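(* Let $F:\mathbb{T}^d\to\mathbb{T}^d$ be a measure-preserving $C^1$ map, and assume the noise generating density $g$ satisfies, for some $\alpha\in(0,2]$, either $\int_{\mathbb{R}^d}|x|^\alpha g(x)dx<\infty$ or $1-\hat g(\xi)\sim|\xi|^\alpha$ as $\xi\to0$. (i) If $\|DF\|_\infty>1$, then there exists a constant $c$ such that for all sufficiently small $\varepsilon>0$, $\tau_*\ge\frac{\alpha\wedge1}{\ln\|DF\|_\infty}\ln(\varepsilon^{-1})+c$. If $\mu_F>1$, then there exist constants $\mu\ge\mu_F$ and $\tilde c$ such that for all sufficiently small $\varepsilon>0$, $\tilde\tau_*\ge\frac{\alpha\wedge1}{\ln\mu}\ln(\varepsilon^{-1})+\tilde c$. If $F$ is a $C^1$ diffeomorphism, these statements hold with $\|DF\|_\infty$ replaced by $\min(\|DF\|_\infty,\|D(F^{-1})\|_\infty)$, resp. with some $\mu\ge\min(\mu_F,\mu_{F^{-1}})$. (ii) If $\|DF\|_\infty=1$, then $\tau_*\gtrsim\varepsilon^{-(\alpha\wedge1)}$. If moreover $g$ satisfies $1-\hat g(\xi)\sim|\xi|^\alpha$ as $\xi\to0$ with $\alpha\in(0,1]$, then $\tau_*\sim\varepsilon^{-\alpha}$. (iii) If $\mu_F=1$ and there are $A>0$, $\beta>0$ with $\|DF^n\|_\infty\le An^\beta$ for all $n\in\mathbb{N}$, then $\tilde\tau_*\gtrsim\varepsilon^{-(\alpha\wedge1)/\beta}$. If $\|DF^n\|_\infty$ is bounded uniformly in $n$, then $\tilde\tau_*=\infty$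 for all sufficiently small $\varepsilon>0$.
   Context: $\mathbb{T}^d=\mathbb{R}^d/\mathbb{Z}^d$ with Lebesgue measure $m$; $F$ measure-preserving means $m(F^{-1}B)=m(B)$ for all Borel $B$. $L^2_0$: zero-mean $L^2$ functions, $\|\cdot\|$ operator norm. $U_Ff=f\circ F$. A noise generating density is a probability density $g\in L^1(\mathbb{R}^d)$ with $g(-x)=g(x)$, $\hat g(\xi)=\int g(x)e^{-2\pi ix\cdot\xi}dx$; for $\varepsilon>0$, $G_\varepsilon f=\tilde g_\varepsilon*f$, $\tilde g_\varepsilon(x)=\sum_{n\in\mathbb{Z}^d}\varepsilon^{-d}g((x+n)/\varepsilon)$. $T_\varepsilon=G_\varepsilon U_F$, $\tilde T^{(n)}_\varepsilon=G_\varepsilon U_F^nG_\varepsilon$; $\tau_*=\min\{n\in\mathbb{N}:\|T_\varepsilon^n\|<e^{-1}\}$, $\tilde\tau_*=\min\{n\in\mathbb{N}:\|\tilde T^{(n)}_\varepsilon\|<e^{-1}\}$ ($=\infty$ if no such $n$). $DF(x)$ is the tangent map represented as a $d\times d$ matrix in the Cartesian basis, $|DF(x)|$ its Euclidean operator norm, $\|DF^n\|_\infty=\sup_x|DF^n(x)|$, and $\mu_F=\limsup_{n\to\infty}\|DF^n\|_\infty^{1/n}$. $\alpha\wedge1=\min\{\alpha,1\}$. $a_\varepsilon\lesssim b_\varepsilon$ means $\limsup_{\varepsilon\to0}a_\varepsilon/b_\varepsilon<\infty$, $a_\varepsilon\gtrsim b_\varepsilon$ means $b_\varepsilon\lesssim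 a_\varepsilon$, and $a_\varepsilon\sim b_\varepsilon$ means both; $a(\xi)\sim b(\xi)$ as $\xi\to0$ means both ratios stay bounded. *)

theory Defs
  imports "HOL-Analysis.Analysis"
begin

text \<open>The torus T^d is modelled by R^d = real^'d modulo the lattice Z^d.
 Functions on T^d are Z^d-periodic functions on R^d, the Lebesgue measure
 on T^d is Lebesgue measure on the fundamental cube [0,1)^d.
 A map F of T^d is represented by a lift F : R^d -> R^d with
 F(x+k) - F(x) in Z^d for all k in Z^d.\<close>

definition lattice :: "(real^'d) set" where
  "lattice = {k. \<forall>i. k $ i \<in> \<int>}"

definition lat_vec :: "int^'d \<Rightarrow> real^'d" where
  "lat_vec n = (\<chi> i. of_int (n $ i))"

definition cube :: "(real^'d) set" where
  "cube = {x. \<forall>i. 0 \<le> x $ i \<and> x $ i < 1}"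

definition periodic_fun :: "(real^'d \<Rightarrow> 'b) \<Rightarrow> bool" where
  "periodic_fun f \<longleftrightarrow> (\<forall>x k. k \<in> lattice \<longrightarrow> f (x + k) = f x)"

definition periodic_set :: "(real^'d) set \<Rightarrow> bool" where
  "periodic_set B \<longleftrightarrow> (\<forall>x k. k \<in> lattice \<longrightarrow> (x + k \<in> B \<longleftrightarrow> x \<in> B))"

definition torus_lift :: "(real^'d \<Rightarrow> real^'d) \<Rightarrow> bool" where
  "torus_lift F \<longleftrightarrow> (\<forall>x k. k \<in> lattice \<longrightarrow> F (x + k) - F x \<in> lattice)"

definition C1_map :: "(real^'d \<Rightarrow> real^'d) \<Rightarrow> bool" where
  "C1_map F \<longleftrightarrow> (\<exists>F'. (\<forall>x. (F has_derivative blinfun_apply (F' x)) (at x))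
                      \<and> continuous_on UNIV F')"

definition torus_measure_preserving :: "(real^'d \<Rightarrow> real^'d) \<Rightarrow> bool" where
  "torus_measure_preserving F \<longleftrightarrow>
     (\<forall>B \<in> sets borel. periodic_set B \<longrightarrow>
        emeasure lborel (cube \<inter> F -` B) = emeasure lborel (cube \<inter> B))"

definition torus_C1_diffeo :: "(real^'d \<Rightarrow> real^'d) \<Rightarrow> bool" where
  "torus_C1_diffeo F \<longleftrightarrow> torus_lift F \<and> C1_map F \<and> bij F
      \<and> torus_lift (inv F) \<and> C1_map (inv F)"

definition normD :: "(real^'d \<Rightarrow> real^'d) \<Rightarrow> nat \<Rightarrow> real" where
  "normD F n = (SUP x. onorm (frechet_derivative (F ^^ n) (at x)))"

definition muF :: "(real^'d \<Rightarrow> real^'d) \<Rightarrow> ereal" where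
  "muF F = limsup (\<lambda>n. ereal (normD F n powr (1 / real n)))"

definition noise_density :: "(real^'d \<Rightarrow> real) \<Rightarrow> bool" where
  "noise_density g \<longleftrightarrow> g \<in> borel_measurable lborel \<and> (\<forall>x. 0 \<le> g x)
     \<and> integrable lborel g \<and> integral\<^sup>L lborel g = 1 \<and> (\<forall>x. g (- x) = g x)"

definition ghat :: "(real^'d \<Rightarrow> real) \<Rightarrow> real^'d \<Rightarrow> complex" where
  "ghat g \<xi> = (LINT x|lborel. complex_of_real (g x) * cis (- 2 * pi * (x \<bullet> \<xi>)))"

definition fourier_asymp :: "(real^'d \<Rightarrow> real) \<Rightarrow> real \<Rightarrow> bool" where
  "fourier_asymp g \<alpha> \<longleftrightarrow> (\<exists>C>0. \<exists>\<delta>>0. \<forall>\<xi>. 0 < norm \<xi> \<and> norm \<xi> < \<delta> \<longrightarrow>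
      norm (1 - ghat g \<xi>) \<le> C * norm \<xi> powr \<alpha> \<and> norm \<xi> powr \<alpha> \<le> C * norm (1 - ghat g \<xi>))"

definition moment_finite :: "(real^'d \<Rightarrow> real) \<Rightarrow> real \<Rightarrow> bool" where
  "moment_finite g \<alpha> \<longleftrightarrow> integrable lborel (\<lambda>x. norm x powr \<alpha> * g x)"

definition gtilde :: "(real^'d \<Rightarrow> real) \<Rightarrow> real \<Rightarrow> real^'d \<Rightarrow> real" where
  "gtilde g \<epsilon> x = (\<Sum>\<^sub>\<infinity>n\<in>(UNIV :: (int^'d) set).
       \<epsilon> powr (- real CARD('d)) * g ((1 / \<epsilon>) *\<^sub>R (x + lat_vec n)))"

definition Gop :: "(real^'d \<Rightarrow> real) \<Rightarrow> real \<Rightarrow> (real^'d \<Rightarrow> real) \<Rightarrow> (real^'d \<Rightarrow> real)" where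
  "Gop g \<epsilon> f = (\<lambda>x. LINT y:cube|lborel. gtilde g \<epsilon> (x - y) * f y)"

definition Uop :: "(real^'d \<Rightarrow> real^'d) \<Rightarrow> (real^'d \<Rightarrow> real) \<Rightarrow> (real^'d \<Rightarrow> real)" where
  "Uop F f = f \<circ> F"

definition L2_0 :: "(real^'d \<Rightarrow> real) set" where
  "L2_0 = {f. periodic_fun f \<and> f \<in> borel_measurable lborel
            \<and> set_integrable lborel cube (\<lambda>x. (f x)\<^sup>2)
            \<and> (LINT x:cube|lborel. f x) = 0}"

definition L2norm :: "(real^'d \<Rightarrow> real) \<Rightarrow> real" where
  "L2norm f = sqrt (LINT x:cube|lborel. (f x)\<^sup>2)"

definition opnorm :: "((real^'d \<Rightarrow> real) \<Rightarrow> (real^'d \<Rightarrow> real)) \<Rightarrow> real" where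
  "opnorm T = Sup {L2norm (T f) | f. f \<in> L2_0 \<and> L2norm f \<le> 1}"

definition Top :: "(real^'d \<Rightarrow> real) \<Rightarrow> (real^'d \<Rightarrow> real^'d) \<Rightarrow> real
                   \<Rightarrow> (real^'d \<Rightarrow> real) \<Rightarrow> (real^'d \<Rightarrow> real)" where
  "Top g F \<epsilon> = Gop g \<epsilon> \<circ> Uop F"

definition Ttilde :: "(real^'d \<Rightarrow> real) \<Rightarrow> (real^'d \<Rightarrow> real^'d) \<Rightarrow> real \<Rightarrow> nat
                   \<Rightarrow> (real^'d \<Rightarrow> real) \<Rightarrow> (real^'d \<Rightarrow> real)" where
  "Ttilde g F \<epsilon> n = Gop g \<epsilon> \<circ> Uop (F ^^ n) \<circ> Gop g \<epsilon>"

definition tau :: "(real^'d \<Rightarrow> real) \<Rightarrow> (real^'d \<Rightarrow> real^'d) \<Rightarrow> real \<Rightarrow> ereal" where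
  "tau g F \<epsilon> = (if \<exists>n\<ge>1. opnorm (Top g F \<epsilon> ^^ n) < exp (-1)
     then ereal (real (LEAST n. n \<ge> 1 \<and> opnorm (Top g F \<epsilon> ^^ n) < exp (-1))) else \<infinity>)"

definition tau_tilde :: "(real^'d \<Rightarrow> real) \<Rightarrow> (real^'d \<Rightarrow> real^'d) \<Rightarrow> real \<Rightarrow> ereal" where
  "tau_tilde g F \<epsilon> = (if \<exists>n\<ge>1. opnorm (Ttilde g F \<epsilon> n) < exp (-1)
     then ereal (real (LEAST n. n \<ge> 1 \<and> opnorm (Ttilde g F \<epsilon> n) < exp (-1))) else \<infinity>)"

end

theory Submission
  imports Defs
begin

text \<open>
Lower bounds. Put \<open>u\<^sub>j = T\<^sub>\<epsilon>\<^sup>j \<phi>\<close> for a trigonometric observable \<open>\<phi>\<close> of norm one. Averaging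
does not increase Lipschitz constants, so \<open>u\<^sub>j\<close> is Lipschitz with constant \<open>L \<parallel>DF\<parallel>\<^sup>j\<close>, and one application
of \<open>G\<^sub>\<epsilon>\<close> to a function \<open>u\<close> with Lipschitz constant \<open>K\<close> loses at most
\<open>\<parallel>u\<parallel>\<^sup>2 - \<parallel>G\<^sub>\<epsilon> u\<parallel>\<^sup>2 \<le> 2 \<langle>u - G\<^sub>\<epsilon> u, u\<rangle> = \<integral> g(z) \<parallel>u(\<cdot> + \<epsilon> z) - u\<parallel>\<^sup>2 dz\<close>, which is of order
\<open>(\<epsilon> K)\<close> to the power \<open>\<gamma> = min \<alpha> 1\<close>. Hence \<open>\<parallel>T\<^sub>\<epsilon>\<^sup>n\<parallel>\<close> stays away from \<open>0\<close> until
\<open>\<Sum>\<^sub>j (\<epsilon> \<parallel>DF\<parallel>\<^sup>j)\<^sup>\<gamma>\<close>, the sum over \<open>j \<le> n\<close>, is of order one. Measuring the loss by the quadratic form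
rather than by \<open>\<parallel>u - G\<^sub>\<epsilon> u\<parallel>\<close> lets the argument cover heavy tails, including \<open>\<alpha> = 1\<close>. For the coarse-grained
operators only two losses occur, and for diffeomorphisms the adjoint of \<open>T\<^sub>\<epsilon>\<^sup>n\<close> is treated in the same way.

Upper bound. On mean-zero functions \<open>\<parallel>G\<^sub>\<epsilon>\<parallel>\<close> is at most the supremum of \<open>|ghat g (\<epsilon> m)|\<close> over
nonzero lattice points \<open>m\<close>, which is at most \<open>1 - c \<epsilon>\<^sup>\<alpha>\<close>, while \<open>U\<^sub>F\<close> is an isometry.
\<close>

subsection \<open>The torus as a measure space\<close>

text \<open>Nothing here lives on a quotient: maps are lifts, observables are periodic functions on
  R^d, and operators act on functions rather than on classes. Integrals therefore have to be moved
  between the cube and the whole space, and every change of variables is restricted to periodic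
  integrands. In return R^d is convex, so the mean value inequality applies directly to all iterates
  of the lift.

  In the lower bounds both alternatives for the noise are used only through one inequality,
  \<open>truncated_moment g t \<le> C * t powr \<gamma>\<close>. Under the Fourier hypothesis it is
  recovered by averaging \<open>1 - cos\<close> over a range of frequencies.

  When \<open>\<parallel>DF\<parallel> > 1\<close> the losses grow geometrically, so up to a
  constant factor the last one counts. This yields the rate
  \<open>1 / ln \<parallel>DF\<parallel>\<close>, which implies the stated one because
  \<open>\<gamma> \<le> 1\<close>. For the coarse-grained operators the constant \<mu> is simply
  \<open>\<parallel>DF\<parallel>\<close>, which dominates the growth rate of the iterates by
  submultiplicativity.\<close>

definition torus :: "(real^'d) measure" where
  "torus = density lborel (indicator cube)"

definition frac_vec :: "real^'d \<Rightarrow> real^'d" where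
  "frac_vec x = (\<chi> i. frac (x $ i))"

definition floor_vec :: "real^'d \<Rightarrow> int^'d" where
  "floor_vec x = (\<chi> i. \<lfloor>x $ i\<rfloor>)"

lemma frac_vec_eq: "frac_vec x = x - lat_vec (floor_vec x)"
  by (simp add: frac_vec_def lat_vec_def floor_vec_def vec_eq_iff frac_def)

lemma lat_vec_in_lattice [simp]: "lat_vec n \<in> lattice"
  by (simp add: lat_vec_def lattice_def)

lemma lattice_eq_range_lat_vec: "lattice = range lat_vec"
proof (intro equalityI subsetI)
  fix k :: "real^'d" assume k: "k \<in> lattice"
  have "k = lat_vec (floor_vec k)"
    using k by (auto simp: lat_vec_def floor_vec_def vec_eq_iff lattice_def elim!: Ints_cases)
  then show "k \<in> range lat_vec" by blast
qed auto

lemma lat_vec_add: "lat_vec (m + n) = lat_vec m + lat_vec n"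
  and lat_vec_minus: "lat_vec (- n) = - lat_vec n"
  and lat_vec_diff: "lat_vec (m - n) = lat_vec m - lat_vec n"
  and lat_vec_0 [simp]: "lat_vec 0 = 0"
  by (simp_all add: lat_vec_def vec_eq_iff)

lemma lattice_uminus: "k \<in> lattice \<Longrightarrow> - k \<in> lattice"
  by (simp add: lattice_def)

lemma frac_vec_in_cube [simp]: "frac_vec x \<in> cube"
  by (simp add: frac_vec_def cube_def frac_ge_0 frac_lt_1)

lemma frac_vec_cube [simp]: "x \<in> cube \<Longrightarrow> frac_vec x = x"
  by (simp add: frac_vec_def cube_def vec_eq_iff frac_eq)

lemma periodic_fun_diff:
  assumes "periodic_fun f" "k \<in> lattice"
  shows "f (x - k) = f x"
  using assms lattice_uminus[of k] by (metis periodic_fun_def uminus_add_conv_diff add.commute)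

lemma periodic_fun_frac_vec: "periodic_fun f \<Longrightarrow> f (frac_vec x) = f x"
  by (simp add: frac_vec_eq periodic_fun_diff)

lemma periodic_fun_comp_lift:
  fixes S :: "real^'d \<Rightarrow> real^'d"
  assumes "periodic_fun f" "torus_lift S"
  shows "periodic_fun (\<lambda>x. f (S x))"
  unfolding periodic_fun_def
proof safe
  fix x k :: "real^'d" assume "k \<in> lattice"
  then have "S (x + k) - S x \<in> lattice" using assms(2) by (simp add: torus_lift_def)
  then have "f (S x + (S (x + k) - S x)) = f (S x)"
    using assms(1) by (simp only: periodic_fun_def)
  then show "f (S (x + k)) = f (S x)" by simp
qed

lemma borel_measurable_vec_nth [measurable]: "(\<lambda>x::real^'d. x $ i) \<in> borel_measurable borel"
  by (intro borel_measurable_continuous_onI continuous_intros)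

lemma borel_measurable_vec_lambda:
  assumes "\<And>i. (\<lambda>x. f x i) \<in> borel_measurable M"
  shows "(\<lambda>x. (\<chi> i. f x i) :: real^'d) \<in> borel_measurable M"
proof (subst borel_measurable_euclidean_space, rule ballI)
  fix b :: "real^'d" assume "b \<in> Basis"
  then obtain i where b: "b = axis i 1" by (auto simp: Basis_vec_def)
  show "(\<lambda>x. (\<chi> i. f x i) \<bullet> b) \<in> borel_measurable M"
    using assms[of i] by (simp add: b inner_axis)
qed

lemma frac_vec_measurable [measurable]: "frac_vec \<in> borel \<rightarrow>\<^sub>M borel"
  unfolding frac_vec_def frac_def
  by (intro borel_measurable_vec_lambda) measurable

lemma cube_measurable [measurable]: "cube \<in> sets borel"
proof -
  have "cube = {x::real^'d. \<forall>i\<in>UNIV. 0 \<le> x $ i \<and> x $ i < 1}" by (auto simp: cube_def)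
  also have "\<dots> \<in> sets borel" by measurable
  finally show ?thesis .
qed

text \<open>A density on \<open>lborel\<close> instead of a restriction to the cube keeps the whole
  space and the full Borel algebra, so periodic functions on R^d stay integrands as they
  are.\<close>

lemma sets_torus [simp, measurable_cong]: "sets torus = sets borel"
  and space_torus [simp]: "space torus = UNIV"
  by (simp_all add: torus_def)

lemma measurable_torus [simp]: "measurable torus N = measurable borel N"
  by (rule measurable_cong_sets) auto

text \<open>The half-open cube lies between the open and the closed unit box, which have the same
  volume.\<close>

lemma emeasure_cube: "emeasure lborel (cube :: (real^'d) set) = 1"
proof -
  have One: "One = ((\<chi> i. 1) :: real^'d)"
  proof -
    have "One $ i = (1::real)" for i :: 'd
      using inner_sum_Basis[of "axis i 1 :: real^'d"] by (simp only: cart_eq_inner_axis axis_in_Basis_iff) simp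
    then show ?thesis by (simp add: vec_eq_iff)
  qed
  have sub: "box 0 One \<subseteq> (cube::(real^'d) set)" "(cube::(real^'d) set) \<subseteq> cbox 0 One"
    unfolding One cube_def subset_iff mem_box_cart by (simp_all add: less_imp_le)
  have "emeasure lborel (box 0 (One::real^'d)) \<le> emeasure lborel (cube::(real^'d) set)"
    by (intro emeasure_mono sub) auto
  moreover have "emeasure lborel (cube::(real^'d) set) \<le> emeasure lborel (cbox 0 (One::real^'d))"
    by (intro emeasure_mono sub) auto
  ultimately show ?thesis
    by (simp add: emeasure_lborel_box_eq emeasure_lborel_cbox_eq)
qed

lemma emeasure_torus_UNIV [simp]: "emeasure torus UNIV = 1"
  by (simp add: torus_def emeasure_density emeasure_cube)

lemma measure_torus_UNIV [simp]: "measure torus UNIV = 1"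
  by (simp add: measure_def)

interpretation torus: finite_measure torus
  by standard simp

lemma nn_integral_torus:
  "f \<in> borel_measurable borel \<Longrightarrow> (\<integral>\<^sup>+x. f x \<partial>torus) = (\<integral>\<^sup>+x. f x * indicator cube x \<partial>lborel)"
  by (simp add: torus_def nn_integral_density mult.commute)

lemma emeasure_torus:
  "A \<in> sets borel \<Longrightarrow> emeasure torus A = emeasure lborel (cube \<inter> A)"
  by (simp add: torus_def emeasure_density flip: indicator_inter_arith)

lemma lebesgue_integral_torus:
  fixes f :: "real^'d \<Rightarrow> 'b::{banach, second_countable_topology}"
  assumes "f \<in> borel_measurable borel"
  shows "(LINT x:cube|lborel. f x) = (\<integral>x. f x \<partial>torus)"
proof -
  have *: "density lborel (indicator cube) = density lborel (\<lambda>x::real^'d. ennreal (indicator cube x))"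
    by (simp add: ennreal_indicator)
  show ?thesis
    unfolding torus_def set_lebesgue_integral_def *
    using assms by (subst integral_density) auto
qed

lemma set_integrable_torus:
  fixes f :: "real^'d \<Rightarrow> 'b::{banach, second_countable_topology}"
  assumes "f \<in> borel_measurable borel"
  shows "set_integrable lborel cube f \<longleftrightarrow> integrable torus f"
proof -
  have *: "density lborel (indicator cube) = density lborel (\<lambda>x::real^'d. ennreal (indicator cube x))"
    by (simp add: ennreal_indicator)
  show ?thesis
    unfolding torus_def set_integrable_def *
    using assms by (subst integrable_density) auto
qed

section \<open>Tiling of R^d by translates of the cube, and maps preserving the torus
  measure\<close>

lemma nn_integral_lattice_indicator:
  fixes c :: ennreal and x :: "real^'d"
  shows "(\<integral>\<^sup>+n. c * indicator cube (x - lat_vec n) \<partial>count_space UNIV) = c"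
proof -
  \<comment> \<open>The translates of the half-open cube tile without overlap, so a single lattice
    vector contributes: the coordinatewise floor.\<close>
  have "x - lat_vec n \<in> cube \<longleftrightarrow> n = floor_vec x" for n
  proof -
    have "0 \<le> x $ i - of_int (n $ i) \<and> x $ i - of_int (n $ i) < 1 \<longleftrightarrow> n $ i = \<lfloor>x $ i\<rfloor>" for i
      using floor_eq_iff[of "x $ i" "n $ i"] by linarith
    then show ?thesis by (simp add: cube_def lat_vec_def floor_vec_def vec_eq_iff)
  qed
  then have "(\<integral>\<^sup>+n. c * indicator cube (x - lat_vec n) \<partial>count_space UNIV)
     = (\<integral>\<^sup>+n. c * indicator {floor_vec x} n \<partial>count_space UNIV)"
    by (intro nn_integral_cong) (auto simp: indicator_def)
  then show ?thesis by simp
qed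

lemma nn_integral_lborel_add:
  fixes f :: "'a::euclidean_space \<Rightarrow> ennreal"
  assumes "f \<in> borel_measurable borel"
  shows "(\<integral>\<^sup>+x. f (x + a) \<partial>lborel) = (\<integral>\<^sup>+x. f x \<partial>lborel)"
  using assms by (subst (2) lborel_distr_plus[of a, symmetric]) (simp add: nn_integral_distr add.commute)

lemma nn_integral_lborel_uminus:
  fixes f :: "'a::euclidean_space \<Rightarrow> ennreal"
  assumes "f \<in> borel_measurable borel"
  shows "(\<integral>\<^sup>+x. f (- x) \<partial>lborel) = (\<integral>\<^sup>+x. f x \<partial>lborel)"
  using assms by (subst (2) lborel_affine[of "-1" 0]) (simp_all add: nn_integral_distr density_1)

text \<open>Inserting the indicators of the tiles, which sum to one, breaks the integral over R^d
  into integrals over cubes, each moved back to the fundamental one. Values in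
  \<open>ennreal\<close> make every exchange of sum and integral legitimate.\<close>

lemma nn_integral_unfold_torus:
  fixes h :: "real^'d \<Rightarrow> ennreal"
  assumes [measurable]: "h \<in> borel_measurable borel"
  shows "(\<integral>\<^sup>+x. h x \<partial>lborel) = (\<integral>\<^sup>+x. (\<integral>\<^sup>+n. h (x + lat_vec n) \<partial>count_space UNIV) \<partial>torus)"
proof -
  have "(\<integral>\<^sup>+x. h x \<partial>lborel)
      = (\<integral>\<^sup>+x. (\<integral>\<^sup>+n. h x * indicator cube (x - lat_vec n) \<partial>count_space UNIV) \<partial>lborel)"
    by (simp add: nn_integral_lattice_indicator)
  also have "\<dots> = (\<integral>\<^sup>+n. (\<integral>\<^sup>+x. h x * indicator cube (x - lat_vec n) \<partial>lborel) \<partial>count_space UNIV)"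
    by (rule nn_integral_count_space_nn_integral) auto
  also have "\<dots> = (\<integral>\<^sup>+n. (\<integral>\<^sup>+x. h (x + lat_vec n) * indicator cube x \<partial>lborel) \<partial>count_space UNIV)"
  proof (rule nn_integral_cong)
    fix n :: "int^'d"
    show "(\<integral>\<^sup>+x. h x * indicator cube (x - lat_vec n) \<partial>lborel)
        = (\<integral>\<^sup>+x. h (x + lat_vec n) * indicator cube x \<partial>lborel)"
      by (subst nn_integral_lborel_add[of _ "lat_vec n", symmetric]) auto
  qed
  also have "\<dots> = (\<integral>\<^sup>+n. (\<integral>\<^sup>+x. h (x + lat_vec n) \<partial>torus) \<partial>count_space UNIV)"
    by (simp add: nn_integral_torus)
  also have "\<dots> = (\<integral>\<^sup>+x. (\<integral>\<^sup>+n. h (x + lat_vec n) \<partial>count_space UNIV) \<partial>torus)"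
    by (rule nn_integral_count_space_nn_integral[symmetric]) auto
  finally show ?thesis .
qed

text \<open>Invariance is tested on nonnegative periodic functions because a lift need not map the
  cube into itself; only periodic observables have a meaning on the torus. In this form it is closed
  under composition and covers translations and reflections as well as \<open>F\<close>.\<close>

definition mpres :: "(real^'d \<Rightarrow> real^'d) \<Rightarrow> bool" where
  "mpres S \<longleftrightarrow> S \<in> borel \<rightarrow>\<^sub>M borel \<and> torus_lift S
     \<and> (\<forall>\<phi>::real^'d \<Rightarrow> ennreal. \<phi> \<in> borel_measurable borel \<longrightarrow> periodic_fun \<phi> \<longrightarrow>
          (\<integral>\<^sup>+x. \<phi> (S x) \<partial>torus) = (\<integral>\<^sup>+x. \<phi> x \<partial>torus))"

lemma mpres_measurable: "mpres S \<Longrightarrow> S \<in> borel \<rightarrow>\<^sub>M borel"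
  and mpres_lift: "mpres S \<Longrightarrow> torus_lift S"
  and mpres_nn_integral: "mpres S \<Longrightarrow> \<phi> \<in> borel_measurable borel \<Longrightarrow> periodic_fun \<phi> \<Longrightarrow>
    (\<integral>\<^sup>+x. \<phi> (S x) \<partial>torus) = (\<integral>\<^sup>+x. \<phi> x \<partial>torus)" for \<phi> :: "real^'d \<Rightarrow> ennreal"
  by (auto simp: mpres_def)

text \<open>Reducing the values of the lift modulo the lattice produces a genuine map into the cube,
  to which the transport theorems for Bochner integrals apply.\<close>

lemma mpres_distr:
  assumes "mpres (S::real^'d \<Rightarrow> real^'d)"
  shows "distr torus borel (\<lambda>x. frac_vec (S x)) = torus"
proof (rule measure_eqI)
  have [measurable]: "S \<in> borel \<rightarrow>\<^sub>M borel" using assms by (rule mpres_measurable)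
  fix A :: "(real^'d) set" assume "A \<in> sets (distr torus borel (\<lambda>x. frac_vec (S x)))"
  then have [measurable]: "A \<in> sets borel" by simp
  have "emeasure (distr torus borel (\<lambda>x. frac_vec (S x))) A
      = (\<integral>\<^sup>+x. indicator A (frac_vec (S x)) \<partial>torus)"
    by (simp add: nn_integral_indicator[symmetric] nn_integral_distr del: nn_integral_indicator)
  also have "\<dots> = (\<integral>\<^sup>+x. indicator A (frac_vec x) \<partial>torus)"
  proof (rule mpres_nn_integral[OF assms])
    show "periodic_fun (\<lambda>x. indicator A (frac_vec x))"
      by (auto simp: periodic_fun_def lattice_def frac_vec_def frac_def indicator_def vec_eq_iff elim!: Ints_cases)
  qed measurable
  also have "\<dots> = (\<integral>\<^sup>+x. indicator A x \<partial>torus)"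
    by (simp only: nn_integral_torus borel_measurable_indicator measurable_compose[OF frac_vec_measurable]
         \<open>A \<in> sets borel\<close>) (auto intro!: nn_integral_cong simp: indicator_def)
  finally show "emeasure (distr torus borel (\<lambda>x. frac_vec (S x))) A = emeasure torus A"
    by simp
qed simp

lemma mpres_integrable:
  fixes f :: "real^'d \<Rightarrow> 'b::{banach, second_countable_topology}"
  assumes S: "mpres S" and f: "f \<in> borel_measurable borel" "periodic_fun f"
  shows "integrable torus (\<lambda>x. f (S x)) \<longleftrightarrow> integrable torus f"
proof -
  have [measurable]: "S \<in> borel \<rightarrow>\<^sub>M borel" using S by (rule mpres_measurable)
  have "integrable torus (\<lambda>x. f (frac_vec (S x))) \<longleftrightarrow>
        integrable (distr torus borel (\<lambda>x. frac_vec (S x))) f"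
    using f(1) by (subst integrable_distr_eq) auto
  then show ?thesis by (simp add: mpres_distr[OF S] periodic_fun_frac_vec[OF f(2)])
qed

lemma mpres_integral:
  fixes f :: "real^'d \<Rightarrow> 'b::{banach, second_countable_topology}"
  assumes S: "mpres S" and f: "f \<in> borel_measurable borel" "periodic_fun f"
  shows "(\<integral>x. f (S x) \<partial>torus) = (\<integral>x. f x \<partial>torus)"
proof -
  have [measurable]: "S \<in> borel \<rightarrow>\<^sub>M borel" using S by (rule mpres_measurable)
  have "(\<integral>x. f (frac_vec (S x)) \<partial>torus) =
        integral\<^sup>L (distr torus borel (\<lambda>x. frac_vec (S x))) f"
    using f(1) by (subst integral_distr) auto
  then show ?thesis by (simp add: mpres_distr[OF S] periodic_fun_frac_vec[OF f(2)])
qed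

text \<open>A translated cube is again a fundamental domain: after unfolding, the lattice translates
  of its indicator still sum to one.\<close>

lemma mpres_translation: "mpres (\<lambda>x::real^'d. x + a)"
  unfolding mpres_def
proof (intro conjI allI impI)
  show "torus_lift (\<lambda>x. x + a)" by (simp add: torus_lift_def)
  fix \<phi> :: "real^'d \<Rightarrow> ennreal"
  assume [measurable]: "\<phi> \<in> borel_measurable borel" and p: "periodic_fun \<phi>"
  have "(\<integral>\<^sup>+x. \<phi> (x + a) \<partial>torus) = (\<integral>\<^sup>+x. \<phi> (x + a) * indicator cube ((x + a) - a) \<partial>lborel)"
    by (simp add: nn_integral_torus)
  also have "\<dots> = (\<integral>\<^sup>+x. \<phi> x * indicator cube (x - a) \<partial>lborel)"
    by (rule nn_integral_lborel_add[of "\<lambda>x. \<phi> x * indicator cube (x - a)" a]) measurable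
  also have "\<dots> = (\<integral>\<^sup>+x. (\<integral>\<^sup>+n. \<phi> x * indicator cube ((x - a) - lat_vec (- n)) \<partial>count_space UNIV) \<partial>torus)"
    using p by (subst nn_integral_unfold_torus)
      (auto simp: periodic_fun_def lat_vec_minus algebra_simps)
  also have "\<dots> = (\<integral>\<^sup>+x. (\<integral>\<^sup>+n. \<phi> x * indicator cube ((x - a) - lat_vec n) \<partial>count_space UNIV) \<partial>torus)"
    by (intro nn_integral_cong nn_integral_bij_count_space) (auto intro!: bij_uminus)
  also have "\<dots> = (\<integral>\<^sup>+x. \<phi> x \<partial>torus)"
    by (simp add: nn_integral_lattice_indicator)
  finally show "(\<integral>\<^sup>+x. \<phi> (x + a) \<partial>torus) = (\<integral>\<^sup>+x. \<phi> x \<partial>torus)" .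
qed simp

text \<open>The reflected cube is also a fundamental domain, half-open on the opposite sides, so no
  boundary null set has to be discussed.\<close>

lemma mpres_uminus: "mpres (\<lambda>x::real^'d. - x)"
  unfolding mpres_def
proof (intro conjI allI impI)
  show "torus_lift (\<lambda>x. - x)" by (simp add: torus_lift_def lattice_def)
  fix \<phi> :: "real^'d \<Rightarrow> ennreal"
  assume [measurable]: "\<phi> \<in> borel_measurable borel" and p: "periodic_fun \<phi>"
  have "(\<integral>\<^sup>+x. \<phi> (- x) \<partial>torus) = (\<integral>\<^sup>+x. \<phi> (- x) * indicator cube (- (- x)) \<partial>lborel)"
    by (simp add: nn_integral_torus)
  also have "\<dots> = (\<integral>\<^sup>+x. \<phi> x * indicator cube (- x) \<partial>lborel)"
    by (rule nn_integral_lborel_uminus[of "\<lambda>x. \<phi> x * indicator cube (- x)"]) measurable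
  also have "\<dots> = (\<integral>\<^sup>+x. (\<integral>\<^sup>+n. \<phi> x * indicator cube (- x - lat_vec n) \<partial>count_space UNIV) \<partial>torus)"
    using p by (subst nn_integral_unfold_torus)
      (auto simp: periodic_fun_def lat_vec_minus algebra_simps)
  also have "\<dots> = (\<integral>\<^sup>+x. \<phi> x \<partial>torus)"
    by (simp add: nn_integral_lattice_indicator)
  finally show "(\<integral>\<^sup>+x. \<phi> (- x) \<partial>torus) = (\<integral>\<^sup>+x. \<phi> x \<partial>torus)" .
qed simp

lemma mpres_comp:
  fixes S T :: "real^'d \<Rightarrow> real^'d"
  assumes "mpres S" "mpres T" shows "mpres (\<lambda>x. S (T x))"
proof -
  note [measurable] = assms[THEN mpres_measurable]
  have p: "periodic_fun (\<lambda>x. \<phi> (S x))" if "periodic_fun \<phi>" for \<phi> :: "real^'d \<Rightarrow> ennreal"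
    using that assms(1) by (simp add: mpres_lift periodic_fun_comp_lift)
  have "torus_lift (\<lambda>x. S (T x))" unfolding torus_lift_def
  proof safe
    fix x k :: "real^'d" assume "k \<in> lattice"
    then have "T (x + k) - T x \<in> lattice" using assms(2) by (simp add: mpres_def torus_lift_def)
    then have "S (T x + (T (x + k) - T x)) - S (T x) \<in> lattice"
      using assms(1) unfolding mpres_def torus_lift_def by blast
    then show "S (T (x + k)) - S (T x) \<in> lattice" by simp
  qed
  then show ?thesis
    using p by (simp add: mpres_def[of "\<lambda>x. S (T x)"] mpres_nn_integral[OF assms(1)]
       mpres_nn_integral[OF assms(2), of "\<lambda>x. _ (S x)"])
qed

lemma mpres_reflection: "mpres (\<lambda>y. x - y)"
  using mpres_comp[OF mpres_translation[of x] mpres_uminus] by simp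

text \<open>The hypothesis speaks of periodic sets only. A Borel set \<open>A\<close> is therefore
  replaced by its preimage under \<open>frac_vec\<close>, which is periodic and meets the cube in
  the same points as \<open>A\<close>.\<close>

lemma mpresI_torus_measure_preserving:
  fixes S :: "real^'d \<Rightarrow> real^'d"
  assumes S: "torus_lift S" "S \<in> borel \<rightarrow>\<^sub>M borel" and mp: "torus_measure_preserving S"
  shows "mpres S"
  unfolding mpres_def
proof (intro conjI allI impI S)
  note [measurable] = S(2)
  have d: "distr torus borel (\<lambda>x. frac_vec (S x)) = torus"
  proof (rule measure_eqI)
    fix A :: "(real^'d) set" assume "A \<in> sets (distr torus borel (\<lambda>x. frac_vec (S x)))"
    then have [measurable]: "A \<in> sets borel" by simp
    have B: "frac_vec -` A \<in> sets borel"
      using measurable_sets[OF frac_vec_measurable \<open>A \<in> sets borel\<close>] by simp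
    have SB: "S -` (frac_vec -` A) \<in> sets borel"
      using measurable_sets[OF S(2) B] by simp
    have "periodic_set (frac_vec -` A)"
      by (auto simp: periodic_set_def lattice_def frac_vec_def frac_def elim!: Ints_cases)
    with mp B have "emeasure lborel (cube \<inter> S -` (frac_vec -` A)) = emeasure lborel (cube \<inter> frac_vec -` A)"
      by (simp add: torus_measure_preserving_def)
    also have "cube \<inter> frac_vec -` A = cube \<inter> A" by auto
    finally show "emeasure (distr torus borel (\<lambda>x. frac_vec (S x))) A = emeasure torus A"
      using SB by (simp add: emeasure_distr emeasure_torus vimage_def)
  qed simp
  fix \<phi> :: "real^'d \<Rightarrow> ennreal"
  assume [measurable]: "\<phi> \<in> borel_measurable borel" and p: "periodic_fun \<phi>"
  have "(\<integral>\<^sup>+x. \<phi> (frac_vec (S x)) \<partial>torus) =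
      (\<integral>\<^sup>+x. \<phi> x \<partial>distr torus borel (\<lambda>x. frac_vec (S x)))"
    by (subst nn_integral_distr) auto
  then show "(\<integral>\<^sup>+x. \<phi> (S x) \<partial>torus) = (\<integral>\<^sup>+x. \<phi> x \<partial>torus)"
    by (simp add: d periodic_fun_frac_vec[OF p])
qed

subsection \<open>Convolution with a kernel on the torus\<close>

interpretation torus_pair: pair_sigma_finite torus torus ..

definition L2_torus :: "(real^'d \<Rightarrow> real) set" where
  "L2_torus = {f. f \<in> borel_measurable borel \<and> periodic_fun f \<and> integrable torus (\<lambda>x. (f x)\<^sup>2)}"

definition nsq :: "(real^'d \<Rightarrow> real) \<Rightarrow> real" where
  "nsq f = (\<integral>x. (f x)\<^sup>2 \<partial>torus)"

lemma L2_torusD [dest]: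
  assumes "f \<in> L2_torus"
  shows "f \<in> borel_measurable borel" "periodic_fun f" "integrable torus (\<lambda>x. (f x)\<^sup>2)"
  using assms by (auto simp: L2_torus_def)

lemma nsq_nonneg [simp]: "0 \<le> nsq f"
  by (simp add: nsq_def)

lemma L2norm_eq: "f \<in> borel_measurable borel \<Longrightarrow> L2norm f = sqrt (nsq f)"
  by (simp add: L2norm_def nsq_def lebesgue_integral_torus)

lemma L2_0_iff: "f \<in> L2_0 \<longleftrightarrow> f \<in> L2_torus \<and> (\<integral>x. f x \<partial>torus) = 0"
  by (auto simp: L2_0_def L2_torus_def lebesgue_integral_torus set_integrable_torus)

lemma abs_mult_le_squares: "\<bar>a * b\<bar> \<le> a\<^sup>2 + b\<^sup>2" for a b :: real
proof -
  have "2 * \<bar>a * b\<bar> \<le> a\<^sup>2 + b\<^sup>2"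
    using sum_squares_bound[of "\<bar>a\<bar>" "\<bar>b\<bar>"] by (simp add: abs_mult)
  then show ?thesis using abs_ge_zero[of "a * b"] by linarith
qed

lemma L2_torus_integrable_mult:
  assumes "f \<in> L2_torus" "h \<in> L2_torus"
  shows "integrable torus (\<lambda>x. f x * h x)"
proof (rule Bochner_Integration.integrable_bound)
  show "integrable torus (\<lambda>x. (f x)\<^sup>2 + (h x)\<^sup>2)"
    using assms by (auto dest: L2_torusD)
  have [measurable]: "f \<in> borel_measurable borel" "h \<in> borel_measurable borel" using assms by auto
  show "(\<lambda>x. f x * h x) \<in> borel_measurable torus" by simp
  show "AE x in torus. norm (f x * h x) \<le> norm ((f x)\<^sup>2 + (h x)\<^sup>2)"
    by (simp add: abs_mult_le_squares)
qed

lemma L2_torus_const: "(\<lambda>x. c) \<in> L2_torus"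
  by (simp add: L2_torus_def periodic_fun_def)

lemma L2_torus_integrable: "f \<in> L2_torus \<Longrightarrow> integrable torus f"
  using L2_torus_integrable_mult[OF _ L2_torus_const[of 1]] by simp

lemma L2_torusI_bounded:
  assumes "f \<in> borel_measurable borel" "periodic_fun f" "\<And>x. \<bar>f x\<bar> \<le> B"
  shows "f \<in> L2_torus"
proof -
  have "(f x)\<^sup>2 \<le> B\<^sup>2" for x
    using power_mono[OF assms(3)[of x] abs_ge_zero, of 2] by simp
  then have "integrable torus (\<lambda>x. (f x)\<^sup>2)"
    using assms(1) by (intro torus.integrable_const_bound[of _ "B\<^sup>2"]) auto
  with assms show ?thesis by (simp add: L2_torus_def)
qed

lemma nsq_diff:
  assumes "f \<in> L2_torus" "h \<in> L2_torus"
  shows "(\<integral>x. (f x - h x)\<^sup>2 \<partial>torus) = nsq f + nsq h - 2 * (\<integral>x. f x * h x \<partial>torus)"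
proof -
  note [simp] = L2_torusD(3)[OF assms(1)] L2_torusD(3)[OF assms(2)] L2_torus_integrable_mult[OF assms]
  have "(\<integral>x. (f x - h x)\<^sup>2 \<partial>torus) = (\<integral>x. (f x)\<^sup>2 + (h x)\<^sup>2 - 2 * (f x * h x) \<partial>torus)"
    by (simp add: power2_diff mult.assoc)
  then show ?thesis by (simp add: nsq_def)
qed

text \<open>Cauchy-Schwarz by the discriminant: the square of \<open>f - t * h\<close> has
  nonnegative integral for every real \<open>t\<close>.\<close>

lemma integral_mult_le_nsq:
  assumes "f \<in> L2_torus" "h \<in> L2_torus"
  shows "(\<integral>x. f x * h x \<partial>torus) \<le> sqrt (nsq f) * sqrt (nsq h)"
proof -
  have "2 * t * (\<integral>x. f x * h x \<partial>torus) \<le> nsq f + t\<^sup>2 * nsq h" for t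
  proof -
    have "0 \<le> (\<integral>x. (f x - t * h x)\<^sup>2 \<partial>torus)" by simp
    also have "(\<lambda>x. t * h x) \<in> L2_torus"
      using assms(2) by (auto simp: L2_torus_def periodic_fun_def power_mult_distrib)
    from nsq_diff[OF assms(1) this] have
      "(\<integral>x. (f x - t * h x)\<^sup>2 \<partial>torus) = nsq f + t\<^sup>2 * nsq h - 2 * t * (\<integral>x. f x * h x \<partial>torus)"
      by (simp add: nsq_def power_mult_distrib mult.left_commute)
    finally show ?thesis by simp
  qed
  note * = this
  define I where "I = (\<integral>x. f x * h x \<partial>torus)"
  have I: "2 * t * I \<le> nsq f + t\<^sup>2 * nsq h" for t using * by (simp add: I_def)
  have "I\<^sup>2 \<le> nsq f * nsq h"
  proof (cases "nsq h = 0")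
    case False
    then have pos: "0 < nsq h" by (simp add: less_le)
    have "2 * (I / nsq h) * I \<le> nsq f + (I / nsq h)\<^sup>2 * nsq h" by (rule I)
    then show ?thesis using pos by (simp add: field_simps power2_eq_square)
  next
    case True
    have "I = 0"
    proof (rule ccontr)
      assume "I \<noteq> 0"
      \<comment> \<open>For \<open>nsq h = 0\<close> the inequality is linear in \<open>t\<close>;
        this \<open>t\<close> would give \<open>2 * (nsq f + 1) \<le> nsq f\<close>.\<close>
      then show False using I[of "(nsq f + 1) / I"] True nsq_nonneg[of f] by simp
    qed
    then show ?thesis by simp
  qed
  then show ?thesis
    by (metis I_def real_le_rsqrt real_sqrt_mult)
qed

text \<open>An even probability density on the torus. Evenness makes convolution self-adjoint; total
  mass one makes it an average, so that Jensen's inequality and the preservation of sup and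
  Lipschitz bounds become available.\<close>

locale torus_kernel =
  fixes k :: "real^'d \<Rightarrow> real"
  assumes k_measurable [measurable]: "k \<in> borel_measurable borel"
    and k_nonneg: "\<And>x. 0 \<le> k x"
    and k_periodic: "periodic_fun k"
    and k_even: "\<And>x. k (- x) = k x"
    and k_nn_integral: "(\<integral>\<^sup>+x. k x \<partial>torus) = 1"
begin

definition conv :: "(real^'d \<Rightarrow> real) \<Rightarrow> real^'d \<Rightarrow> real" where
  "conv f x = (\<integral>y. k (x - y) * f y \<partial>torus)"

lemma k_swap: "k (x - y) = k (y - x)"
  using k_even[of "x - y"] by simp

lemma nn_integral_k_diff: "(\<integral>\<^sup>+y. k (x - y) \<partial>torus) = 1"
  using mpres_nn_integral[OF mpres_reflection[of x], of "\<lambda>z. ennreal (k z)"] k_periodic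
  by (simp add: k_nn_integral periodic_fun_def)

lemma integrable_k: "integrable torus k"
  using k_nonneg by (intro integrableI_nn_integral_finite[where x=1]) (auto simp: k_nn_integral)

lemma integrable_k_diff: "integrable torus (\<lambda>y. k (x - y))"
  using k_nonneg by (intro integrableI_nn_integral_finite[where x=1]) (auto simp: nn_integral_k_diff)

lemma integral_k_diff [simp]: "(\<integral>y. k (x - y) \<partial>torus) = 1"
  by (subst integral_eq_nn_integral) (auto simp: nn_integral_k_diff k_nonneg)

lemma conv_measurable [measurable]:
  assumes [measurable]: "f \<in> borel_measurable borel"
  shows "conv f \<in> borel_measurable borel"
proof -
  have "(\<lambda>x. \<integral>y. k (x - y) * f y \<partial>torus) \<in> borel_measurable (torus :: (real^'d) measure)"
    by measurable
  then show ?thesis by (simp add: conv_def[abs_def])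
qed

lemma conv_periodic: "periodic_fun (conv f)"
proof -
  have "k (x + l - y) = k (x - y)" if "l \<in> lattice" for x y l
    using k_periodic that unfolding periodic_fun_def by (metis add_diff_eq add.commute diff_add_eq)
  then show ?thesis by (simp add: periodic_fun_def conv_def)
qed

text \<open>Jensen's inequality, obtained from the nonnegative variance of \<open>f\<close> under
  the probability weight \<open>k (x - y)\<close> about its mean \<open>conv f x\<close>. With the
  right side in \<open>ennreal\<close> the bound holds at every point, including those where it is
  infinite.\<close>

lemma conv_square_le:
  assumes [measurable]: "f \<in> borel_measurable borel"
  shows "ennreal ((conv f x)\<^sup>2) \<le> (\<integral>\<^sup>+y. ennreal (k (x - y) * (f y)\<^sup>2) \<partial>torus)"
proof (cases "(\<integral>\<^sup>+y. ennreal (k (x - y) * (f y)\<^sup>2) \<partial>torus) = \<infinity>")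
  case False
  then have i2: "integrable torus (\<lambda>y. k (x - y) * (f y)\<^sup>2)"
    using k_nonneg by (intro integrableI_nonneg) (auto simp: less_top)
  have i1: "integrable torus (\<lambda>y. k (x - y) * f y)"
  proof (rule Bochner_Integration.integrable_bound)
    show "integrable torus (\<lambda>y. k (x - y) + k (x - y) * (f y)\<^sup>2)"
      using i2 integrable_k_diff by auto
    have "\<bar>a\<bar> \<le> 1 + a\<^sup>2" for a :: real
      using zero_le_power2[of "\<bar>a\<bar> - 1"] zero_le_power2[of a] by (simp add: power2_diff)
    then have "k (x - y) * \<bar>f y\<bar> \<le> k (x - y) * (1 + (f y)\<^sup>2)" for y
      by (intro mult_left_mono k_nonneg)
    then show "AE y in torus. norm (k (x - y) * f y) \<le> norm (k (x - y) + k (x - y) * (f y)\<^sup>2)"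
      using k_nonneg by (auto simp: abs_mult algebra_simps)
  qed simp
  define c where "c = conv f x"
  have "0 \<le> (\<integral>y. k (x - y) * (f y - c)\<^sup>2 \<partial>torus)"
    by (simp add: k_nonneg)
  also have "\<dots> = (\<integral>y. k (x - y) * (f y)\<^sup>2 - 2 * c * (k (x - y) * f y) + c\<^sup>2 * k (x - y) \<partial>torus)"
    by (intro Bochner_Integration.integral_cong) (auto simp: power2_eq_square algebra_simps)
  also have "\<dots> = (\<integral>y. k (x - y) * (f y)\<^sup>2 \<partial>torus) - 2 * c * c + c\<^sup>2"
    using i1 i2 integrable_k_diff by (simp add: c_def conv_def)
  finally have "c\<^sup>2 \<le> (\<integral>y. k (x - y) * (f y)\<^sup>2 \<partial>torus)"
    by (simp add: power2_eq_square)
  then have "ennreal (c\<^sup>2) \<le> ennreal (\<integral>y. k (x - y) * (f y)\<^sup>2 \<partial>torus)"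
    by (rule ennreal_leI)
  also have "\<dots> = (\<integral>\<^sup>+y. ennreal (k (x - y) * (f y)\<^sup>2) \<partial>torus)"
    using i2 k_nonneg by (intro nn_integral_eq_integral[symmetric]) auto
  finally show ?thesis by (simp add: c_def)
qed simp

text \<open>The coupling with density \<open>k (x - y)\<close> has \<open>torus\<close> as both
  marginals, because \<open>k\<close> has mass one in either variable; a function of one variable
  therefore integrates as it does on the torus.\<close>

lemma
  assumes "integrable torus \<phi>"
  shows integrable_pair_snd: "integrable (torus \<Otimes>\<^sub>M torus) (\<lambda>(x, y). k (x - y) * \<phi> y)" (is ?A)
    and integrable_pair_fst: "integrable (torus \<Otimes>\<^sub>M torus) (\<lambda>(x, y). k (x - y) * \<phi> x)" (is ?B)
    and integral_pair_snd: "(\<integral>(x, y). k (x - y) * \<phi> y \<partial>(torus \<Otimes>\<^sub>M torus)) = (\<integral>x. \<phi> x \<partial>torus)" (is ?C)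
    and integral_pair_fst: "(\<integral>(x, y). k (x - y) * \<phi> x \<partial>(torus \<Otimes>\<^sub>M torus)) = (\<integral>x. \<phi> x \<partial>torus)" (is ?D)
proof -
  have [measurable]: "\<phi> \<in> borel_measurable borel"
    using borel_measurable_integrable[OF assms] by simp
  have fin: "(\<integral>\<^sup>+x. ennreal \<bar>\<phi> x\<bar> \<partial>torus) < \<infinity>"
    using assms by (simp add: integrable_iff_bounded)
  have y: "(\<integral>\<^sup>+x. ennreal (k (x - y) * \<bar>\<phi> y\<bar>) \<partial>torus) = ennreal \<bar>\<phi> y\<bar>" for y
    by (simp add: ennreal_mult k_nonneg nn_integral_multc k_swap[of _ y] nn_integral_k_diff)
  have x: "(\<integral>\<^sup>+y. ennreal (k (x - y) * \<bar>\<phi> x\<bar>) \<partial>torus) = ennreal \<bar>\<phi> x\<bar>" for x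
    by (simp add: ennreal_mult k_nonneg nn_integral_multc nn_integral_k_diff)
  show A: ?A
  proof (rule integrableI_bounded)
    have "(\<integral>\<^sup>+ z. ennreal (norm (case z of (x, y) \<Rightarrow> k (x - y) * \<phi> y)) \<partial>(torus \<Otimes>\<^sub>M torus))
       = (\<integral>\<^sup>+y. (\<integral>\<^sup>+x. ennreal (k (x - y) * \<bar>\<phi> y\<bar>) \<partial>torus) \<partial>torus)"
      by (subst torus_pair.nn_integral_snd[symmetric]) (auto simp: abs_mult k_nonneg)
    also have "\<dots> < \<infinity>" using fin by (simp add: y)
    finally show "(\<integral>\<^sup>+ z. ennreal (norm (case z of (x, y) \<Rightarrow> k (x - y) * \<phi> y)) \<partial>(torus \<Otimes>\<^sub>M torus)) < \<infinity>" .
  qed measurable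
  show B: ?B
  proof (rule integrableI_bounded)
    have "(\<integral>\<^sup>+ z. ennreal (norm (case z of (x, y) \<Rightarrow> k (x - y) * \<phi> x)) \<partial>(torus \<Otimes>\<^sub>M torus))
       = (\<integral>\<^sup>+x. (\<integral>\<^sup>+y. ennreal (k (x - y) * \<bar>\<phi> x\<bar>) \<partial>torus) \<partial>torus)"
      by (subst torus.nn_integral_fst[symmetric]) (auto simp: abs_mult k_nonneg)
    also have "\<dots> < \<infinity>" using fin by (simp add: x)
    finally show "(\<integral>\<^sup>+ z. ennreal (norm (case z of (x, y) \<Rightarrow> k (x - y) * \<phi> x)) \<partial>(torus \<Otimes>\<^sub>M torus)) < \<infinity>" .
  qed measurable
  show ?C
    using torus_pair.integral_snd[of "\<lambda>x y. k (x - y) * \<phi> y"] A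
    by (simp add: k_swap)
  show ?D
    using torus_pair.integral_fst'[of "\<lambda>(x, y). k (x - y) * \<phi> x"] B by simp
qed

lemma conv_nn_le:
  assumes [measurable]: "f \<in> borel_measurable borel"
  shows "(\<integral>\<^sup>+x. ennreal ((conv f x)\<^sup>2) \<partial>torus) \<le> (\<integral>\<^sup>+x. ennreal ((f x)\<^sup>2) \<partial>torus)"
proof -
  have "(\<integral>\<^sup>+x. ennreal ((conv f x)\<^sup>2) \<partial>torus)
      \<le> (\<integral>\<^sup>+x. (\<integral>\<^sup>+y. ennreal (k (x - y) * (f y)\<^sup>2) \<partial>torus) \<partial>torus)"
    by (intro nn_integral_mono conv_square_le) simp
  also have "\<dots> = (\<integral>\<^sup>+y. (\<integral>\<^sup>+x. ennreal (k (x - y) * (f y)\<^sup>2) \<partial>torus) \<partial>torus)"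
    by (rule torus_pair.Fubini') measurable
  also have "\<dots> = (\<integral>\<^sup>+x. ennreal ((f x)\<^sup>2) \<partial>torus)"
    by (simp add: ennreal_mult k_nonneg nn_integral_multc k_swap nn_integral_k_diff)
  finally show ?thesis .
qed

lemma conv_L2:
  assumes "f \<in> L2_torus"
  shows "conv f \<in> L2_torus"
proof -
  have [measurable]: "f \<in> borel_measurable borel" using assms by auto
  have "(\<integral>\<^sup>+x. ennreal ((f x)\<^sup>2) \<partial>torus) < \<infinity>"
    using L2_torusD(3)[OF assms] by (simp add: integrable_iff_bounded)
  with conv_nn_le[of f] have "(\<integral>\<^sup>+x. ennreal ((conv f x)\<^sup>2) \<partial>torus) < \<infinity>"
    by simp
  then have "integrable torus (\<lambda>x. (conv f x)\<^sup>2)"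
    by (intro integrableI_nonneg) auto
  then show ?thesis
    using conv_periodic by (simp add: L2_torus_def)
qed

lemma nsq_conv_le:
  assumes "f \<in> L2_torus"
  shows "nsq (conv f) \<le> nsq f"
proof -
  have [measurable]: "f \<in> borel_measurable borel" using assms by auto
  have "ennreal (nsq (conv f)) \<le> ennreal (nsq f)"
    unfolding nsq_def using conv_nn_le[of f] assms conv_L2[OF assms]
    by (subst (1 2) nn_integral_eq_integral[symmetric]) (auto dest: L2_torusD)
  then show ?thesis by simp
qed

lemma integral_conv:
  assumes "integrable torus f"
  shows "(\<integral>x. conv f x \<partial>torus) = (\<integral>x. f x \<partial>torus)"
  using torus_pair.integral_fst'[OF integrable_pair_snd[OF assms]] integral_pair_snd[OF assms]
  by (simp add: conv_def)

lemma conv_L2_0: "f \<in> L2_0 \<Longrightarrow> conv f \<in> L2_0"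
  by (simp add: L2_0_iff conv_L2 integral_conv L2_torus_integrable)

lemma integrable_pair_mult:
  assumes "f \<in> L2_torus" "h \<in> L2_torus"
  shows "integrable (torus \<Otimes>\<^sub>M torus) (\<lambda>(x, y). k (x - y) * (h x * f y))"
proof (rule Bochner_Integration.integrable_bound)
  have [measurable]: "f \<in> borel_measurable borel" "h \<in> borel_measurable borel" using assms by auto
  show "integrable (torus \<Otimes>\<^sub>M torus)
     (\<lambda>z. (case z of (x, y) \<Rightarrow> k (x - y) * (h x)\<^sup>2) + (case z of (x, y) \<Rightarrow> k (x - y) * (f y)\<^sup>2))"
    using assms by (intro Bochner_Integration.integrable_add integrable_pair_fst integrable_pair_snd) auto
  have "k (x - y) * \<bar>h x * f y\<bar> \<le> k (x - y) * ((h x)\<^sup>2 + (f y)\<^sup>2)" for x y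
    by (intro mult_left_mono k_nonneg abs_mult_le_squares)
  then show "AE z in torus \<Otimes>\<^sub>M torus. norm (case z of (x, y) \<Rightarrow> k (x - y) * (h x * f y)) \<le>
     norm ((case z of (x, y) \<Rightarrow> k (x - y) * (h x)\<^sup>2) + (case z of (x, y) \<Rightarrow> k (x - y) * (f y)\<^sup>2))"
    by (auto simp: abs_mult k_nonneg distrib_left)
  show "(\<lambda>(x, y). k (x - y) * (h x * f y)) \<in> borel_measurable (torus \<Otimes>\<^sub>M torus)"
    by measurable
qed

lemma integral_pair_mult:
  assumes "f \<in> L2_torus" "h \<in> L2_torus"
  shows "(\<integral>(x, y). k (x - y) * (h x * f y) \<partial>(torus \<Otimes>\<^sub>M torus)) = (\<integral>x. h x * conv f x \<partial>torus)"
  using torus_pair.integral_fst'[OF integrable_pair_mult[OF assms]]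
  by (simp add: conv_def mult.left_commute)

text \<open>Fubini together with the symmetry \<open>k (x - y) = k (y - x)\<close>.\<close>

lemma conv_selfadjoint:
  assumes "f \<in> L2_torus" "h \<in> L2_torus"
  shows "(\<integral>x. h x * conv f x \<partial>torus) = (\<integral>x. conv h x * f x \<partial>torus)"
proof -
  have "(\<integral>x. conv h x * f x \<partial>torus) = (\<integral>y. (\<integral>x. k (x - y) * (h x * f y) \<partial>torus) \<partial>torus)"
  proof (intro Bochner_Integration.integral_cong refl)
    fix y
    have "conv h y * f y = (\<integral>x. k (y - x) * h x * f y \<partial>torus)"
      by (simp add: conv_def)
    then show "conv h y * f y = (\<integral>x. k (x - y) * (h x * f y) \<partial>torus)"
      by (simp only: k_swap[of y] mult.assoc)
  qed
  also have "\<dots> = (\<integral>(x, y). k (x - y) * (h x * f y) \<partial>(torus \<Otimes>\<^sub>M torus))"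
    using integrable_pair_mult[OF assms] by (rule torus_pair.integral_snd)
  finally show ?thesis using integral_pair_mult[OF assms] by simp
qed

text \<open>Expanding the square, the double integral of
  \<open>k (x - y) * (u x - u y)\<^sup>2\<close> is \<open>2 * nsq u\<close> minus twice the pairing
  of \<open>u\<close> with \<open>conv u\<close>. The hypothesis is pointwise in \<open>x\<close>
  because Lipschitz functions satisfy it uniformly; integrating over total mass one keeps
  \<open>\<kappa>\<close>.\<close>

lemma nsq_conv_ge:
  assumes u: "u \<in> L2_torus"
    and le: "\<And>x. (\<integral>\<^sup>+y. ennreal (k (x - y) * (u x - u y)\<^sup>2) \<partial>torus) \<le> ennreal \<kappa>" and "0 \<le> \<kappa>"
  shows "nsq u - \<kappa> \<le> nsq (conv u)"
proof -
  let ?P = "torus \<Otimes>\<^sub>M torus :: ((real^'d) \<times> (real^'d)) measure"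
  have [measurable]: "u \<in> borel_measurable borel" using u by auto
  have eq: "(case z of (x, y) \<Rightarrow> k (x - y) * (u x - u y)\<^sup>2) =
        (case z of (x, y) \<Rightarrow> k (x - y) * (u x)\<^sup>2) + (case z of (x, y) \<Rightarrow> k (x - y) * (u y)\<^sup>2)
         - 2 * (case z of (x, y) \<Rightarrow> k (x - y) * (u x * u y))" for z
    by (cases z) (simp add: power2_eq_square algebra_simps)
  note [simp] = integrable_pair_fst[OF L2_torusD(3)[OF u]] integrable_pair_snd[OF L2_torusD(3)[OF u]]
    integrable_pair_mult[OF u u]
  have i: "integrable ?P (\<lambda>(x, y). k (x - y) * (u x - u y)\<^sup>2)"
    unfolding eq by simp
  have I: "(\<integral>(x, y). k (x - y) * (u x - u y)\<^sup>2 \<partial>?P) = 2 * nsq u - 2 * (\<integral>x. u x * conv u x \<partial>torus)"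
    unfolding eq by (simp add: integral_pair_fst[OF L2_torusD(3)[OF u]] integral_pair_snd[OF L2_torusD(3)[OF u]]
      integral_pair_mult[OF u u] nsq_def)
  have "ennreal (\<integral>(x, y). k (x - y) * (u x - u y)\<^sup>2 \<partial>?P) = (\<integral>\<^sup>+z. ennreal (case z of (x, y) \<Rightarrow> k (x - y) * (u x - u y)\<^sup>2) \<partial>?P)"
    using i by (intro nn_integral_eq_integral[symmetric]) (auto simp: k_nonneg)
  also have "\<dots> = (\<integral>\<^sup>+x. (\<integral>\<^sup>+y. ennreal (k (x - y) * (u x - u y)\<^sup>2) \<partial>torus) \<partial>torus)"
    by (subst torus.nn_integral_fst[symmetric]) auto
  also have "\<dots> \<le> (\<integral>\<^sup>+x. ennreal \<kappa> \<partial>(torus :: (real^'d) measure))"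
    by (intro nn_integral_mono le)
  also have "\<dots> = ennreal \<kappa>" by simp
  finally have "2 * nsq u - 2 * (\<integral>x. u x * conv u x \<partial>torus) \<le> \<kappa>"
    using \<open>0 \<le> \<kappa>\<close> by (simp add: I)
  \<comment> \<open>Turns the lower bound on the pairing into one on the norm: the pairing is at
    most half of \<open>nsq u + nsq (conv u)\<close>.\<close>
  moreover have "0 \<le> (\<integral>x. (u x - conv u x)\<^sup>2 \<partial>torus)" by simp
  ultimately show ?thesis
    using nsq_diff[OF u conv_L2[OF u]] by simp
qed

text \<open>With the shift moved into the argument of \<open>f\<close>, sup and Lipschitz bounds
  pass through the average.\<close>

lemma conv_eq:
  assumes [measurable]: "f \<in> borel_measurable borel" and p: "periodic_fun f"
  shows "conv f x = (\<integral>z. k z * f (x - z) \<partial>torus)"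
proof -
  have "(\<integral>y. k (x - y) * f (x - (x - y)) \<partial>torus) = (\<integral>z. k z * f (x - z) \<partial>torus)"
  proof (rule mpres_integral[OF mpres_reflection, of "\<lambda>z. k z * f (x - z)"])
    show "periodic_fun (\<lambda>z. k z * f (x - z))"
      using k_periodic periodic_fun_comp_lift[OF p mpres_lift[OF mpres_reflection[of x]]]
      by (simp add: periodic_fun_def)
  qed measurable
  then show ?thesis by (simp add: conv_def)
qed

lemma integrable_k_bounded:
  assumes [measurable]: "f \<in> borel_measurable borel" and b: "\<And>x. \<bar>f x\<bar> \<le> B"
  shows "integrable torus (\<lambda>z. k z * f z)"
proof (rule Bochner_Integration.integrable_bound)
  show "integrable torus (\<lambda>z. B * k z)" using integrable_k by simp
  have "\<bar>k z * f z\<bar> \<le> \<bar>B * k z\<bar>" for z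
    using mult_left_mono[OF b k_nonneg, of z z] b[of z] by (auto simp: abs_mult k_nonneg mult.commute)
  then show "AE z in torus. norm (k z * f z) \<le> norm (B * k z)" by simp
qed simp

lemma integral_k: "(\<integral>y. k y \<partial>torus) = 1"
  by (subst integral_eq_nn_integral) (auto simp: k_nn_integral k_nonneg)

lemma integral_k_mult_le:
  assumes [measurable]: "f \<in> borel_measurable borel" and b: "\<And>x. \<bar>f x\<bar> \<le> B"
  shows "\<bar>\<integral>z. k z * f z \<partial>torus\<bar> \<le> B"
proof -
  have "\<bar>\<integral>z. k z * f z \<partial>torus\<bar> \<le> (\<integral>z. \<bar>k z * f z\<bar> \<partial>torus)"
    by (rule integral_abs_bound)
  also have "\<dots> \<le> (\<integral>z. k z * B \<partial>torus)"
    using integrable_k integrable_abs[OF integrable_k_bounded[OF assms(1) b]]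
    by (intro integral_mono) (auto simp: abs_mult k_nonneg b mult_left_mono)
  also have "\<dots> = B" by (simp add: integral_k)
  finally show ?thesis .
qed

lemma conv_bounded:
  assumes [measurable]: "f \<in> borel_measurable borel" and p: "periodic_fun f" and b: "\<And>x. \<bar>f x\<bar> \<le> B"
  shows "\<bar>conv f x\<bar> \<le> B"
  unfolding conv_eq[OF assms(1,2)] by (rule integral_k_mult_le) (auto intro: b)

lemma conv_lipschitz:
  assumes [measurable]: "f \<in> borel_measurable borel" and p: "periodic_fun f" and b: "\<And>x. \<bar>f x\<bar> \<le> B"
    and L: "\<And>x y. \<bar>f x - f y\<bar> \<le> L * norm (x - y)"
  shows "\<bar>conv f x - conv f y\<bar> \<le> L * norm (x - y)"
proof -
  have i: "integrable torus (\<lambda>z. k z * f (x - z))" for x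
    by (rule integrable_k_bounded) (auto intro: b)
  have "conv f x - conv f y = (\<integral>z. k z * (f (x - z) - f (y - z)) \<partial>torus)"
    using i[of x] i[of y] by (simp add: conv_eq[OF assms(1,2)] right_diff_distrib)
  also have "\<bar>\<dots>\<bar> \<le> L * norm (x - y)"
    by (rule integral_k_mult_le) (auto intro: order_trans[OF L])
  finally show ?thesis .
qed

end

subsection \<open>The noise operator\<close>

text \<open>\<open>gtilde\<close> is a real infinite sum that defaults to 0 where the series
  diverges. The \<open>ennreal\<close> version keeps the value infinity there, so exchanging sum and
  integral needs no convergence; the two agree almost everywhere.\<close>

definition periodization :: "(real^'d \<Rightarrow> real) \<Rightarrow> real \<Rightarrow> real^'d \<Rightarrow> ennreal" where
  "periodization g \<epsilon> x = (\<integral>\<^sup>+n. ennreal (\<epsilon> powr (- real CARD('d)) * g ((1 / \<epsilon>) *\<^sub>R (x + lat_vec n))) \<partial>count_space UNIV)"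

text \<open>The defaults match: a divergent nonnegative series has infinite sum 0, and
  \<open>enn2real\<close> sends infinity to 0.\<close>

lemma infsum_eq_enn2real_nn_integral:
  fixes a :: "'i \<Rightarrow> real"
  assumes nonneg: "\<And>i. 0 \<le> a i"
  shows "(\<Sum>\<^sub>\<infinity>i. a i) = enn2real (\<integral>\<^sup>+i. ennreal (a i) \<partial>count_space UNIV)"
proof (cases "(\<integral>\<^sup>+i. ennreal (a i) \<partial>count_space UNIV) = \<infinity>")
  case True
  have "\<not> a summable_on UNIV"
  proof
    assume "a summable_on UNIV"
    then have "Infinite_Sum.abs_summable_on a UNIV" using nonneg by simp
    then have "integrable (count_space UNIV) a"
      unfolding abs_summable_equivalent Infinite_Set_Sum.abs_summable_on_def .
    then show False using True nonneg by (simp add: integrable_iff_bounded)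
  qed
  then show ?thesis using True by (simp add: infsum_not_exists)
next
  case False
  then have i: "integrable (count_space UNIV) a"
    using nonneg by (intro integrableI_nonneg) (auto simp: less_top)
  then have "Infinite_Set_Sum.abs_summable_on a UNIV"
    by (simp add: Infinite_Set_Sum.abs_summable_on_def)
  from infsetsum_infsum[OF this] have "(\<Sum>\<^sub>\<infinity>i. a i) = (\<integral>i. a i \<partial>count_space UNIV)"
    by (simp add: infsetsum_def)
  also have "\<dots> = enn2real (\<integral>\<^sup>+i. ennreal (a i) \<partial>count_space UNIV)"
    using nonneg by (intro integral_eq_nn_integral) auto
  finally show ?thesis .
qed

lemma nn_integral_lborel_scaleR:
  fixes h :: "'a::euclidean_space \<Rightarrow> ennreal"
  assumes [measurable]: "h \<in> borel_measurable borel" and "0 < \<epsilon>"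
  shows "(\<integral>\<^sup>+x. h x \<partial>lborel) = ennreal (\<epsilon> ^ DIM('a)) * (\<integral>\<^sup>+x. h (\<epsilon> *\<^sub>R x) \<partial>lborel)"
proof -
  have "(\<integral>\<^sup>+x. h x \<partial>lborel) = (\<integral>\<^sup>+x. h x \<partial>density (distr lborel borel (\<lambda>x. 0 + \<epsilon> *\<^sub>R x)) (\<lambda>_. ennreal (\<bar>\<epsilon>\<bar> ^ DIM('a))))"
    using assms(2) by (subst lborel_affine[of \<epsilon> 0]) auto
  also have "\<dots> = ennreal (\<epsilon> ^ DIM('a)) * (\<integral>\<^sup>+x. h (\<epsilon> *\<^sub>R x) \<partial>lborel)"
    using assms(2) by (simp add: nn_integral_density nn_integral_distr nn_integral_cmult)
  finally show ?thesis .
qed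

lemma noise_density_measurable: "noise_density g \<Longrightarrow> g \<in> borel_measurable borel"
  and noise_density_nonneg: "noise_density g \<Longrightarrow> 0 \<le> g x"
  and noise_density_even: "noise_density g \<Longrightarrow> g (- x) = g x"
  and noise_density_integrable: "noise_density g \<Longrightarrow> integrable lborel g"
  and noise_density_integral: "noise_density g \<Longrightarrow> (\<integral>x. g x \<partial>lborel) = 1"
  by (simp_all add: noise_density_def)

lemma noise_density_nn_integral: "noise_density g \<Longrightarrow> (\<integral>\<^sup>+x. ennreal (g x) \<partial>lborel) = 1"
  by (subst nn_integral_eq_integral) (auto simp: noise_density_def)

context
  fixes g :: "real^'d \<Rightarrow> real" and \<epsilon> :: real
  assumes g: "noise_density g" and \<epsilon>: "0 < \<epsilon>"
begin

lemmas g_measurable [measurable] = noise_density_measurable[OF g]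
  and g_nonneg = noise_density_nonneg[OF g]
  and g_nn_integral = noise_density_nn_integral[OF g]

lemma gtilde_eq: "gtilde g \<epsilon> x = enn2real (periodization g \<epsilon> x)"
  unfolding gtilde_def periodization_def
  by (rule infsum_eq_enn2real_nn_integral) (simp add: g_nonneg)

lemma periodization_measurable [measurable]: "periodization g \<epsilon> \<in> borel_measurable borel"
proof -
  have "(\<lambda>z::(real^'d) \<times> (int^'d). ennreal (\<epsilon> powr (- real CARD('d)) * g ((1 / \<epsilon>) *\<^sub>R (fst z + lat_vec (snd z)))))
      \<in> borel_measurable (borel \<Otimes>\<^sub>M count_space UNIV)"
    by (rule measurable_compose_countable'[where g=snd and I=UNIV]) auto
  then have "(\<lambda>x. \<integral>\<^sup>+n. ennreal (\<epsilon> powr (- real CARD('d)) * g ((1 / \<epsilon>) *\<^sub>R (x + lat_vec n))) \<partial>count_space UNIV) \<in> borel_measurable borel"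
    by (intro sigma_finite_measure.borel_measurable_nn_integral sigma_finite_measure_count_space_countable)
      (auto simp: case_prod_beta')
  then show ?thesis by (simp add: periodization_def[abs_def])
qed

text \<open>Averaging against the periodized kernel is averaging over the scaled noise
  \<open>\<epsilon> *\<^sub>R z\<close> on R^d: unfold the lattice sum, then rescale. This is the
  bridge between the kernel on the torus and the density on R^d.\<close>

lemma nn_integral_periodization:
  fixes \<phi> :: "real^'d \<Rightarrow> ennreal"
  assumes [measurable]: "\<phi> \<in> borel_measurable borel" and p: "periodic_fun \<phi>"
  shows "(\<integral>\<^sup>+z. periodization g \<epsilon> z * \<phi> z \<partial>torus) = (\<integral>\<^sup>+z. ennreal (g z) * \<phi> (\<epsilon> *\<^sub>R z) \<partial>lborel)"
proof -
  let ?h = "\<lambda>z. ennreal (\<epsilon> powr (- real CARD('d)) * g ((1 / \<epsilon>) *\<^sub>R z)) * \<phi> z"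
  have "(\<integral>\<^sup>+z. periodization g \<epsilon> z * \<phi> z \<partial>torus)
      = (\<integral>\<^sup>+z. (\<integral>\<^sup>+n. ?h (z + lat_vec n) \<partial>count_space UNIV) \<partial>torus)"
    using p by (intro nn_integral_cong) (simp add: periodization_def periodic_fun_def nn_integral_multc)
  also have "\<dots> = (\<integral>\<^sup>+z. ?h z \<partial>lborel)"
    by (rule nn_integral_unfold_torus[symmetric]) measurable
  also have "\<dots> = ennreal (\<epsilon> ^ CARD('d)) * (\<integral>\<^sup>+z. ?h (\<epsilon> *\<^sub>R z) \<partial>lborel)"
    by (subst nn_integral_lborel_scaleR[OF _ \<epsilon>]) auto
  also have "\<dots> = (\<integral>\<^sup>+z. ennreal (\<epsilon> ^ CARD('d)) * ?h (\<epsilon> *\<^sub>R z) \<partial>lborel)"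
    by (rule nn_integral_cmult[symmetric]) measurable
  also have "\<dots> = (\<integral>\<^sup>+z. ennreal (g z) * \<phi> (\<epsilon> *\<^sub>R z) \<partial>lborel)"
  proof (rule nn_integral_cong)
    fix z
    \<comment> \<open>The Jacobian of the dilation cancels the normalizing factor of the
      kernel.\<close>
    have *: "\<epsilon> ^ CARD('d) * (\<epsilon> powr (- real CARD('d)) * g z) = g z"
      using \<epsilon> by (simp add: powr_minus powr_realpow)
    have "ennreal (\<epsilon> ^ CARD('d)) * ennreal (\<epsilon> powr (- real CARD('d)) * g z) = ennreal (g z)"
      by (subst ennreal_mult[symmetric]) (use \<epsilon> g_nonneg[of z] * in auto)
    then show "ennreal (\<epsilon> ^ CARD('d)) * ?h (\<epsilon> *\<^sub>R z) = ennreal (g z) * \<phi> (\<epsilon> *\<^sub>R z)"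
      using \<epsilon> by (simp add: mult.assoc[symmetric])
  qed
  finally show ?thesis .
qed

lemma AE_periodization: "AE z in torus. ennreal (gtilde g \<epsilon> z) = periodization g \<epsilon> z"
proof -
  have "(\<integral>\<^sup>+z. periodization g \<epsilon> z \<partial>torus) \<noteq> \<infinity>"
    using nn_integral_periodization[of "\<lambda>_. 1"] by (simp add: periodic_fun_def g_nn_integral)
  then have "AE z in torus. periodization g \<epsilon> z \<noteq> \<infinity>"
    by (intro nn_integral_noteq_infinite) auto
  then show ?thesis by eventually_elim (simp add: gtilde_eq less_top)
qed

lemma nn_integral_gtilde:
  fixes \<phi> :: "real^'d \<Rightarrow> ennreal"
  assumes "\<phi> \<in> borel_measurable borel" and p: "periodic_fun \<phi>"
  shows "(\<integral>\<^sup>+z. ennreal (gtilde g \<epsilon> z) * \<phi> z \<partial>torus) = (\<integral>\<^sup>+z. ennreal (g z) * \<phi> (\<epsilon> *\<^sub>R z) \<partial>lborel)"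
proof -
  have "(\<integral>\<^sup>+z. ennreal (gtilde g \<epsilon> z) * \<phi> z \<partial>torus) = (\<integral>\<^sup>+z. periodization g \<epsilon> z * \<phi> z \<partial>torus)"
    using AE_periodization by (intro nn_integral_cong_AE) auto
  then show ?thesis using nn_integral_periodization[OF assms] by simp
qed

text \<open>Periodicity and evenness are reindexings of the lattice sum, by a shift and by negation;
  unit mass is the transfer identity for the constant 1.\<close>

lemma torus_kernel_gtilde: "torus_kernel (gtilde g \<epsilon>)"
proof
  have "gtilde g \<epsilon> = (\<lambda>x. enn2real (periodization g \<epsilon> x))" by (simp add: gtilde_eq fun_eq_iff)
  then show "gtilde g \<epsilon> \<in> borel_measurable borel" by simp
  show "0 \<le> gtilde g \<epsilon> x" for x by (simp add: gtilde_eq)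
  have "periodization g \<epsilon> (x + k) = periodization g \<epsilon> x" if k: "k \<in> lattice" for x k
  proof -
    obtain m where m: "k = lat_vec m" using k by (auto simp: lattice_eq_range_lat_vec)
    have "bij (\<lambda>n. m + n)" by (rule bij_plus)
    from nn_integral_bij_count_space[OF this,
        of "\<lambda>n. ennreal (\<epsilon> powr (- real CARD('d)) * g ((1 / \<epsilon>) *\<^sub>R (x + lat_vec n)))"]
    show ?thesis by (simp add: periodization_def m lat_vec_add add.assoc)
  qed
  then show "periodic_fun (gtilde g \<epsilon>)" by (simp add: periodic_fun_def gtilde_eq)
  have "periodization g \<epsilon> (- x) = periodization g \<epsilon> x" for x
  proof -
    have "g ((1 / \<epsilon>) *\<^sub>R (x + lat_vec (- n))) = g ((1 / \<epsilon>) *\<^sub>R (- x + lat_vec n))" for n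
    proof -
      have "(1 / \<epsilon>) *\<^sub>R (- x + lat_vec n) = - ((1 / \<epsilon>) *\<^sub>R (x + lat_vec (- n)))"
        by (simp add: lat_vec_minus algebra_simps)
      then show ?thesis using g by (simp only: noise_density_def)
    qed
    then show ?thesis
      using nn_integral_bij_count_space[OF bij_uminus,
        of "\<lambda>n. ennreal (\<epsilon> powr (- real CARD('d)) * g ((1 / \<epsilon>) *\<^sub>R (x + lat_vec n)))"]
      by (simp add: periodization_def)
  qed
  then show "gtilde g \<epsilon> (- x) = gtilde g \<epsilon> x" for x by (simp add: gtilde_eq)
  show "(\<integral>\<^sup>+x. ennreal (gtilde g \<epsilon> x) \<partial>torus) = 1"
    using nn_integral_gtilde[of "\<lambda>_. 1"] by (simp add: periodic_fun_def g_nn_integral)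
qed

lemma Gop_eq_conv:
  assumes [measurable]: "f \<in> borel_measurable borel"
  shows "Gop g \<epsilon> f = torus_kernel.conv (gtilde g \<epsilon>) f"
proof -
  interpret torus_kernel "gtilde g \<epsilon>" by (rule torus_kernel_gtilde)
  show ?thesis
    by (simp add: Gop_def fun_eq_iff conv_def lebesgue_integral_torus)
qed

end

text \<open>The energy lost in one diffusion step is a second moment of the noise truncated at scale
  \<open>1 / (\<epsilon> L)\<close>, which remains controllable when the noise has heavy tails.\<close>

definition truncated_moment :: "(real^'d \<Rightarrow> real) \<Rightarrow> real \<Rightarrow> ennreal" where
  "truncated_moment g t = (\<integral>\<^sup>+z. ennreal (g z * min 1 ((t * norm z)\<^sup>2)) \<partial>lborel)"

text \<open>The bound 2 leaves room for the normalized observable \<open>sqrt 2 * cos (2 * pi * x $ i)\<close>.\<close>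

definition smooth_obs :: "real \<Rightarrow> (real^'d \<Rightarrow> real) set" where
  "smooth_obs L = {u. u \<in> borel_measurable borel \<and> periodic_fun u \<and> (\<forall>x. \<bar>u x\<bar> \<le> 2)
     \<and> (\<forall>x y. \<bar>u x - u y\<bar> \<le> L * norm (x - y)) \<and> (\<integral>x. u x \<partial>torus) = 0}"

lemma smooth_obsD:
  assumes "u \<in> smooth_obs L"
  shows "u \<in> borel_measurable borel" "periodic_fun u" "\<bar>u x\<bar> \<le> 2"
    "\<bar>u x - u y\<bar> \<le> L * norm (x - y)" "(\<integral>x. u x \<partial>torus) = 0"
  using assms by (auto simp: smooth_obs_def)

lemma smooth_obs_L2: "u \<in> smooth_obs L \<Longrightarrow> u \<in> L2_torus"
  by (rule L2_torusI_bounded[where B=2]) (auto simp: smooth_obs_def)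

lemma smooth_obs_L2_0: "u \<in> smooth_obs L \<Longrightarrow> u \<in> L2_0"
  by (simp add: L2_0_iff smooth_obs_L2 smooth_obsD)

lemma Gop_smooth_obs:
  assumes g: "noise_density g" and \<epsilon>: "0 < \<epsilon>" and u: "u \<in> smooth_obs L"
  shows "Gop g \<epsilon> u \<in> smooth_obs L"
proof -
  interpret torus_kernel "gtilde g \<epsilon>" by (rule torus_kernel_gtilde[OF g \<epsilon>])
  note [measurable] = smooth_obsD(1)[OF u]
  show ?thesis
    unfolding Gop_eq_conv[OF g \<epsilon> smooth_obsD(1)[OF u]] smooth_obs_def
    using conv_periodic conv_bounded[of u 2] conv_lipschitz[of u 2 L] smooth_obsD[OF u]
      integral_conv[OF L2_torus_integrable[OF smooth_obs_L2[OF u]]]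
    by auto
qed

lemma Uop_smooth_obs:
  assumes S: "mpres S" and lip: "\<And>x y. norm (S x - S y) \<le> K * norm (x - y)"
    and u: "u \<in> smooth_obs L" and "0 \<le> L"
  shows "Uop S u \<in> smooth_obs (L * K)"
proof -
  note [measurable] = smooth_obsD(1)[OF u] mpres_measurable[OF S]
  have "\<bar>u (S x) - u (S y)\<bar> \<le> L * K * norm (x - y)" for x y
    using order_trans[OF smooth_obsD(4)[OF u] mult_left_mono[OF lip \<open>0 \<le> L\<close>]] by (simp add: mult.assoc)
  then show ?thesis
    using smooth_obsD[OF u] mpres_integral[OF S smooth_obsD(1,2)[OF u]]
      periodic_fun_comp_lift[OF smooth_obsD(2)[OF u] mpres_lift[OF S]]
    by (auto simp: smooth_obs_def Uop_def comp_def)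
qed

lemma nsq_Uop:
  assumes S: "mpres S" and f: "f \<in> borel_measurable borel" "periodic_fun f"
  shows "nsq (Uop S f) = nsq f"
  using f by (auto simp: nsq_def Uop_def periodic_fun_def intro!: mpres_integral[OF S, of "\<lambda>x. (f x)\<^sup>2"])

text \<open>Along a noise step \<open>\<epsilon> *\<^sub>R z\<close> the observable changes by at
  most the smaller of 4 and \<open>\<epsilon> * L * norm z\<close>; squaring and averaging over
  \<open>z\<close> produces the truncated moment at \<open>\<epsilon> * L\<close>.\<close>

lemma nsq_Gop_ge:
  assumes g: "noise_density g" and \<epsilon>: "0 < \<epsilon>" and u: "u \<in> smooth_obs L" and "0 \<le> L"
    and \<kappa>: "truncated_moment g (\<epsilon> * L) \<le> ennreal \<kappa>" "0 \<le> \<kappa>"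
  shows "nsq u - 16 * \<kappa> \<le> nsq (Gop g \<epsilon> u)"
proof -
  interpret torus_kernel "gtilde g \<epsilon>" by (rule torus_kernel_gtilde[OF g \<epsilon>])
  note [measurable] = smooth_obsD(1)[OF u] noise_density_measurable[OF g]
  have "(\<integral>\<^sup>+y. ennreal (gtilde g \<epsilon> (x - y) * (u x - u y)\<^sup>2) \<partial>torus) \<le> ennreal (16 * \<kappa>)" for x
  proof -
    let ?\<phi> = "\<lambda>z. ennreal ((u x - u (x - z))\<^sup>2)"
    have per: "periodic_fun ?\<phi>"
      using periodic_fun_comp_lift[OF smooth_obsD(2)[OF u] mpres_lift[OF mpres_reflection[of x]]]
      by (simp add: periodic_fun_def)
    have "(\<integral>\<^sup>+y. ennreal (gtilde g \<epsilon> (x - y) * (u x - u y)\<^sup>2) \<partial>torus)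
        = (\<integral>\<^sup>+y. ennreal (gtilde g \<epsilon> (x - y)) * ?\<phi> (x - y) \<partial>torus)"
      by (simp add: ennreal_mult k_nonneg)
    also have "\<dots> = (\<integral>\<^sup>+z. ennreal (gtilde g \<epsilon> z) * ?\<phi> z \<partial>torus)"
      using per k_periodic
      by (intro mpres_nn_integral[OF mpres_reflection, of "\<lambda>z. ennreal (gtilde g \<epsilon> z) * ?\<phi> z"])
         (auto simp: periodic_fun_def)
    also have "\<dots> = (\<integral>\<^sup>+z. ennreal (g z) * ?\<phi> (\<epsilon> *\<^sub>R z) \<partial>lborel)"
      by (rule nn_integral_gtilde[OF g \<epsilon> _ per]) measurable
    also have "\<dots> \<le> (\<integral>\<^sup>+z. ennreal 16 * ennreal (g z * min 1 ((\<epsilon> * L * norm z)\<^sup>2)) \<partial>lborel)"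
    proof (rule nn_integral_mono)
      fix z
      let ?d = "\<bar>u x - u (x - \<epsilon> *\<^sub>R z)\<bar>"
      \<comment> \<open>The constant 16 is the square of 4, the largest possible oscillation of a
        function bounded by 2.\<close>
      have "?d \<le> 4" using smooth_obsD(3)[OF u, of x] smooth_obsD(3)[OF u, of "x - \<epsilon> *\<^sub>R z"] by linarith
      then have "?d\<^sup>2 \<le> 4\<^sup>2" by (intro power_mono) auto
      moreover have "?d \<le> \<epsilon> * L * norm z"
        using smooth_obsD(4)[OF u, of x "x - \<epsilon> *\<^sub>R z"] \<epsilon> by (simp add: mult_ac)
      then have "?d\<^sup>2 \<le> (\<epsilon> * L * norm z)\<^sup>2" by (intro power_mono) auto
      moreover have "s \<le> 16 \<Longrightarrow> s \<le> q \<Longrightarrow> 0 \<le> q \<Longrightarrow> s \<le> 16 * min 1 q" for s q :: real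
        by (simp add: min_def)
      ultimately have "(u x - u (x - \<epsilon> *\<^sub>R z))\<^sup>2 \<le> 16 * min 1 ((\<epsilon> * L * norm z)\<^sup>2)"
        by simp
      then have "g z * (u x - u (x - \<epsilon> *\<^sub>R z))\<^sup>2 \<le> g z * (16 * min 1 ((\<epsilon> * L * norm z)\<^sup>2))"
        by (intro mult_left_mono noise_density_nonneg[OF g])
      then have "ennreal (g z * (u x - u (x - \<epsilon> *\<^sub>R z))\<^sup>2) \<le> ennreal (16 * (g z * min 1 ((\<epsilon> * L * norm z)\<^sup>2)))"
        by (intro ennreal_leI) (simp add: mult_ac)
      then show "ennreal (g z) * ?\<phi> (\<epsilon> *\<^sub>R z) \<le> ennreal 16 * ennreal (g z * min 1 ((\<epsilon> * L * norm z)\<^sup>2))"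
        using noise_density_nonneg[OF g, of z] by (simp add: ennreal_mult)
    qed
    also have "\<dots> = ennreal 16 * truncated_moment g (\<epsilon> * L)"
      unfolding truncated_moment_def by (rule nn_integral_cmult) measurable
    also have "\<dots> \<le> ennreal 16 * ennreal \<kappa>"
      by (intro mult_left_mono \<kappa>) simp
    also have "\<dots> = ennreal (16 * \<kappa>)" using \<kappa>(2) by (simp add: ennreal_mult)
    finally show ?thesis .
  qed
  then show ?thesis
    using \<kappa>(2) unfolding Gop_eq_conv[OF g \<epsilon> smooth_obsD(1)[OF u]]
    by (intro nsq_conv_ge smooth_obs_L2[OF u]) auto
qed

subsection \<open>Truncated moments of the noise\<close>

text \<open>Below 1 a smaller exponent gives a larger power; above 1 the truncation is at most any
  positive power.\<close>

lemma min_one_le_powr: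
  fixes s \<gamma> :: real
  assumes "0 \<le> s" "0 < \<gamma>" "\<gamma> \<le> 2"
  shows "min 1 (s\<^sup>2) \<le> s powr \<gamma>"
proof (cases "s \<le> 1")
  case True
  have "s\<^sup>2 \<le> s powr \<gamma>"
  proof (cases "s = 0")
    case False
    with True assms have "s powr 2 \<le> s powr \<gamma>" by (intro powr_mono') auto
    with False assms show ?thesis by simp
  qed simp
  then show ?thesis by simp
next
  case False
  with assms have "1 \<le> s powr \<gamma>" by (intro ge_one_powr_ge_zero) auto
  then show ?thesis by simp
qed

text \<open>Subadditivity of truncation, which reduces the norm on R^d to one coordinate at a
  time.\<close>

lemma min_one_sum_le:
  fixes a :: "'i \<Rightarrow> real"
  assumes "finite I" "\<And>i. i \<in> I \<Longrightarrow> 0 \<le> a i"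
  shows "min 1 (\<Sum>i\<in>I. a i) \<le> (\<Sum>i\<in>I. min 1 (a i))"
  using assms
proof (induction I)
  case (insert j I)
  then have "0 \<le> sum a I" "0 \<le> a j" by (auto intro: sum_nonneg)
  then have "min 1 (a j + sum a I) \<le> min 1 (a j) + min 1 (sum a I)" by (auto simp: min_def)
  also have "\<dots> \<le> min 1 (a j) + (\<Sum>i\<in>I. min 1 (a i))" using insert by simp
  finally show ?case using insert by simp
qed simp

text \<open>\<open>1 - sin x / x\<close> is the mean of \<open>1 - cos (x * u)\<close> over
  \<open>u\<close> in the unit interval. Up to 2, the Taylor bound with
  \<open>y ^ 5 \<le> 4 * y ^ 3\<close> leaves the cubic coefficient 1/6 - 1/30, which exceeds 1/8;
  beyond 2 the quotient is at most 1/2.\<close>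

lemma sinc_bound:
  fixes x :: real
  assumes "x \<noteq> 0"
  shows "min 1 (x\<^sup>2) \<le> 8 * (1 - sin x / x)"
proof -
  have main: "min 1 (y\<^sup>2) \<le> 8 * (1 - sin y / y)" if y: "0 < y" for y :: real
  proof (cases "y \<le> 2")
    case True
    have "\<bar>sin y - (\<Sum>m<5. sin_coeff m * y ^ m)\<bar> \<le> inverse (fact 5) * \<bar>y\<bar> ^ 5"
      by (rule Maclaurin_sin_bound)
    moreover have "(\<Sum>m<5. sin_coeff m * y ^ m) = y - y ^ 3 / 6"
    proof -
      have "{..<5::nat} = {0, 1, 2, 3, 4}" by auto
      then show ?thesis by (simp add: sin_coeff_def fact_numeral)
    qed
    moreover have "inverse (fact 5) * \<bar>y\<bar> ^ 5 = y ^ 5 / 120"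
      using y by (simp add: fact_numeral)
    ultimately have "sin y \<le> y - y ^ 3 / 6 + y ^ 5 / 120"
      by linarith
    also have "y ^ 5 \<le> 4 * y ^ 3"
    proof -
      have "y\<^sup>2 \<le> 2\<^sup>2" using y True by (intro power_mono) auto
      from mult_right_mono[OF this, of "y ^ 3"] y show ?thesis
        by (simp add: power_add[symmetric])
    qed
    finally have "sin y \<le> y - y ^ 3 / 8" using zero_less_power[OF y, of 3] by linarith
    then have "sin y / y \<le> 1 - y\<^sup>2 / 8"
      using y by (simp add: field_simps power2_eq_square power3_eq_cube)
    then show ?thesis by simp
  next
    case False
    then have "2 * sin y \<le> y" using sin_le_one[of y] by linarith
    then have "sin y / y \<le> 1 / 2" using y by (simp add: divide_le_eq)
    then show ?thesis by simp
  qed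
  show ?thesis
    using main[of x] main[of "- x"] assms by (cases "0 < x") auto
qed

text \<open>A single \<open>1 - cos x\<close> vanishes at nonzero multiples of 2 pi and cannot
  dominate the truncated square; averaging over the dilations \<open>x * u\<close> removes these
  zeros.\<close>

lemma nn_integral_one_minus_cos_ge:
  fixes x :: real
  shows "ennreal (min 1 (x\<^sup>2)) \<le> 8 * (\<integral>\<^sup>+u. ennreal (1 - cos (x * u)) * indicator {0..1} u \<partial>lborel)"
proof (cases "x = 0")
  case False
  have "(\<integral>\<^sup>+u. ennreal (1 - cos (x * u)) * indicator {0..1} u \<partial>lborel) = ennreal ((1 - sin (x * 1) / x) - (0 - sin (x * 0) / x))"
    using False by (intro nn_integral_FTC_Icc) (auto intro!: derivative_eq_intros)
  also have "\<dots> = ennreal (1 - sin x / x)" by simp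
  finally have *: "8 * (\<integral>\<^sup>+u. ennreal (1 - cos (x * u)) * indicator {0..1} u \<partial>lborel) = ennreal (8 * (1 - sin x / x))"
    by (subst ennreal_mult') auto
  show ?thesis unfolding * by (intro ennreal_leI sinc_bound False)
qed simp

lemma integrable_ghat:
  assumes g: "noise_density g"
  shows "integrable lborel (\<lambda>x. complex_of_real (g x) * cis (- 2 * pi * (x \<bullet> \<xi>)))"
proof (rule Bochner_Integration.integrable_bound[OF noise_density_integrable[OF g]])
  note [measurable] = noise_density_measurable[OF g]
  have [measurable]: "cis \<in> borel_measurable borel"
    by (intro borel_measurable_continuous_onI continuous_intros)
  show "(\<lambda>x. complex_of_real (g x) * cis (- 2 * pi * (x \<bullet> \<xi>))) \<in> borel_measurable lborel"
    by measurable
qed (auto simp: norm_mult)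

lemma integrable_mult_cos:
  fixes f :: "'a::euclidean_space \<Rightarrow> real"
  assumes "integrable lborel f"
  shows "integrable lborel (\<lambda>x. f x * cos (2 * pi * (x \<bullet> \<xi>)))"
proof (rule Bochner_Integration.integrable_bound[OF assms])
  have [measurable]: "f \<in> borel_measurable borel" using borel_measurable_integrable[OF assms] by simp
  show "(\<lambda>x. f x * cos (2 * pi * (x \<bullet> \<xi>))) \<in> borel_measurable lborel" by measurable
  have "\<bar>f x\<bar> * \<bar>cos (2 * pi * (x \<bullet> \<xi>))\<bar> \<le> \<bar>f x\<bar>" for x by (intro mult_left_le) auto
  then show "AE x in lborel. norm (f x * cos (2 * pi * (x \<bullet> \<xi>))) \<le> norm (f x)" by (simp add: abs_mult)
qed

lemmas integrable_noise_cos = integrable_mult_cos[OF noise_density_integrable]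

lemma Re_ghat:
  assumes g: "noise_density g"
  shows "Re (ghat g \<xi>) = (\<integral>x. g x * cos (2 * pi * (x \<bullet> \<xi>)) \<partial>lborel)"
  unfolding ghat_def using integrable_ghat[OF g, of \<xi>]
  by (subst integral_Re[symmetric]) (auto simp: cis.simps)

lemma nn_integral_one_minus_cos:
  assumes g: "noise_density g"
  shows "(\<integral>\<^sup>+x. ennreal (g x * (1 - cos (2 * pi * (x \<bullet> \<xi>)))) \<partial>lborel) = ennreal (1 - Re (ghat g \<xi>))"
proof -
  have "(\<integral>\<^sup>+x. ennreal (g x * (1 - cos (2 * pi * (x \<bullet> \<xi>)))) \<partial>lborel) =
      ennreal (\<integral>x. g x * (1 - cos (2 * pi * (x \<bullet> \<xi>))) \<partial>lborel)"
    using integrable_noise_cos[OF g, of \<xi>] noise_density_integrable[OF g] noise_density_nonneg[OF g]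
    by (intro nn_integral_eq_integral) (auto simp: right_diff_distrib intro!: AE_I2 mult_left_le)
  also have "(\<integral>x. g x * (1 - cos (2 * pi * (x \<bullet> \<xi>))) \<partial>lborel) = 1 - Re (ghat g \<xi>)"
    using integrable_noise_cos[OF g, of \<xi>] noise_density_integrable[OF g]
    by (simp add: right_diff_distrib Re_ghat[OF g] noise_density_integral[OF g])
  finally show ?thesis .
qed

lemma truncated_moment_le_one:
  assumes g: "noise_density g"
  shows "truncated_moment g t \<le> 1"
proof -
  have "truncated_moment g t \<le> (\<integral>\<^sup>+z. ennreal (g z) \<partial>lborel)"
    unfolding truncated_moment_def using noise_density_nonneg[OF g]
    by (intro nn_integral_mono ennreal_leI mult_left_le) auto
  then show ?thesis by (simp add: noise_density_nn_integral[OF g])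
qed

text \<open>Since \<open>min \<alpha> 1 \<le> \<alpha>\<close>, the corresponding power of
  \<open>norm z\<close> is at most \<open>1 + norm z powr \<alpha>\<close>, so the mass and the
  moment of the density together give the constant.\<close>

lemma truncated_moment_bound_moment:
  fixes g :: "real^'d \<Rightarrow> real"
  assumes g: "noise_density g" and \<alpha>: "0 < \<alpha>" and m: "moment_finite g \<alpha>"
  shows "\<exists>C>0. \<forall>t\<ge>0. truncated_moment g t \<le> ennreal (C * t powr min \<alpha> 1)"
proof (intro exI conjI allI impI)
  define \<gamma> where "\<gamma> = min \<alpha> 1"
  define C where "C = (\<integral>z. g z + norm z powr \<alpha> * g z \<partial>lborel)"
  have i: "integrable lborel (\<lambda>z. g z + norm z powr \<alpha> * g z)"
    using m noise_density_integrable[OF g] by (auto simp: moment_finite_def)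
  have nn: "0 \<le> g z + norm z powr \<alpha> * g z" for z
    using noise_density_nonneg[OF g] by (intro add_nonneg_nonneg mult_nonneg_nonneg) auto
  show "0 < C + 1" using nn unfolding C_def by (intro add_nonneg_pos Bochner_Integration.integral_nonneg) auto
  fix t :: real assume t: "0 \<le> t"
  have "truncated_moment g t \<le> (\<integral>\<^sup>+z. ennreal (t powr \<gamma> * (g z + norm z powr \<alpha> * g z)) \<partial>lborel)"
    unfolding truncated_moment_def
  proof (intro nn_integral_mono ennreal_leI)
    fix z :: "real^'d"
    have "min 1 ((t * norm z)\<^sup>2) \<le> (t * norm z) powr \<gamma>"
      using t \<alpha> by (intro min_one_le_powr) (auto simp: \<gamma>_def)
    also have "\<dots> = t powr \<gamma> * norm z powr \<gamma>" using t by (simp add: powr_mult)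
    also have "norm z powr \<gamma> \<le> 1 + norm z powr \<alpha>"
    proof (cases "norm z \<le> 1")
      case True
      then have "norm z powr \<gamma> \<le> 1" using \<alpha> by (intro powr_le1) (auto simp: \<gamma>_def)
      then show ?thesis using powr_ge_zero[of "norm z" \<alpha>] by linarith
    next
      case False
      then have "norm z powr \<gamma> \<le> norm z powr \<alpha>" by (intro powr_mono) (auto simp: \<gamma>_def)
      then show ?thesis by simp
    qed
    finally have "min 1 ((t * norm z)\<^sup>2) \<le> t powr \<gamma> * (1 + norm z powr \<alpha>)"
      by (simp add: mult_left_mono)
    from mult_left_mono[OF this noise_density_nonneg[OF g, of z]]
    show "g z * min 1 ((t * norm z)\<^sup>2) \<le> t powr \<gamma> * (g z + norm z powr \<alpha> * g z)"
      by (simp add: algebra_simps)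
  qed
  also have "\<dots> = ennreal (\<integral>z. t powr \<gamma> * (g z + norm z powr \<alpha> * g z) \<partial>lborel)"
    using i nn by (intro nn_integral_eq_integral) auto
  also have "\<dots> \<le> ennreal ((C + 1) * t powr \<gamma>)"
  proof (rule ennreal_leI)
    have "(\<integral>z. t powr \<gamma> * (g z + norm z powr \<alpha> * g z) \<partial>lborel) = C * t powr \<gamma>"
      by (simp only: C_def integral_mult_right_zero mult.commute)
    also have "\<dots> \<le> (C + 1) * t powr \<gamma>" by (intro mult_right_mono) auto
    finally show "(\<integral>z. t powr \<gamma> * (g z + norm z powr \<alpha> * g z) \<partial>lborel) \<le> (C + 1) * t powr \<gamma>" .
  qed
  finally show "truncated_moment g t \<le> ennreal ((C + 1) * t powr min \<alpha> 1)" by (simp add: \<gamma>_def)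
qed

text \<open>The classical control of tails by the characteristic function near 0: along each
  coordinate axis the mean of \<open>1 - ghat\<close> over the frequencies \<open>t * u\<close>
  dominates the truncated second moment. All these frequencies stay below \<open>\<delta>\<close>,
  where the assumed bound applies. The factor 8 comes from \<open>sinc_bound\<close>, the dimension
  from summing over coordinates.\<close>

lemma truncated_moment_bound_fourier_small:
  fixes g :: "real^'d \<Rightarrow> real" and C \<delta> t \<alpha> :: real
  assumes g: "noise_density g" and \<alpha>: "0 < \<alpha>" and C: "0 < C" and t: "0 < t" "t < \<delta>"
    and le: "\<And>\<xi>. 0 < norm \<xi> \<Longrightarrow> norm \<xi> < \<delta> \<Longrightarrow> norm (1 - ghat g \<xi>) \<le> C * norm \<xi> powr \<alpha>"
  shows "truncated_moment g t \<le> ennreal (8 * real CARD('d) * C * t powr \<alpha>)"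
proof -
  note [measurable] = noise_density_measurable[OF g]
  have cos_le: "(\<integral>\<^sup>+z. ennreal (g z * (1 - cos (2 * pi * t * (z $ i) * u))) \<partial>lborel) \<le> ennreal (C * t powr \<alpha>)"
    if u: "u \<in> {0..1}" for u and i :: 'd
  proof (cases "u = 0")
    case False
    define \<xi> :: "real^'d" where "\<xi> = axis i (t * u)"
    have n: "norm \<xi> = t * u" using t u by (simp add: \<xi>_def norm_eq_sqrt_inner inner_axis_axis)
    have "(\<integral>\<^sup>+z. ennreal (g z * (1 - cos (2 * pi * t * (z $ i) * u))) \<partial>lborel)
        = (\<integral>\<^sup>+z. ennreal (g z * (1 - cos (2 * pi * (z \<bullet> \<xi>)))) \<partial>lborel)"
      by (simp add: \<xi>_def inner_axis mult_ac)
    also have "\<dots> = ennreal (1 - Re (ghat g \<xi>))" by (rule nn_integral_one_minus_cos[OF g])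
    also have "1 - Re (ghat g \<xi>) \<le> C * norm \<xi> powr \<alpha>"
    proof -
      have "1 - Re (ghat g \<xi>) \<le> norm (1 - ghat g \<xi>)"
        using complex_Re_le_cmod[of "1 - ghat g \<xi>"] by simp
      also have "t * u \<le> t * 1" using t u by (intro mult_left_mono) auto
      then have "t * u < \<delta>" using t by linarith
      then have "norm (1 - ghat g \<xi>) \<le> C * norm \<xi> powr \<alpha>"
        using t u False by (intro le; simp add: n)
      finally show ?thesis .
    qed
    also have "C * norm \<xi> powr \<alpha> \<le> C * t powr \<alpha>"
      using t u C \<alpha> by (intro mult_left_mono powr_mono2) (auto simp: n mult_left_le)
    finally show ?thesis by (simp add: ennreal_leI)
  qed simp
  have coord: "(\<integral>\<^sup>+z. ennreal (g z * min 1 ((t * z $ i)\<^sup>2)) \<partial>lborel) \<le> ennreal (8 * C * t powr \<alpha>)" for i :: 'd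
  proof -
    have "(\<integral>\<^sup>+z. ennreal (g z * min 1 ((t * z $ i)\<^sup>2)) \<partial>lborel)
        \<le> (\<integral>\<^sup>+z. (\<integral>\<^sup>+u. 8 * (ennreal (g z * (1 - cos (2 * pi * t * (z $ i) * u))) * indicator {0..1} u) \<partial>lborel) \<partial>lborel)"
    proof (rule nn_integral_mono)
      fix z :: "real^'d"
      \<comment> \<open>The factor 2 pi of the Fourier convention only enlarges the truncated
        square.\<close>
      have "1 \<le> 2 * pi" using pi_gt3 by simp
      then have "1 \<le> (2 * pi)\<^sup>2" by (rule one_le_power)
      then have "1 * (t * z $ i)\<^sup>2 \<le> (2 * pi)\<^sup>2 * (t * z $ i)\<^sup>2" by (intro mult_right_mono) auto
      also have "\<dots> = (2 * pi * t * (z $ i))\<^sup>2" by (simp add: power_mult_distrib)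
      finally have "ennreal (min 1 ((t * z $ i)\<^sup>2)) \<le> ennreal (min 1 ((2 * pi * t * (z $ i))\<^sup>2))"
        by (intro ennreal_leI) auto
      also note nn_integral_one_minus_cos_ge
      finally have "ennreal (g z) * ennreal (min 1 ((t * z $ i)\<^sup>2)) \<le>
          ennreal (g z) * (8 * (\<integral>\<^sup>+u. ennreal (1 - cos (2 * pi * t * (z $ i) * u)) * indicator {0..1} u \<partial>lborel))"
        by (rule mult_left_mono) simp
      also have "\<dots> = (\<integral>\<^sup>+u. 8 * (ennreal (g z * (1 - cos (2 * pi * t * (z $ i) * u))) * indicator {0..1} u) \<partial>lborel)"
      proof -
        have "ennreal (g z) * (8 * (\<integral>\<^sup>+u. ennreal (1 - cos (2 * pi * t * (z $ i) * u)) * indicator {0..1} u \<partial>lborel))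
          = (\<integral>\<^sup>+u. (ennreal (g z) * 8) * (ennreal (1 - cos (2 * pi * t * (z $ i) * u)) * indicator {0..1} u) \<partial>lborel)"
          by (subst nn_integral_cmult) (auto simp: mult.assoc)
        also have "\<dots> = (\<integral>\<^sup>+u. 8 * (ennreal (g z * (1 - cos (2 * pi * t * (z $ i) * u))) * indicator {0..1} u) \<partial>lborel)"
          using noise_density_nonneg[OF g, of z]
          by (intro nn_integral_cong) (simp add: ennreal_mult mult_ac)
        finally show ?thesis .
      qed
      finally show "ennreal (g z * min 1 ((t * z $ i)\<^sup>2)) \<le>
          (\<integral>\<^sup>+u. 8 * (ennreal (g z * (1 - cos (2 * pi * t * (z $ i) * u))) * indicator {0..1} u) \<partial>lborel)"
        using noise_density_nonneg[OF g, of z] by (simp add: ennreal_mult)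
    qed
    also have "\<dots> = (\<integral>\<^sup>+u. (\<integral>\<^sup>+z. 8 * (ennreal (g z * (1 - cos (2 * pi * t * (z $ i) * u))) * indicator {0..1} u) \<partial>lborel) \<partial>lborel)"
      by (rule lborel_pair.Fubini') measurable
    also have "\<dots> \<le> (\<integral>\<^sup>+u. 8 * ennreal (C * t powr \<alpha>) * indicator {0..1::real} u \<partial>lborel)"
    proof (rule nn_integral_mono)
      fix u :: real
      show "(\<integral>\<^sup>+z. 8 * (ennreal (g z * (1 - cos (2 * pi * t * (z $ i) * u))) * indicator {0..1} u) \<partial>lborel)
          \<le> 8 * ennreal (C * t powr \<alpha>) * indicator {0..1} u"
        using cos_le[of u i] by (cases "u \<in> {0..1}") (auto simp: nn_integral_cmult intro!: mult_left_mono)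
    qed
    also have "\<dots> = 8 * ennreal (C * t powr \<alpha>)" by (simp add: nn_integral_cmult)
    also have "\<dots> = ennreal (8 * C * t powr \<alpha>)" using C by (simp add: ennreal_mult' mult.assoc)
    finally show ?thesis .
  qed
  have "truncated_moment g t \<le> (\<integral>\<^sup>+z. (\<Sum>i\<in>UNIV. ennreal (g z * min 1 ((t * z $ i)\<^sup>2))) \<partial>lborel)"
    unfolding truncated_moment_def
  proof (rule nn_integral_mono)
    fix z :: "real^'d"
    have "(t * norm z)\<^sup>2 = (\<Sum>i\<in>UNIV. (t * z $ i)\<^sup>2)"
      by (simp add: power_mult_distrib norm_vec_def L2_set_def sum_nonneg sum_distrib_left)
    then have "min 1 ((t * norm z)\<^sup>2) \<le> (\<Sum>i\<in>UNIV. min 1 ((t * z $ i)\<^sup>2))"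
      using min_one_sum_le[of UNIV "\<lambda>i. (t * z $ i)\<^sup>2"] by simp
    from mult_left_mono[OF this noise_density_nonneg[OF g, of z]]
    show "ennreal (g z * min 1 ((t * norm z)\<^sup>2)) \<le> (\<Sum>i\<in>UNIV. ennreal (g z * min 1 ((t * z $ i)\<^sup>2)))"
      using noise_density_nonneg[OF g, of z] by (simp add: sum_distrib_left ennreal_leI)
  qed
  also have "\<dots> = (\<Sum>i\<in>UNIV. (\<integral>\<^sup>+z. ennreal (g z * min 1 ((t * z $ i)\<^sup>2)) \<partial>lborel))"
    by (rule nn_integral_sum) measurable
  also have "\<dots> \<le> (\<Sum>i\<in>(UNIV::'d set). ennreal (8 * C * t powr \<alpha>))"
    by (intro sum_mono coord)
  also have "\<dots> = ennreal (8 * real CARD('d) * C * t powr \<alpha>)"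
    using C by (subst sum_ennreal) (auto simp: mult_ac)
  finally show ?thesis .
qed

lemma truncated_moment_bound:
  fixes g :: "real^'d \<Rightarrow> real"
  assumes g: "noise_density g" and \<alpha>: "0 < \<alpha>" and cond: "moment_finite g \<alpha> \<or> fourier_asymp g \<alpha>"
  shows "\<exists>C>0. \<forall>t\<ge>0. truncated_moment g t \<le> ennreal (C * t powr min \<alpha> 1)"
  using cond
proof
  assume "moment_finite g \<alpha>" then show ?thesis by (rule truncated_moment_bound_moment[OF g \<alpha>])
next
  assume "fourier_asymp g \<alpha>"
  then obtain C \<delta> where C: "C > 0" "\<delta> > 0"
    and le: "\<And>\<xi>. 0 < norm \<xi> \<Longrightarrow> norm \<xi> < \<delta> \<Longrightarrow> norm (1 - ghat g \<xi>) \<le> C * norm \<xi> powr \<alpha>"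
    unfolding fourier_asymp_def by blast
  define \<gamma> where "\<gamma> = min \<alpha> 1"
  \<comment> \<open>At most 1, so that \<open>t powr \<alpha> \<le> t powr \<gamma>\<close> below
    \<open>\<rho>\<close>. From \<open>\<rho>\<close> on, the trivial bound 1 on the truncated
    moment is absorbed by the summand \<open>\<rho> powr (- \<gamma>)\<close> of the
    constant.\<close>
  define \<rho> where "\<rho> = min \<delta> 1"
  have \<rho>: "0 < \<rho>" "\<rho> \<le> 1" "\<rho> \<le> \<delta>" and \<gamma>: "0 < \<gamma>" "\<gamma> \<le> \<alpha>" using C \<alpha> by (auto simp: \<rho>_def \<gamma>_def)
  define K where "K = 8 * real CARD('d) * C + \<rho> powr (- \<gamma>)"
  have Kpos: "8 * real CARD('d) * C > 0" "\<rho> powr (- \<gamma>) > 0" using C \<rho> by auto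
  show ?thesis
  proof (intro exI[of _ K] conjI allI impI)
    show "0 < K" unfolding K_def using Kpos by (rule add_pos_pos)
    fix t :: real assume t: "0 \<le> t"
    consider "t = 0" | "0 < t" "t < \<rho>" | "\<rho> \<le> t" using t by linarith
    then have "truncated_moment g t \<le> ennreal (K * t powr \<gamma>)"
    proof cases
      case 1 then show ?thesis by (simp add: truncated_moment_def)
    next
      case 2
      have "truncated_moment g t \<le> ennreal (8 * real CARD('d) * C * t powr \<alpha>)"
        using 2 \<rho> by (intro truncated_moment_bound_fourier_small[OF g \<alpha> C(1) _ _ le]) auto
      also have "\<dots> \<le> ennreal (K * t powr \<gamma>)"
        using Kpos 2 \<rho> \<gamma> by (intro ennreal_leI mult_mono powr_mono') (auto simp: K_def)
      finally show ?thesis .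
    next
      case 3
      have "\<rho> powr \<gamma> \<le> t powr \<gamma>" using 3 \<rho> \<gamma> by (intro powr_mono2) auto
      then have "1 \<le> \<rho> powr (- \<gamma>) * t powr \<gamma>"
        using \<rho> by (simp add: powr_minus field_simps)
      also have "\<dots> \<le> K * t powr \<gamma>"
        using Kpos by (intro mult_right_mono) (auto simp: K_def)
      finally show ?thesis
        by (intro order_trans[OF truncated_moment_le_one[OF g]]) (simp add: ennreal_leI flip: ennreal_1)
    qed
    then show "truncated_moment g t \<le> ennreal (K * t powr min \<alpha> 1)" by (simp add: \<gamma>_def)
  qed
qed

subsection \<open>Lipschitz bounds for the dynamics\<close>

text \<open>\<open>F (x + k) - F x\<close> is continuous in \<open>x\<close> with lattice values,
  and distinct integers differ by at least 1, so it is constant on the connected space. Consequently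
  the derivative of the lift is periodic.\<close>

lemma torus_lift_translation:
  fixes F :: "real^'d \<Rightarrow> real^'d"
  assumes F: "torus_lift F" "continuous_on UNIV F" and k: "k \<in> lattice"
  obtains c where "\<And>x. F (x + k) = F x + c"
proof -
  have "(F (x + k) - F x) $ i = (F (0 + k) - F 0) $ i" for x i
  proof -
    have "(\<lambda>x. (F (x + k) - F x) $ i) constant_on UNIV"
    proof (rule continuous_discrete_range_constant)
      show "continuous_on UNIV (\<lambda>x. (F (x + k) - F x) $ i)"
        by (intro continuous_intros continuous_on_compose2[OF F(2)]) auto
      fix x :: "real^'d"
      have "1 \<le> \<bar>(F (y + k) - F y) $ i - (F (x + k) - F x) $ i\<bar>"
        if "(F (y + k) - F y) $ i \<noteq> (F (x + k) - F x) $ i" for y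
        using F(1) k that by (intro Ints_nonzero_abs_ge1 Ints_diff) (auto simp: torus_lift_def lattice_def)
      then show "\<exists>e>0. \<forall>y. y \<in> UNIV \<and> (F (y + k) - F y) $ i \<noteq> (F (x + k) - F x) $ i \<longrightarrow>
          e \<le> norm ((F (y + k) - F y) $ i - (F (x + k) - F x) $ i)"
        by (intro exI[of _ 1]) auto
    qed (rule connected_UNIV)
    then show ?thesis unfolding constant_on_def by (metis UNIV_I)
  qed
  then have "F (x + k) - F x = F (0 + k) - F 0" for x by (simp only: vec_eq_iff) blast
  then show ?thesis by (intro that[of "F (0 + k) - F 0"]) (metis add.commute diff_add_cancel)
qed

lemma C1_map_continuous: "C1_map F \<Longrightarrow> continuous_on UNIV F"
  unfolding C1_map_def by (meson continuous_at_imp_continuous_on has_derivative_continuous)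

lemma C1_map_has_derivative:
  "C1_map F \<Longrightarrow> (F has_derivative frechet_derivative F (at x)) (at x)"
  unfolding C1_map_def by (metis differentiableI frechet_derivative_works)

text \<open>Periodicity of the derivative reduces the supremum to the closed cube, where compactness
  bounds it. This has to be secured because \<open>normD\<close> is a real supremum, meaningful only
  for bounded sets.\<close>

lemma bdd_above_onorm_derivative:
  fixes F :: "real^'d \<Rightarrow> real^'d"
  assumes lift: "torus_lift F" and C1: "C1_map F"
  shows "bdd_above (range (\<lambda>x. onorm (frechet_derivative F (at x))))"
proof -
  from C1 obtain F' where F': "\<And>x. (F has_derivative blinfun_apply (F' x)) (at x)" "continuous_on UNIV F'"
    unfolding C1_map_def by blast
  have eq: "onorm (frechet_derivative F (at x)) = norm (F' x)" for x
    using frechet_derivative_at[OF F'(1)[of x]] by (simp add: norm_blinfun.rep_eq)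
  have per: "F' (frac_vec x) = F' x" for x
  proof -
    obtain c where c: "\<And>y. F (y + - lat_vec (floor_vec x)) = F y + c"
      using torus_lift_translation[OF lift C1_map_continuous[OF C1], of "- lat_vec (floor_vec x)"]
      by (metis lat_vec_in_lattice lat_vec_minus)
    have fr: "frac_vec x = x + - lat_vec (floor_vec x)" by (simp add: frac_vec_eq)
    have "((\<lambda>y. F (y + - lat_vec (floor_vec x))) has_derivative blinfun_apply (F' (frac_vec x))) (at x)"
    proof (rule has_derivative_eq_rhs)
      show "((\<lambda>y. F (y + - lat_vec (floor_vec x))) has_derivative (\<lambda>h. blinfun_apply (F' (frac_vec x)) h)) (at x)"
        unfolding fr by (rule has_derivative_compose[OF _ F'(1), where f'="\<lambda>h. h"])
          (auto intro!: derivative_eq_intros)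
    qed simp
    moreover have "((\<lambda>y. F y + c) has_derivative blinfun_apply (F' x)) (at x)"
      by (rule has_derivative_eq_rhs, rule has_derivative_add[OF F'(1) has_derivative_const]) auto
    ultimately have "blinfun_apply (F' (frac_vec x)) = blinfun_apply (F' x)"
      unfolding c by (rule has_derivative_unique)
    then show ?thesis by (simp add: blinfun_eqI)
  qed
  have "compact (F' ` cbox 0 (\<chi> i. 1))"
    by (intro compact_continuous_image continuous_on_subset[OF F'(2)]) auto
  then obtain B where B: "\<And>y. y \<in> cbox 0 (\<chi> i. 1) \<Longrightarrow> norm (F' y) \<le> B"
    by (metis bounded_iff compact_imp_bounded imageI)
  have "norm (F' x) \<le> B" for x
  proof -
    have "frac_vec x \<in> cbox 0 (\<chi> i. 1)"
      using frac_vec_in_cube[of x] by (simp add: cube_def mem_box_cart less_imp_le)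
    from B[OF this] show ?thesis by (simp add: per)
  qed
  then show ?thesis unfolding eq by (intro bdd_aboveI[of _ B]) auto
qed

lemma normD_nonnegI:
  assumes "bdd_above (range (\<lambda>x. onorm (frechet_derivative (F ^^ n) (at x))))"
    and "\<And>x. ((F ^^ n) has_derivative frechet_derivative (F ^^ n) (at x)) (at x)"
  shows "0 \<le> normD F n"
proof -
  have "0 \<le> onorm (frechet_derivative (F ^^ n) (at 0))"
    by (rule onorm_pos_le[OF has_derivative_bounded_linear[OF assms(2)]])
  also have "\<dots> \<le> normD F n"
    unfolding normD_def by (rule cSUP_upper[OF _ assms(1)]) simp
  finally show ?thesis .
qed

text \<open>Proved together because the supremum \<open>normD F n\<close> can be used only once the
  derivatives of the iterate are known to be bounded; the chain rule yields that bound and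
  submultiplicativity at once.\<close>

lemma
  fixes F :: "real^'d \<Rightarrow> real^'d"
  assumes lift: "torus_lift F" and C1: "C1_map F"
  shows funpow_has_derivative: "((F ^^ n) has_derivative frechet_derivative (F ^^ n) (at x)) (at x)"
    and onorm_funpow_le: "onorm (frechet_derivative (F ^^ n) (at x)) \<le> normD F n"
    and normD_nonneg: "0 \<le> normD F n"
    and normD_le_power: "normD F n \<le> normD F 1 ^ n"
proof -
  have bl: "bounded_linear (frechet_derivative F (at x))" for x
    by (rule has_derivative_bounded_linear[OF C1_map_has_derivative[OF C1]])
  have le1: "onorm (frechet_derivative F (at x)) \<le> normD F 1" for x
    using cSUP_upper[OF _ bdd_above_onorm_derivative[OF lift C1]] by (simp add: normD_def)
  have "0 \<le> onorm (frechet_derivative F (at 0))" by (rule onorm_pos_le[OF bl])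
  then have nn1: "0 \<le> normD F 1" using le1[of 0] by linarith
  have "\<exists>D. (\<forall>x. ((F ^^ n) has_derivative D x) (at x)) \<and> (\<forall>x. onorm (D x) \<le> normD F 1 ^ n)" for n
  proof (induction n)
    case 0
    show ?case by (intro exI[of _ "\<lambda>x h. h"]) (auto simp: id_def onorm_id_le)
  next
    case (Suc n)
    then obtain D where D: "\<And>x. ((F ^^ n) has_derivative D x) (at x)" "\<And>x. onorm (D x) \<le> normD F 1 ^ n"
      by blast
    show ?case
    proof (intro exI[of _ "\<lambda>x. frechet_derivative F (at ((F ^^ n) x)) \<circ> D x"] conjI allI)
      fix x
      show "((F ^^ Suc n) has_derivative frechet_derivative F (at ((F ^^ n) x)) \<circ> D x) (at x)"
        using diff_chain_at[OF D(1) C1_map_has_derivative[OF C1]] by (simp add: comp_def)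
      have "onorm (frechet_derivative F (at ((F ^^ n) x)) \<circ> D x)
          \<le> onorm (frechet_derivative F (at ((F ^^ n) x))) * onorm (D x)"
        by (rule onorm_compose[OF bl has_derivative_bounded_linear[OF D(1)]])
      also have "\<dots> \<le> normD F 1 * normD F 1 ^ n"
        using nn1 onorm_pos_le[OF has_derivative_bounded_linear[OF D(1)]] by (intro mult_mono le1 D(2))
      finally show "onorm (frechet_derivative F (at ((F ^^ n) x)) \<circ> D x) \<le> normD F 1 ^ Suc n" by simp
    qed
  qed
  then obtain D where D: "\<And>x. ((F ^^ n) has_derivative D x) (at x)" "\<And>x. onorm (D x) \<le> normD F 1 ^ n"
    by blast
  have eq: "frechet_derivative (F ^^ n) (at x) = D x" for x
    using frechet_derivative_at[OF D(1)] by simp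
  show A: "((F ^^ n) has_derivative frechet_derivative (F ^^ n) (at x)) (at x)" for x
    using D(1) by (simp add: eq)
  have bdd: "bdd_above (range (\<lambda>x. onorm (frechet_derivative (F ^^ n) (at x))))"
    unfolding eq using D(2) by (intro bdd_aboveI[of _ "normD F 1 ^ n"]) auto
  show "onorm (frechet_derivative (F ^^ n) (at x)) \<le> normD F n"
    unfolding normD_def by (rule cSUP_upper[OF _ bdd]) simp
  show "0 \<le> normD F n" by (rule normD_nonnegI[OF bdd A])
  show "normD F n \<le> normD F 1 ^ n"
    unfolding normD_def[of F n] using D(2) by (intro cSUP_least) (auto simp: eq)
qed

lemma funpow_lipschitz:
  fixes F :: "real^'d \<Rightarrow> real^'d"
  assumes "torus_lift F" "C1_map F"
  shows "norm ((F ^^ n) x - (F ^^ n) y) \<le> normD F n * norm (x - y)"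
  using funpow_has_derivative[OF assms, of n] onorm_funpow_le[OF assms, of n]
  by (intro differentiable_bound[of UNIV "F ^^ n" "\<lambda>x. frechet_derivative (F ^^ n) (at x)"]) auto

text \<open>Justifies \<open>normD F 1\<close> as the constant \<mu> in the bound for the
  coarse-grained operators.\<close>

lemma muF_le_normD:
  assumes "torus_lift F" "C1_map F"
  shows "muF F \<le> ereal (normD F 1)"
  unfolding muF_def
proof (rule Limsup_bounded)
  show "\<forall>\<^sub>F n in sequentially. ereal (normD F n powr (1 / real n)) \<le> ereal (normD F 1)"
    using eventually_gt_at_top[of 0]
  proof eventually_elim
    case (elim n)
    have nn: "0 \<le> normD F 1" by (rule normD_nonneg[OF assms])
    have "normD F n powr (1 / real n) \<le> (normD F 1 ^ n) powr (1 / real n)"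
      using normD_nonneg[OF assms] normD_le_power[OF assms] by (intro powr_mono2) auto
    also have "\<dots> = normD F 1"
    proof (cases "normD F 1 = 0")
      case False
      with nn have "(normD F 1 ^ n) powr (1 / real n) = (normD F 1 powr real n) powr (1 / real n)"
        by (simp add: powr_realpow)
      then show ?thesis using elim nn False by (simp add: powr_powr)
    qed (use elim in simp)
    finally show ?case by simp
  qed
qed

section \<open>Measure preservation under iteration and inversion; contractions of mean-zero
  functions\<close>

lemma mpres_id: "mpres (\<lambda>x. x)"
  by (simp add: mpres_def torus_lift_def)

lemma mpres_funpow:
  assumes "mpres F" shows "mpres (F ^^ n)"
proof (induction n)
  case 0 then show ?case by (simp add: id_def mpres_id)
next
  case (Suc n) then show ?case using mpres_comp[OF assms Suc] by (simp add: comp_def)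
qed

lemma mpres_inv:
  fixes F :: "real^'d \<Rightarrow> real^'d"
  assumes F: "mpres F" "bij F" and i: "torus_lift (inv F)" "inv F \<in> borel \<rightarrow>\<^sub>M borel"
  shows "mpres (inv F)"
  unfolding mpres_def
proof (intro conjI allI impI i)
  fix \<phi> :: "real^'d \<Rightarrow> ennreal"
  assume [measurable]: "\<phi> \<in> borel_measurable borel" and p: "periodic_fun \<phi>"
  note [measurable] = i(2)
  have "(\<integral>\<^sup>+x. \<phi> (inv F x) \<partial>torus) = (\<integral>\<^sup>+x. \<phi> (inv F (F x)) \<partial>torus)"
    by (rule mpres_nn_integral[OF F(1), symmetric]) (simp_all add: periodic_fun_comp_lift[OF p i(1)])
  then show "(\<integral>\<^sup>+x. \<phi> (inv F x) \<partial>torus) = (\<integral>\<^sup>+x. \<phi> x \<partial>torus)"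
    using F(2) by (simp add: bij_is_inj)
qed

lemma mpres_C1_map:
  assumes "torus_lift F" "C1_map F" "torus_measure_preserving F"
  shows "mpres F"
  using assms by (intro mpresI_torus_measure_preserving)
    (auto intro: borel_measurable_continuous_onI C1_map_continuous)

text \<open>Operators on functions, not on classes modulo null sets, so that contractivity has to be
  carried along as a closure property of the set \<^const>\<open>L2_0\<close>.\<close>

definition contraction_L2_0 :: "((real^'d \<Rightarrow> real) \<Rightarrow> (real^'d \<Rightarrow> real)) \<Rightarrow> bool" where
  "contraction_L2_0 A \<longleftrightarrow> (\<forall>f\<in>L2_0. A f \<in> L2_0 \<and> nsq (A f) \<le> nsq f)"

lemma contraction_comp: "contraction_L2_0 A \<Longrightarrow> contraction_L2_0 B \<Longrightarrow> contraction_L2_0 (A \<circ> B)"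
  unfolding contraction_L2_0_def comp_def by (meson order_trans)

lemma contraction_funpow: "contraction_L2_0 A \<Longrightarrow> contraction_L2_0 (A ^^ n)"
proof (induction n)
  case 0 then show ?case by (simp add: contraction_L2_0_def)
next
  case (Suc n) then show ?case unfolding funpow.simps by (intro contraction_comp)
qed

lemma L2_0D: "f \<in> L2_0 \<Longrightarrow> f \<in> borel_measurable borel" "f \<in> L2_0 \<Longrightarrow> periodic_fun f"
  "f \<in> L2_0 \<Longrightarrow> f \<in> L2_torus" "f \<in> L2_0 \<Longrightarrow> (\<integral>x. f x \<partial>torus) = 0"
  by (auto simp: L2_0_iff)

lemma contraction_Gop:
  assumes "noise_density g" "0 < \<epsilon>"
  shows "contraction_L2_0 (Gop g \<epsilon>)"
proof -
  interpret torus_kernel "gtilde g \<epsilon>" by (rule torus_kernel_gtilde[OF assms])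
  show ?thesis
    using conv_L2_0 nsq_conv_le L2_0D(3) by (auto simp: contraction_L2_0_def Gop_eq_conv[OF assms] L2_0D)
qed

lemma Uop_L2_0:
  assumes S: "mpres S" and f: "f \<in> L2_0"
  shows "Uop S f \<in> L2_0"
proof -
  note [measurable] = L2_0D(1)[OF f] mpres_measurable[OF S]
  have "periodic_fun (\<lambda>x. (f x)\<^sup>2)" using L2_0D(2)[OF f] by (simp add: periodic_fun_def)
  then show ?thesis
    using mpres_integrable[OF S, of "\<lambda>x. (f x)\<^sup>2"] mpres_integral[OF S L2_0D(1,2)[OF f]] L2_0D[OF f]
      periodic_fun_comp_lift[OF L2_0D(2)[OF f] mpres_lift[OF S]]
    by (auto simp: L2_0_iff L2_torus_def Uop_def comp_def)
qed

lemma contraction_Uop: "mpres S \<Longrightarrow> contraction_L2_0 (Uop S)"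
  by (auto simp: contraction_L2_0_def Uop_L2_0 nsq_Uop L2_0D)

text \<open>Contractivity bounds the set of norms from above, which the real supremum in
  \<open>opnorm\<close> requires.\<close>

lemma opnorm_ge:
  assumes A: "contraction_L2_0 A" and f: "f \<in> L2_0" "nsq f \<le> 1"
  shows "sqrt (nsq (A f)) \<le> opnorm A"
proof -
  have "bdd_above {L2norm (A f) | f. f \<in> L2_0 \<and> L2norm f \<le> 1}"
  proof (rule bdd_aboveI[of _ 1])
    fix y assume "y \<in> {L2norm (A f) | f. f \<in> L2_0 \<and> L2norm f \<le> 1}"
    then obtain h where h: "y = L2norm (A h)" "h \<in> L2_0" "L2norm h \<le> 1" by blast
    then have "nsq (A h) \<le> nsq h" "A h \<in> L2_0" using A by (auto simp: contraction_L2_0_def)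
    with h show "y \<le> 1" by (auto simp: L2norm_eq L2_0D)
  qed
  then have "L2norm (A f) \<le> opnorm A"
    unfolding opnorm_def using f by (intro cSup_upper) (auto simp: L2norm_eq L2_0D)
  then show ?thesis using A f by (simp add: L2norm_eq L2_0D contraction_L2_0_def)
qed

text \<open>A number in the unit interval lies below its square root. The resulting bound is linear
  in the energy, the quantity tracked along the iteration.\<close>

lemma opnorm_ge_nsq:
  assumes A: "contraction_L2_0 A" and f: "f \<in> L2_0" "nsq f \<le> 1"
  shows "nsq (A f) \<le> opnorm A"
proof -
  have "nsq (A f) \<le> 1" using A f by (force simp: contraction_L2_0_def)
  then have "nsq (A f) * nsq (A f) \<le> nsq (A f) * 1" by (intro mult_left_mono) auto
  then have "nsq (A f) \<le> sqrt (nsq (A f))" by (intro real_le_rsqrt) (simp add: power2_eq_square)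
  then show ?thesis using opnorm_ge[OF assms] by linarith
qed

lemma opnorm_le:
  assumes "\<And>f. f \<in> L2_0 \<Longrightarrow> A f \<in> L2_0 \<and> nsq (A f) \<le> q\<^sup>2 * nsq f" "0 \<le> q"
  shows "opnorm A \<le> q"
  unfolding opnorm_def
proof (rule cSup_least)
  have "(\<lambda>x. 0) \<in> L2_0" by (simp add: L2_0_iff L2_torus_const)
  then show "{L2norm (A f) | f. f \<in> L2_0 \<and> L2norm f \<le> 1} \<noteq> {}"
    by (auto intro!: exI[of _ "\<lambda>x. 0"] simp: L2norm_eq nsq_def)
  fix y assume "y \<in> {L2norm (A f) | f. f \<in> L2_0 \<and> L2norm f \<le> 1}"
  then obtain h where h: "y = L2norm (A h)" "h \<in> L2_0" "L2norm h \<le> 1" by blast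
  then have "nsq (A h) \<le> q\<^sup>2 * nsq h" using assms(1) by blast
  also have "\<dots> \<le> q\<^sup>2 * 1" using h by (intro mult_left_mono) (auto simp: L2norm_eq L2_0D)
  finally have "sqrt (nsq (A h)) \<le> q" using assms(2) by (intro real_le_lsqrt) auto
  then show "y \<le> q" using h assms(1) by (auto simp: L2norm_eq L2_0D)
qed

section \<open>Characters of the torus and a normalized test observable\<close>

definition character :: "int^'d \<Rightarrow> real^'d \<Rightarrow> complex" where
  "character m x = cis (2 * pi * (lat_vec m \<bullet> x))"

lemma character_continuous: "continuous_on A (character m)"
  unfolding character_def by (intro continuous_intros)

lemma character_measurable [measurable]: "character m \<in> borel_measurable borel"
  by (intro borel_measurable_continuous_onI character_continuous)

lemma norm_character [simp]: "norm (character m x) = 1"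
  by (simp add: character_def)

lemma inner_lat_vec_Ints: "k \<in> lattice \<Longrightarrow> lat_vec m \<bullet> k \<in> \<int>" for m :: "int^'d"
  by (auto simp: inner_vec_def lattice_def lat_vec_def intro!: Ints_sum Ints_mult)

lemma character_periodic: "periodic_fun (character (m :: int^'d))"
  unfolding periodic_fun_def
proof safe
  fix x k :: "real^'d" assume k: "k \<in> lattice"
  have "cis (2 * pi * (lat_vec m \<bullet> k)) = 1"
    using cis_multiple_2pi[OF inner_lat_vec_Ints[OF k]] by simp
  then show "character m (x + k) = character m x"
    by (simp add: character_def inner_add_right distrib_left flip: cis_mult)
qed

text \<open>Translation by a vector \<open>a\<close> with
  \<open>lat_vec m \<bullet> a = 1 / 2\<close> flips the sign of the character, and invariance
  forces the integral to equal its negative.\<close>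

lemma integral_character:
  fixes m :: "int^'d"
  assumes "m \<noteq> 0"
  shows "(\<integral>x. character m x \<partial>torus) = 0"
proof -
  have ne: "lat_vec m \<noteq> 0" using assms by (auto simp: lat_vec_def vec_eq_iff)
  define a where "a = (1 / (2 * (lat_vec m \<bullet> lat_vec m))) *\<^sub>R lat_vec m"
  have "character m (x + a) = - character m x" for x
    using ne by (simp add: character_def a_def inner_add_right distrib_left flip: cis_mult)
  then have "(\<integral>x. character m x \<partial>torus) = (\<integral>x. - character m x \<partial>torus)"
    using mpres_integral[OF mpres_translation[of a] character_measurable[of m] character_periodic] by simp
  then show ?thesis by simp
qed

lemma integral_cos_character:
  fixes m :: "int^'d"
  assumes "m \<noteq> 0"
  shows "(\<integral>x. cos (2 * pi * (lat_vec m \<bullet> x)) \<partial>torus) = 0"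
proof -
  have i: "integrable torus (character m)"
    by (rule torus.integrable_const_bound[of _ 1]) auto
  have "(\<integral>x. cos (2 * pi * (lat_vec m \<bullet> x)) \<partial>torus) = (\<integral>x. Re (character m x) \<partial>torus)"
    by (simp add: character_def)
  also have "\<dots> = Re (\<integral>x. character m x \<partial>torus)" by (rule integral_Re[OF i])
  finally show ?thesis by (simp add: integral_character[OF assms])
qed

lemma normalized_smooth_obs:
  obtains \<phi> :: "real^'d \<Rightarrow> real" and L where "0 < L" "\<phi> \<in> smooth_obs L" "nsq \<phi> = 1"
proof -
  define m :: "int^'d" where "m = axis undefined 1"
  \<comment> \<open>The second inequality is for the double-angle term of the squared cosine, whose
    mean must vanish too.\<close>
  have m: "m \<noteq> 0" "2 * m \<noteq> 0" by (auto simp: m_def vec_eq_iff axis_def)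
  have m2: "lat_vec (2 * m) = 2 *\<^sub>R lat_vec m" by (simp add: lat_vec_def vec_eq_iff)
  have nm: "norm (lat_vec m) = 1"
  proof -
    have "lat_vec m = axis undefined 1" by (simp add: lat_vec_def m_def vec_eq_iff axis_def)
    then show ?thesis by simp
  qed
  \<comment> \<open>The factor \<open>sqrt 2\<close> normalizes, as the squared cosine has mean
    1/2.\<close>
  define \<phi> where "\<phi> x = sqrt 2 * cos (2 * pi * (lat_vec m \<bullet> x))" for x
  have [measurable]: "\<phi> \<in> borel_measurable borel" unfolding \<phi>_def by measurable
  have per: "periodic_fun \<phi>"
    using character_periodic[of m] by (auto simp: periodic_fun_def \<phi>_def character_def cis.ctr)
  have bd: "\<bar>\<phi> x\<bar> \<le> 2" for x
  proof -
    have "sqrt 2 * \<bar>cos (2 * pi * (lat_vec m \<bullet> x))\<bar> \<le> 2 * 1"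
      by (intro mult_mono) (auto simp: real_le_lsqrt)
    then show ?thesis by (simp add: \<phi>_def abs_mult)
  qed
  have lip: "\<bar>\<phi> x - \<phi> y\<bar> \<le> (sqrt 2 * (2 * pi)) * norm (x - y)" for x y
  proof -
    have cosl: "\<bar>cos a - cos b\<bar> \<le> \<bar>a - b\<bar>" for a b :: real
    proof -
      have "norm (cos a - cos b) \<le> 1 * norm (a - b)"
        by (rule field_differentiable_bound[of UNIV cos "\<lambda>x. - sin x"])
          (auto intro!: derivative_eq_intros)
      then show ?thesis by simp
    qed
    have "\<bar>\<phi> x - \<phi> y\<bar> = sqrt 2 * \<bar>cos (2 * pi * (lat_vec m \<bullet> x)) - cos (2 * pi * (lat_vec m \<bullet> y))\<bar>"
      by (simp add: \<phi>_def abs_mult flip: right_diff_distrib)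
    also have "\<dots> \<le> sqrt 2 * \<bar>2 * pi * (lat_vec m \<bullet> x) - 2 * pi * (lat_vec m \<bullet> y)\<bar>"
      by (intro mult_left_mono cosl) simp
    also have "\<dots> = sqrt 2 * (2 * pi) * \<bar>lat_vec m \<bullet> (x - y)\<bar>"
      by (simp add: inner_diff_right abs_mult flip: right_diff_distrib)
    also have "\<dots> \<le> sqrt 2 * (2 * pi) * (norm (lat_vec m) * norm (x - y))"
      by (intro mult_left_mono Cauchy_Schwarz_ineq2) auto
    finally show ?thesis by (simp add: nm)
  qed
  have int0: "(\<integral>x. \<phi> x \<partial>torus) = 0"
    using integral_cos_character[OF m(1)] by (simp add: \<phi>_def)
  have i: "integrable torus (\<lambda>x. cos (2 * pi * (lat_vec (2 * m) \<bullet> x)))"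
    by (rule torus.integrable_const_bound[of _ 1]) auto
  have "nsq \<phi> = (\<integral>x. 1 + cos (2 * pi * (lat_vec (2 * m) \<bullet> x)) \<partial>torus)"
    unfolding nsq_def
  proof (rule Bochner_Integration.integral_cong[OF refl])
    fix x
    have "cos (2 * (2 * pi * (lat_vec m \<bullet> x))) = 2 * (cos (2 * pi * (lat_vec m \<bullet> x)))\<^sup>2 - 1"
      by (rule cos_double_cos)
    moreover have "2 * pi * (lat_vec (2 * m) \<bullet> x) = 2 * (2 * pi * (lat_vec m \<bullet> x))"
      by (simp add: m2)
    ultimately show "(\<phi> x)\<^sup>2 = 1 + cos (2 * pi * (lat_vec (2 * m) \<bullet> x))"
      by (simp add: \<phi>_def power_mult_distrib)
  qed
  also have "\<dots> = 1" using i integral_cos_character[OF m(2)] by simp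
  finally have "nsq \<phi> = 1" .
  with lip bd per int0 show thesis
    by (intro that[of "sqrt 2 * (2 * pi)" \<phi>]) (auto simp: smooth_obs_def)
qed

subsection \<open>Lower bounds for the dissipation times\<close>

lemma power_powr: "0 \<le> (a::real) \<Longrightarrow> (a ^ n) powr b = (a powr b) ^ n"
  by (induction n) (auto simp: powr_mult)

text \<open>The noise enters through a power bound on its truncated moment, so that both
  alternatives of the hypothesis are treated at once. The exponent will be
  \<open>min \<alpha> 1\<close>.\<close>

locale noisy_map =
  fixes F :: "real^'d \<Rightarrow> real^'d" and g :: "real^'d \<Rightarrow> real" and C \<gamma> :: real
  assumes F_lift: "torus_lift F" and F_C1: "C1_map F" and F_mpres: "mpres F"
    and noise: "noise_density g"
    and C_pos: "0 < C" and \<gamma>_pos: "0 < \<gamma>" and \<gamma>_le_1: "\<gamma> \<le> 1"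
    and truncated: "\<And>t. 0 \<le> t \<Longrightarrow> truncated_moment g t \<le> ennreal (C * t powr \<gamma>)"
begin

lemma nsq_Gop_loss:
  assumes "0 < \<epsilon>" "0 \<le> L" "u \<in> smooth_obs L"
  shows "nsq u - 16 * C * (\<epsilon> * L) powr \<gamma> \<le> nsq (Gop g \<epsilon> u)"
  using nsq_Gop_ge[OF noise assms(1,3,2) truncated] assms C_pos by (simp add: mult.assoc)

text \<open>The sum starts at 1 because \<open>Uop F\<close> acts before \<open>Gop\<close>: the
  noise meets a function already stretched once more. Each step adds the loss at the current
  Lipschitz constant \<open>L * K ^ j\<close>; composition with \<open>F\<close> loses
  nothing.\<close>

lemma Top_iterate:
  assumes \<epsilon>: "0 < \<epsilon>" and L: "0 \<le> L" and u: "u \<in> smooth_obs L"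
    and K: "0 \<le> K" "\<And>x y. norm (F x - F y) \<le> K * norm (x - y)"
  shows "(Top g F \<epsilon> ^^ n) u \<in> smooth_obs (L * K ^ n) \<and>
    nsq u - 16 * C * (\<epsilon> * L) powr \<gamma> * (\<Sum>j=1..n. (K powr \<gamma>) ^ j) \<le> nsq ((Top g F \<epsilon> ^^ n) u)"
proof (induction n)
  case (Suc n)
  let ?v = "(Top g F \<epsilon> ^^ n) u"
  have LK: "0 \<le> L * K ^ n" "0 \<le> L * K ^ Suc n" using L K by simp_all
  have v: "?v \<in> smooth_obs (L * K ^ n)" using Suc by blast
  have Uv: "Uop F ?v \<in> smooth_obs (L * K ^ Suc n)"
    using Uop_smooth_obs[OF F_mpres K(2) v LK(1)] by (simp add: mult_ac)
  have "nsq ?v - 16 * C * (\<epsilon> * (L * K ^ Suc n)) powr \<gamma> \<le> nsq (Gop g \<epsilon> (Uop F ?v))"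
    using nsq_Gop_loss[OF \<epsilon> LK(2) Uv] nsq_Uop[OF F_mpres smooth_obsD(1,2)[OF v]] by simp
  also have "(\<epsilon> * (L * K ^ Suc n)) powr \<gamma> = (\<epsilon> * L) powr \<gamma> * (K powr \<gamma>) ^ Suc n"
    using \<epsilon> L K by (simp add: powr_mult power_powr)
  finally have "nsq ?v - 16 * C * (\<epsilon> * L) powr \<gamma> * (K powr \<gamma>) ^ Suc n \<le> nsq (Gop g \<epsilon> (Uop F ?v))"
    by (simp only: mult.assoc)
  moreover have "(Top g F \<epsilon> ^^ Suc n) u = Gop g \<epsilon> (Uop F ?v)" by (simp add: Top_def)
  moreover have "(\<Sum>j=1..Suc n. (K powr \<gamma>) ^ j) = (\<Sum>j=1..n. (K powr \<gamma>) ^ j) + (K powr \<gamma>) ^ Suc n"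
    by simp
  ultimately show ?case
    using Suc[THEN conjunct2] Gop_smooth_obs[OF noise \<epsilon> Uv] by (simp only: distrib_left simp_thms)
qed (use u in simp)

text \<open>Here the noise comes first and the stretching second, hence the sum starts at exponent
  0.\<close>

lemma dual_iterate:
  assumes S: "mpres S" and \<epsilon>: "0 < \<epsilon>" and L: "0 \<le> L" and u: "u \<in> smooth_obs L"
    and K: "0 \<le> K" "\<And>x y. norm (S x - S y) \<le> K * norm (x - y)"
  shows "((Uop S \<circ> Gop g \<epsilon>) ^^ n) u \<in> smooth_obs (L * K ^ n) \<and>
    nsq u - 16 * C * (\<epsilon> * L) powr \<gamma> * (\<Sum>j<n. (K powr \<gamma>) ^ j) \<le> nsq (((Uop S \<circ> Gop g \<epsilon>) ^^ n) u)"
proof (induction n)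
  case (Suc n)
  let ?v = "((Uop S \<circ> Gop g \<epsilon>) ^^ n) u"
  have LK: "0 \<le> L * K ^ n" using L K by simp
  have v: "?v \<in> smooth_obs (L * K ^ n)" using Suc by blast
  note Gv = Gop_smooth_obs[OF noise \<epsilon> v]
  have UGv: "Uop S (Gop g \<epsilon> ?v) \<in> smooth_obs (L * K ^ Suc n)"
    using Uop_smooth_obs[OF S K(2) Gv LK] by (simp add: mult_ac)
  have "nsq ?v - 16 * C * (\<epsilon> * (L * K ^ n)) powr \<gamma> \<le> nsq (Uop S (Gop g \<epsilon> ?v))"
    using nsq_Gop_loss[OF \<epsilon> LK v] nsq_Uop[OF S smooth_obsD(1,2)[OF Gv]] by simp
  also have "(\<epsilon> * (L * K ^ n)) powr \<gamma> = (\<epsilon> * L) powr \<gamma> * (K powr \<gamma>) ^ n"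
    using \<epsilon> L K by (simp add: powr_mult power_powr)
  finally have "nsq ?v - 16 * C * (\<epsilon> * L) powr \<gamma> * (K powr \<gamma>) ^ n \<le> nsq (Uop S (Gop g \<epsilon> ?v))"
    by (simp only: mult.assoc)
  moreover have "((Uop S \<circ> Gop g \<epsilon>) ^^ Suc n) u = Uop S (Gop g \<epsilon> ?v)" by simp
  moreover have "(\<Sum>j<Suc n. (K powr \<gamma>) ^ j) = (\<Sum>j<n. (K powr \<gamma>) ^ j) + (K powr \<gamma>) ^ n"
    by simp
  ultimately show ?case
    using Suc[THEN conjunct2] UGv by (simp only: distrib_left simp_thms)
qed (use u in simp)

lemma contraction_Top: "0 < \<epsilon> \<Longrightarrow> contraction_L2_0 (Top g F \<epsilon> ^^ n)"
  unfolding Top_def by (intro contraction_funpow contraction_comp contraction_Gop contraction_Uop noise F_mpres)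

lemma contraction_Ttilde: "0 < \<epsilon> \<Longrightarrow> contraction_L2_0 (Ttilde g F \<epsilon> n)"
  unfolding Ttilde_def by (intro contraction_comp contraction_Gop contraction_Uop noise mpres_funpow F_mpres)

lemma opnorm_Top_ge:
  assumes K: "0 \<le> K" "\<And>x y. norm (F x - F y) \<le> K * norm (x - y)"
  obtains B where "0 < B"
    "\<And>\<epsilon> n. 0 < \<epsilon> \<Longrightarrow> 1 - B * \<epsilon> powr \<gamma> * (\<Sum>j=1..n. (K powr \<gamma>) ^ j) \<le> opnorm (Top g F \<epsilon> ^^ n)"
proof -
  obtain \<phi> :: "real^'d \<Rightarrow> real" and L where \<phi>: "0 < L" "\<phi> \<in> smooth_obs L" "nsq \<phi> = 1"
    by (rule normalized_smooth_obs)
  show ?thesis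
  proof (rule that)
    show "0 < 16 * C * L powr \<gamma>" using \<phi> C_pos by simp
    fix \<epsilon> :: real and n assume \<epsilon>: "0 < \<epsilon>"
    have "1 - 16 * C * (\<epsilon> * L) powr \<gamma> * (\<Sum>j=1..n. (K powr \<gamma>) ^ j) \<le> nsq ((Top g F \<epsilon> ^^ n) \<phi>)"
      using Top_iterate[OF \<epsilon> _ \<phi>(2) K] \<phi> by simp
    also have "\<dots> \<le> opnorm (Top g F \<epsilon> ^^ n)"
      using \<phi> by (intro opnorm_ge_nsq contraction_Top \<epsilon> smooth_obs_L2_0[OF \<phi>(2)]) auto
    finally show "1 - 16 * C * L powr \<gamma> * \<epsilon> powr \<gamma> * (\<Sum>j=1..n. (K powr \<gamma>) ^ j) \<le> opnorm (Top g F \<epsilon> ^^ n)"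
      using \<epsilon> \<phi> by (simp add: powr_mult mult_ac)
  qed
qed

text \<open>Self-adjointness moves \<open>Gop\<close> across the pairing; the change of variables by
  \<open>F\<close> turns composition with \<open>F\<close> into composition with its inverse
  \<open>S\<close>. Factors leave the outer end of one product and enter the inner end of the other,
  so \<open>h\<close> varies in the induction.\<close>

lemma Top_dual:
  assumes S: "mpres S" "\<And>x. S (F x) = x" "\<And>x. F (S x) = x" and \<epsilon>: "0 < \<epsilon>" and f: "f \<in> L2_0" and h: "h \<in> L2_0"
  shows "(\<integral>x. (Top g F \<epsilon> ^^ n) f x * h x \<partial>torus) = (\<integral>x. f x * ((Uop S \<circ> Gop g \<epsilon>) ^^ n) h x \<partial>torus)"
  using h
proof (induction n arbitrary: h)
  case (Suc n)
  interpret torus_kernel "gtilde g \<epsilon>" by (rule torus_kernel_gtilde[OF noise \<epsilon>])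
  let ?w = "(Top g F \<epsilon> ^^ n) f"
  have w: "?w \<in> L2_0" using contraction_Top[OF \<epsilon>, of n] f by (auto simp: contraction_L2_0_def)
  have Uw: "Uop F ?w \<in> L2_0" by (rule Uop_L2_0[OF F_mpres w])
  have Gh: "Gop g \<epsilon> h \<in> L2_0" using contraction_Gop[OF noise \<epsilon>] Suc.prems by (auto simp: contraction_L2_0_def)
  have UGh: "Uop S (Gop g \<epsilon> h) \<in> L2_0" by (rule Uop_L2_0[OF S(1) Gh])
  have "(\<integral>x. (Top g F \<epsilon> ^^ Suc n) f x * h x \<partial>torus) = (\<integral>x. h x * conv (Uop F ?w) x \<partial>torus)"
  proof -
    have "(Top g F \<epsilon> ^^ Suc n) f = conv (Uop F ?w)"
      by (simp add: Top_def Gop_eq_conv[OF noise \<epsilon> L2_0D(1)[OF Uw, unfolded Top_def]])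
    then show ?thesis by (simp only: mult.commute)
  qed
  also have "\<dots> = (\<integral>x. conv h x * Uop F ?w x \<partial>torus)"
    by (rule conv_selfadjoint[OF L2_0D(3)[OF Uw] L2_0D(3)[OF Suc.prems]])
  also have "\<dots> = (\<integral>x. (\<lambda>y. ?w y * Uop S (Gop g \<epsilon> h) y) (F x) \<partial>torus)"
    by (simp add: Gop_eq_conv[OF noise \<epsilon> L2_0D(1)[OF Suc.prems]] Uop_def S(2) mult.commute)
  also have "\<dots> = (\<integral>x. ?w x * Uop S (Gop g \<epsilon> h) x \<partial>torus)"
  proof (rule mpres_integral[OF F_mpres])
    note [measurable] = L2_0D(1)[OF w] L2_0D(1)[OF UGh]
    show "(\<lambda>y. ?w y * Uop S (Gop g \<epsilon> h) y) \<in> borel_measurable borel" by measurable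
    show "periodic_fun (\<lambda>y. ?w y * Uop S (Gop g \<epsilon> h) y)"
      using L2_0D(2)[OF w] L2_0D(2)[OF UGh] by (simp add: periodic_fun_def)
  qed
  also have "\<dots> = (\<integral>x. f x * ((Uop S \<circ> Gop g \<epsilon>) ^^ n) (Uop S (Gop g \<epsilon> h)) x \<partial>torus)"
    by (rule Suc.IH[OF UGh])
  also have "((Uop S \<circ> Gop g \<epsilon>) ^^ n) (Uop S (Gop g \<epsilon> h)) = ((Uop S \<circ> Gop g \<epsilon>) ^^ Suc n) h"
    by (simp only: funpow_Suc_right comp_apply)
  finally show ?case .
qed simp

text \<open>The operator norm equals that of the adjoint \<open>(U\<^sub>S G\<^sub>\<epsilon>)\<^sup>n\<close> with \<open>S\<close> the inverse of
  \<open>F\<close>; testing with \<open>a = (U\<^sub>S G\<^sub>\<epsilon>)\<^sup>n \<phi>\<close> gives \<open>\<parallel>a\<parallel>\<^sup>2\<close> as a lower bound.\<close>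

lemma opnorm_Top_ge_inverse:
  assumes S: "mpres S" "\<And>x. S (F x) = x" "\<And>x. F (S x) = x"
    and K: "1 \<le> K" "\<And>x y. norm (S x - S y) \<le> K * norm (x - y)"
  obtains B where "0 < B"
    "\<And>\<epsilon> n. 0 < \<epsilon> \<Longrightarrow> 1 - B * \<epsilon> powr \<gamma> * (\<Sum>j=1..n. (K powr \<gamma>) ^ j) \<le> opnorm (Top g F \<epsilon> ^^ n)"
proof -
  obtain \<phi> :: "real^'d \<Rightarrow> real" and L where \<phi>: "0 < L" "\<phi> \<in> smooth_obs L" "nsq \<phi> = 1"
    by (rule normalized_smooth_obs)
  have \<phi>0: "\<phi> \<in> L2_0" by (rule smooth_obs_L2_0[OF \<phi>(2)])
  show ?thesis
  proof (rule that)
    show "0 < 16 * C * L powr \<gamma>" using \<phi> C_pos by simp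
    fix \<epsilon> :: real and n assume \<epsilon>: "0 < \<epsilon>"
    let ?a = "((Uop S \<circ> Gop g \<epsilon>) ^^ n) \<phi>"
    have cS: "contraction_L2_0 ((Uop S \<circ> Gop g \<epsilon>) ^^ n)"
      by (intro contraction_funpow contraction_comp contraction_Gop contraction_Uop noise S(1) \<epsilon>)
    have a: "?a \<in> L2_0" "nsq ?a \<le> 1" using cS \<phi>0 \<phi>(3) by (auto simp: contraction_L2_0_def)
    have Ta: "(Top g F \<epsilon> ^^ n) ?a \<in> L2_0"
      using contraction_Top[OF \<epsilon>, of n] a by (auto simp: contraction_L2_0_def)
    have r: "1 \<le> K powr \<gamma>" using K \<gamma>_pos by (intro ge_one_powr_ge_zero) auto
    \<comment> \<open>Raising every exponent by one only enlarges the sum and brings it to the shape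
      of \<open>opnorm_Top_ge\<close>, so that \<open>tau_log_lower_bound\<close> serves both
      cases.\<close>
    have "(\<Sum>j<n. (K powr \<gamma>) ^ j) \<le> (\<Sum>j<n. (K powr \<gamma>) ^ Suc j)"
      using r by (intro sum_mono power_increasing) auto
    also have "\<dots> = (\<Sum>j=1..n. (K powr \<gamma>) ^ j)"
      by (rule sum.reindex_bij_witness[of _ "\<lambda>j. j - 1" Suc]) auto
    finally have "1 - 16 * C * (\<epsilon> * L) powr \<gamma> * (\<Sum>j=1..n. (K powr \<gamma>) ^ j)
       \<le> 1 - 16 * C * (\<epsilon> * L) powr \<gamma> * (\<Sum>j<n. (K powr \<gamma>) ^ j)"
      using C_pos by (intro diff_left_mono mult_left_mono) auto
    also have "\<dots> \<le> nsq ?a"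
      using dual_iterate[OF S(1) \<epsilon> _ \<phi>(2) _ K(2)] \<phi> K by simp
    also have "nsq ?a = (\<integral>x. (Top g F \<epsilon> ^^ n) ?a x * \<phi> x \<partial>torus)"
      by (subst Top_dual[OF S \<epsilon> a(1) \<phi>0]) (simp add: nsq_def power2_eq_square)
    also have "\<dots> \<le> sqrt (nsq ((Top g F \<epsilon> ^^ n) ?a)) * sqrt (nsq \<phi>)"
      by (rule integral_mult_le_nsq[OF L2_0D(3)[OF Ta] L2_0D(3)[OF \<phi>0]])
    also have "\<dots> \<le> opnorm (Top g F \<epsilon> ^^ n)"
      using opnorm_ge[OF contraction_Top[OF \<epsilon>] a] \<phi> by simp
    finally show "1 - 16 * C * L powr \<gamma> * \<epsilon> powr \<gamma> * (\<Sum>j=1..n. (K powr \<gamma>) ^ j) \<le> opnorm (Top g F \<epsilon> ^^ n)"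
      using \<epsilon> \<phi> by (simp add: powr_mult mult_ac)
  qed
qed

text \<open>One loss occurs for the test function, at scale \<open>L\<close>, and one after
  \<open>n\<close> steps, at scale \<open>L * normD F n\<close>. The norm of the iterate enters as a
  whole and not as a power, which is what polynomial or bounded growth calls for.\<close>

lemma opnorm_Ttilde_ge:
  obtains B where "0 < B"
    "\<And>\<epsilon> n. 0 < \<epsilon> \<Longrightarrow> 1 - B * \<epsilon> powr \<gamma> * (1 + normD F n powr \<gamma>) \<le> opnorm (Ttilde g F \<epsilon> n)"
proof -
  obtain \<phi> :: "real^'d \<Rightarrow> real" and L where \<phi>: "0 < L" "\<phi> \<in> smooth_obs L" "nsq \<phi> = 1"
    by (rule normalized_smooth_obs)
  show ?thesis
  proof (rule that)
    show "0 < 16 * C * L powr \<gamma>" using \<phi> C_pos by simp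
    fix \<epsilon> :: real and n assume \<epsilon>: "0 < \<epsilon>"
    have nn: "0 \<le> normD F n" by (rule normD_nonneg[OF F_lift F_C1])
    have G\<phi>: "Gop g \<epsilon> \<phi> \<in> smooth_obs L" by (rule Gop_smooth_obs[OF noise \<epsilon> \<phi>(2)])
    have L: "0 \<le> L" "0 \<le> L * normD F n" using \<phi> nn by auto
    have U: "Uop (F ^^ n) (Gop g \<epsilon> \<phi>) \<in> smooth_obs (L * normD F n)"
      by (rule Uop_smooth_obs[OF mpres_funpow[OF F_mpres] funpow_lipschitz[OF F_lift F_C1] G\<phi> L(1)])
    have "1 - 16 * C * (\<epsilon> * L) powr \<gamma> \<le> nsq (Gop g \<epsilon> \<phi>)"
      using nsq_Gop_loss[OF \<epsilon> L(1) \<phi>(2)] \<phi> by simp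
    also have "\<dots> = nsq (Uop (F ^^ n) (Gop g \<epsilon> \<phi>))"
      by (rule nsq_Uop[symmetric, OF mpres_funpow[OF F_mpres] smooth_obsD(1,2)[OF G\<phi>]])
    finally have "1 - 16 * C * (\<epsilon> * L) powr \<gamma> - 16 * C * (\<epsilon> * (L * normD F n)) powr \<gamma> \<le> nsq (Ttilde g F \<epsilon> n \<phi>)"
      using nsq_Gop_loss[OF \<epsilon> L(2) U] by (simp add: Ttilde_def)
    also have "\<dots> \<le> opnorm (Ttilde g F \<epsilon> n)"
      using \<phi> by (intro opnorm_ge_nsq contraction_Ttilde \<epsilon> smooth_obs_L2_0[OF \<phi>(2)]) auto
    finally show "1 - 16 * C * L powr \<gamma> * \<epsilon> powr \<gamma> * (1 + normD F n powr \<gamma>) \<le> opnorm (Ttilde g F \<epsilon> n)"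
      using \<epsilon> \<phi> nn by (simp add: powr_mult algebra_simps)
  qed
qed

end

section \<open>From operator norm bounds to dissipation times\<close>

lemma exp_minus_1_le_half: "exp (- 1) \<le> (1 / 2 :: real)"
  using exp_ge_add_one_self[of 1] by (simp add: exp_minus field_simps)

text \<open>An infinite \<open>tau\<close> satisfies every lower bound, so only times at which the
  threshold is crossed matter.\<close>

lemma tau_geI:
  assumes "\<And>n. 1 \<le> n \<Longrightarrow> opnorm (Top g F \<epsilon> ^^ n) < exp (- 1) \<Longrightarrow> X \<le> real n"
  shows "ereal X \<le> tau g F \<epsilon>"
proof (cases "\<exists>n\<ge>1. opnorm (Top g F \<epsilon> ^^ n) < exp (- 1)")
  case True
  then have "(LEAST n. n \<ge> 1 \<and> opnorm (Top g F \<epsilon> ^^ n) < exp (- 1)) \<ge> 1 \<and>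
      opnorm (Top g F \<epsilon> ^^ (LEAST n. n \<ge> 1 \<and> opnorm (Top g F \<epsilon> ^^ n) < exp (- 1))) < exp (- 1)"
    by (rule LeastI_ex)
  with True assms show ?thesis by (simp add: tau_def)
next
  case False
  then show ?thesis unfolding tau_def if_not_P[OF False] by simp
qed

lemma tau_tilde_geI:
  assumes "\<And>n. 1 \<le> n \<Longrightarrow> opnorm (Ttilde g F \<epsilon> n) < exp (- 1) \<Longrightarrow> X \<le> real n"
  shows "ereal X \<le> tau_tilde g F \<epsilon>"
proof (cases "\<exists>n\<ge>1. opnorm (Ttilde g F \<epsilon> n) < exp (- 1)")
  case True
  then have "(LEAST n. n \<ge> 1 \<and> opnorm (Ttilde g F \<epsilon> n) < exp (- 1)) \<ge> 1 \<and>
      opnorm (Ttilde g F \<epsilon> (LEAST n. n \<ge> 1 \<and> opnorm (Ttilde g F \<epsilon> n) < exp (- 1))) < exp (- 1)"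
    by (rule LeastI_ex)
  with True assms show ?thesis by (simp add: tau_tilde_def)
next
  case False
  then show ?thesis unfolding tau_tilde_def if_not_P[OF False] by simp
qed

lemma eventually_small_powr:
  assumes "0 < c" "0 < \<gamma>"
  shows "\<forall>\<^sub>F \<epsilon> in at_right (0::real). 0 < \<epsilon> \<and> \<epsilon> < 1 \<and> \<epsilon> powr \<gamma> < c"
proof -
  have "\<epsilon> powr \<gamma> < c" if "0 < \<epsilon>" "\<epsilon> < c powr (1 / \<gamma>)" for \<epsilon> :: real
  proof -
    have "\<epsilon> powr \<gamma> < (c powr (1 / \<gamma>)) powr \<gamma>" using that assms by (intro powr_less_mono2) auto
    then show ?thesis using assms by (simp add: powr_powr)
  qed
  then show ?thesis
    using assms by (intro eventually_at_rightI[of 0 "min 1 (c powr (1 / \<gamma>))"]) auto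
qed

text \<open>The last premise says that the accumulated loss exceeds 1/2, as it must before the norm
  falls below \<open>exp (- 1)\<close>. Taking logarithms of \<open>1 < 2 * D * \<epsilon> powr
  \<gamma> * (lam powr \<gamma>) ^ n\<close> and dividing by \<open>\<gamma> * ln lam\<close>
  isolates \<open>n\<close> and produces the additive constant.\<close>

lemma log_time_bound:
  fixes \<gamma> lam D \<epsilon> :: real
  assumes "1 < lam" "0 < \<gamma>" "\<gamma> \<le> 1" "0 < D" "0 < \<epsilon>" "\<epsilon> < 1"
    and *: "1 / 2 < D * \<epsilon> powr \<gamma> * (lam powr \<gamma>) ^ n"
  shows "\<gamma> / ln lam * ln (1 / \<epsilon>) + (- ln (2 * D) / (\<gamma> * ln lam)) \<le> real n"
proof -
  have l: "0 < ln lam" using assms by simp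
  have e: "0 < ln (1 / \<epsilon>)" using assms by simp
  have "ln 1 < ln (2 * D * \<epsilon> powr \<gamma> * (lam powr \<gamma>) ^ n)"
    using assms by (subst ln_less_cancel_iff) auto
  also have "\<dots> = ln (2 * D) + \<gamma> * ln \<epsilon> + real n * (\<gamma> * ln lam)"
    using assms by (simp add: ln_mult ln_powr ln_realpow)
  finally have "- ln (2 * D) + \<gamma> * ln (1 / \<epsilon>) < real n * (\<gamma> * ln lam)"
    using assms by (simp add: ln_div algebra_simps)
  then have "(- ln (2 * D) + \<gamma> * ln (1 / \<epsilon>)) / (\<gamma> * ln lam) < real n"
    using l assms by (simp add: divide_less_eq)
  moreover have "(- ln (2 * D) + \<gamma> * ln (1 / \<epsilon>)) / (\<gamma> * ln lam) = - ln (2 * D) / (\<gamma> * ln lam) + 1 / ln lam * ln (1 / \<epsilon>)"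
    using assms by (simp add: add_divide_distrib diff_divide_distrib)
  \<comment> \<open>The logarithms give the coefficient \<open>1 / ln lam\<close>, lowered here to
    the claimed one.\<close>
  moreover have "\<gamma> / ln lam * ln (1 / \<epsilon>) \<le> 1 / ln lam * ln (1 / \<epsilon>)"
    using assms l e by (intro mult_right_mono divide_right_mono) auto
  ultimately show ?thesis by linarith
qed

text \<open>The last term dominates up to the factor \<open>r / (r - 1)\<close>, which only moves
  the additive constant of the time bound.\<close>

lemma geometric_sum_le:
  fixes r :: real
  assumes "1 < r"
  shows "(\<Sum>j=1..n. r ^ j) \<le> r / (r - 1) * r ^ n"
proof (induction n)
  case 0 then show ?case using assms by simp
next
  case (Suc n)
  have "(\<Sum>j=1..Suc n. r ^ j) \<le> r / (r - 1) * r ^ n + r ^ Suc n" using Suc by simp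
  also have "\<dots> = r / (r - 1) * r ^ Suc n" using assms by (simp add: field_simps)
  finally show ?case .
qed

lemma tau_log_lower_bound:
  assumes lam: "1 < lam" and \<gamma>: "0 < \<gamma>" "\<gamma> \<le> 1" and B: "0 < B"
    and op: "\<And>\<epsilon> n. 0 < \<epsilon> \<Longrightarrow> 1 - B * \<epsilon> powr \<gamma> * (\<Sum>j=1..n. (lam powr \<gamma>) ^ j) \<le> opnorm (Top g F \<epsilon> ^^ n)"
  shows "\<exists>c. \<forall>\<^sub>F \<epsilon> in at_right 0. tau g F \<epsilon> \<ge> ereal (\<gamma> / ln lam * ln (1 / \<epsilon>) + c)"
proof
  define r where "r = lam powr \<gamma>"
  have r: "1 < r" using lam \<gamma> by (simp add: r_def)
  define D where "D = B * (r / (r - 1))"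
  have D: "0 < D" using B r by (simp add: D_def)
  show "\<forall>\<^sub>F \<epsilon> in at_right 0. tau g F \<epsilon> \<ge> ereal (\<gamma> / ln lam * ln (1 / \<epsilon>) + (- ln (2 * D) / (\<gamma> * ln lam)))"
    using eventually_small_powr[OF zero_less_one \<gamma>(1)]
  proof eventually_elim
    case (elim \<epsilon>)
    show ?case
    proof (rule tau_geI)
      fix n assume "opnorm (Top g F \<epsilon> ^^ n) < exp (- 1)"
      with op[of \<epsilon> n] elim exp_minus_1_le_half have "1 / 2 < B * \<epsilon> powr \<gamma> * (\<Sum>j=1..n. r ^ j)"
        by (simp add: r_def)
      also have "\<dots> \<le> B * \<epsilon> powr \<gamma> * (r / (r - 1) * r ^ n)"
        using B geometric_sum_le[OF r, of n] by (intro mult_left_mono) auto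
      also have "\<dots> = D * \<epsilon> powr \<gamma> * r ^ n" by (simp add: D_def mult_ac)
      finally show "\<gamma> / ln lam * ln (1 / \<epsilon>) + (- ln (2 * D) / (\<gamma> * ln lam)) \<le> real n"
        using lam \<gamma> D elim by (intro log_time_bound) (auto simp: r_def)
    qed
  qed
qed

lemma ereal_le_multI:
  assumes "0 < C" "ereal (a / C) \<le> t"
  shows "ereal a \<le> ereal C * t"
proof -
  have "ereal a = ereal C * ereal (a / C)" using assms(1) by simp
  also have "\<dots> \<le> ereal C * t" using assms by (intro ereal_mult_left_mono) auto
  finally show ?thesis .
qed

context noisy_map
begin

lemma F_lipschitz: "0 \<le> normD F 1" "norm (F x - F y) \<le> normD F 1 * norm (x - y)"
  using normD_nonneg[OF F_lift F_C1] funpow_lipschitz[OF F_lift F_C1, of 1] by auto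

lemma tau_lower:
  assumes "1 < normD F 1"
  shows "\<exists>c. \<forall>\<^sub>F \<epsilon> in at_right 0. tau g F \<epsilon> \<ge> ereal (\<gamma> / ln (normD F 1) * ln (1 / \<epsilon>) + c)"
proof -
  obtain B where "0 < B" "\<And>\<epsilon> n. 0 < \<epsilon> \<Longrightarrow>
      1 - B * \<epsilon> powr \<gamma> * (\<Sum>j=1..n. (normD F 1 powr \<gamma>) ^ j) \<le> opnorm (Top g F \<epsilon> ^^ n)"
    using opnorm_Top_ge[OF F_lipschitz] by blast
  then show ?thesis using assms \<gamma>_pos \<gamma>_le_1 by (intro tau_log_lower_bound)
qed

lemma tau_lower_inverse:
  assumes d: "torus_C1_diffeo F" and "1 < normD (inv F) 1"
  shows "\<exists>c. \<forall>\<^sub>F \<epsilon> in at_right 0. tau g F \<epsilon> \<ge> ereal (\<gamma> / ln (normD (inv F) 1) * ln (1 / \<epsilon>) + c)"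
proof -
  have i: "bij F" "torus_lift (inv F)" "C1_map (inv F)" using d by (auto simp: torus_C1_diffeo_def)
  have S: "mpres (inv F)" "inv F (F x) = x" "F (inv F x) = x" for x
    using i C1_map_continuous[OF i(3)]
    by (auto intro!: mpres_inv F_mpres borel_measurable_continuous_onI
        simp: bij_is_inj bij_is_surj surj_f_inv_f)
  have lip: "norm (inv F x - inv F y) \<le> normD (inv F) 1 * norm (x - y)" for x y
    using funpow_lipschitz[OF i(2,3), of 1] by simp
  obtain B where "0 < B" "\<And>\<epsilon> n. 0 < \<epsilon> \<Longrightarrow>
      1 - B * \<epsilon> powr \<gamma> * (\<Sum>j=1..n. (normD (inv F) 1 powr \<gamma>) ^ j) \<le> opnorm (Top g F \<epsilon> ^^ n)"
    using opnorm_Top_ge_inverse[OF S _ lip] assms(2) by (metis less_imp_le)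
  then show ?thesis using assms \<gamma>_pos \<gamma>_le_1 by (intro tau_log_lower_bound)
qed

lemma tau_tilde_lower:
  assumes lam: "1 < normD F 1"
  shows "\<exists>c. \<forall>\<^sub>F \<epsilon> in at_right 0. tau_tilde g F \<epsilon> \<ge> ereal (\<gamma> / ln (normD F 1) * ln (1 / \<epsilon>) + c)"
proof -
  obtain B where B: "0 < B" "\<And>\<epsilon> n. 0 < \<epsilon> \<Longrightarrow>
      1 - B * \<epsilon> powr \<gamma> * (1 + normD F n powr \<gamma>) \<le> opnorm (Ttilde g F \<epsilon> n)"
    using opnorm_Ttilde_ge by blast
  define r where "r = normD F 1 powr \<gamma>"
  have r: "1 < r" using lam \<gamma>_pos by (simp add: r_def)
  have "\<forall>\<^sub>F \<epsilon> in at_right 0. tau_tilde g F \<epsilon> \<ge>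
      ereal (\<gamma> / ln (normD F 1) * ln (1 / \<epsilon>) + (- ln (2 * (2 * B)) / (\<gamma> * ln (normD F 1))))"
    using eventually_small_powr[OF zero_less_one \<gamma>_pos]
  proof eventually_elim
    case (elim \<epsilon>)
    show ?case
    proof (rule tau_tilde_geI)
      fix n assume "opnorm (Ttilde g F \<epsilon> n) < exp (- 1)"
      with B(2)[of \<epsilon> n] elim exp_minus_1_le_half have "1 / 2 < B * \<epsilon> powr \<gamma> * (1 + normD F n powr \<gamma>)"
        by simp
      \<comment> \<open>\<open>1 \<le> r ^ n\<close> absorbs the loss of the first noise step into
        the growing one, at the price of a factor 2.\<close>
      also have "\<dots> \<le> B * \<epsilon> powr \<gamma> * (r ^ n + r ^ n)"
      proof (intro mult_left_mono add_mono)
        have "normD F n powr \<gamma> \<le> (normD F 1 ^ n) powr \<gamma>"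
          using normD_le_power[OF F_lift F_C1] normD_nonneg[OF F_lift F_C1] \<gamma>_pos by (intro powr_mono2) auto
        then show "normD F n powr \<gamma> \<le> r ^ n" using lam by (simp add: r_def power_powr)
      qed (use r B in \<open>auto simp: less_imp_le one_le_power\<close>)
      also have "\<dots> = 2 * B * \<epsilon> powr \<gamma> * r ^ n" by simp
      finally show "\<gamma> / ln (normD F 1) * ln (1 / \<epsilon>) + (- ln (2 * (2 * B)) / (\<gamma> * ln (normD F 1))) \<le> real n"
        using lam \<gamma>_pos \<gamma>_le_1 B elim by (intro log_time_bound) (auto simp: r_def)
    qed
  qed
  then show ?thesis by blast
qed

text \<open>At norm 1 every step costs the same: the sum is \<open>n\<close>, and the norm can drop
  only after a number of steps of order \<open>\<epsilon> powr (- \<gamma>)\<close>.\<close>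

lemma tau_lower_neutral:
  assumes "normD F 1 = 1"
  shows "\<exists>K>0. \<forall>\<^sub>F \<epsilon> in at_right 0. ereal (\<epsilon> powr (- \<gamma>)) \<le> ereal K * tau g F \<epsilon>"
proof -
  obtain B where B: "0 < B" "\<And>\<epsilon> n. 0 < \<epsilon> \<Longrightarrow>
      1 - B * \<epsilon> powr \<gamma> * (\<Sum>j=1..n. (normD F 1 powr \<gamma>) ^ j) \<le> opnorm (Top g F \<epsilon> ^^ n)"
    using opnorm_Top_ge[OF F_lipschitz] by blast
  have "\<forall>\<^sub>F \<epsilon> in at_right 0. ereal (\<epsilon> powr (- \<gamma>)) \<le> ereal (2 * B) * tau g F \<epsilon>"
    using eventually_small_powr[OF zero_less_one \<gamma>_pos]
  proof eventually_elim
    case (elim \<epsilon>)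
    show ?case
    proof (intro ereal_le_multI tau_geI)
      fix n assume "opnorm (Top g F \<epsilon> ^^ n) < exp (- 1)"
      with B(2)[of \<epsilon> n] elim exp_minus_1_le_half assms have "1 / 2 < B * \<epsilon> powr \<gamma> * real n"
        by simp
      then show "\<epsilon> powr (- \<gamma>) / (2 * B) \<le> real n"
        using B elim by (simp add: powr_minus field_simps)
    qed (use B in auto)
  qed
  then show ?thesis using B by (intro exI[of _ "2 * B"]) auto
qed

lemma tau_tilde_lower_polynomial:
  assumes A: "0 < A" and \<beta>: "0 < \<beta>" and le: "\<And>n. 1 \<le> n \<Longrightarrow> normD F n \<le> A * real n powr \<beta>"
  shows "\<exists>K>0. \<forall>\<^sub>F \<epsilon> in at_right 0. ereal (\<epsilon> powr (- \<gamma> / \<beta>)) \<le> ereal K * tau_tilde g F \<epsilon>"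
proof -
  obtain B where B: "0 < B" "\<And>\<epsilon> n. 0 < \<epsilon> \<Longrightarrow>
      1 - B * \<epsilon> powr \<gamma> * (1 + normD F n powr \<gamma>) \<le> opnorm (Ttilde g F \<epsilon> n)"
    using opnorm_Ttilde_ge by blast
  \<comment> \<open>The loss condition will read \<open>\<epsilon> powr (- \<gamma>) \<le> D * real
    n powr (\<beta> * \<gamma>)\<close>; \<open>K\<close> is the matching root of
    \<open>D\<close>.\<close>
  define D where "D = 4 * B * A powr \<gamma>"
  define K where "K = D powr (1 / (\<beta> * \<gamma>))"
  have D: "0 < D" and K: "0 < K" using A B by (auto simp: D_def K_def)
  \<comment> \<open>Below this threshold the first noise step loses less than 1/4, so more than 1/4
    must be lost by the second one, after the \<open>n\<close> iterations.\<close>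
  have "0 < 1 / (4 * B)" using B by simp
  from eventually_small_powr[OF this \<gamma>_pos]
  have "\<forall>\<^sub>F \<epsilon> in at_right 0. ereal (\<epsilon> powr (- \<gamma> / \<beta>)) \<le> ereal K * tau_tilde g F \<epsilon>"
  proof eventually_elim
    case (elim \<epsilon>)
    show ?case
    proof (intro ereal_le_multI tau_tilde_geI K)
      fix n :: nat assume n: "1 \<le> n" and "opnorm (Ttilde g F \<epsilon> n) < exp (- 1)"
      with B(2)[of \<epsilon> n] elim exp_minus_1_le_half
      have "1 / 2 < B * \<epsilon> powr \<gamma> * 1 + B * \<epsilon> powr \<gamma> * normD F n powr \<gamma>"
        by (simp add: distrib_left)
      moreover have "B * \<epsilon> powr \<gamma> < 1 / 4" using elim B by (simp add: field_simps)
      ultimately have "1 / 4 < B * \<epsilon> powr \<gamma> * normD F n powr \<gamma>" by simp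
      also have "\<dots> \<le> B * \<epsilon> powr \<gamma> * (A * real n powr \<beta>) powr \<gamma>"
        using B le[OF n] normD_nonneg[OF F_lift F_C1] \<gamma>_pos by (intro mult_left_mono powr_mono2) auto
      also have "\<dots> = B * \<epsilon> powr \<gamma> * (A powr \<gamma> * real n powr (\<beta> * \<gamma>))"
        using A by (simp add: powr_mult powr_powr)
      finally have "\<epsilon> powr (- \<gamma>) \<le> D * real n powr (\<beta> * \<gamma>)"
        using elim by (simp add: D_def powr_minus field_simps)
      then have "(\<epsilon> powr (- \<gamma>)) powr (1 / (\<beta> * \<gamma>)) \<le> (D * real n powr (\<beta> * \<gamma>)) powr (1 / (\<beta> * \<gamma>))"
        using \<beta> \<gamma>_pos by (intro powr_mono2) auto
      also have "\<dots> = K * real n"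
        using D \<beta> \<gamma>_pos n by (simp add: K_def powr_mult powr_powr)
      also have "(\<epsilon> powr (- \<gamma>)) powr (1 / (\<beta> * \<gamma>)) = \<epsilon> powr (- 1 / \<beta>)"
        using \<beta> \<gamma>_pos by (simp add: powr_powr)
      finally have "\<epsilon> powr (- 1 / \<beta>) \<le> K * real n" .
      \<comment> \<open>Solving for \<open>n\<close> gives the exponent
        \<open>- 1 / \<beta>\<close>, at least as strong as the claimed one for
        \<open>\<epsilon> < 1\<close>.\<close>
      moreover have "\<epsilon> powr (- \<gamma> / \<beta>) \<le> \<epsilon> powr (- 1 / \<beta>)"
        using elim \<beta> \<gamma>_le_1 by (intro powr_mono') (auto simp: divide_right_mono)
      ultimately show "\<epsilon> powr (- \<gamma> / \<beta>) / K \<le> real n"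
        using K by (simp add: divide_le_eq mult.commute)
    qed
  qed
  then show ?thesis using K by blast
qed

text \<open>Uniformly Lipschitz iterates lose at most
  \<open>B * \<epsilon> powr \<gamma> * (1 + M powr \<gamma>)\<close> for every \<open>n\<close>;
  once this is below 1/2 the threshold is never reached.\<close>

lemma tau_tilde_infinite:
  assumes "\<And>n. normD F n \<le> M"
  shows "\<forall>\<^sub>F \<epsilon> in at_right 0. tau_tilde g F \<epsilon> = \<infinity>"
proof -
  obtain B where B: "0 < B" "\<And>\<epsilon> n. 0 < \<epsilon> \<Longrightarrow>
      1 - B * \<epsilon> powr \<gamma> * (1 + normD F n powr \<gamma>) \<le> opnorm (Ttilde g F \<epsilon> n)"
    using opnorm_Ttilde_ge by blast
  have M1: "0 < 1 + M powr \<gamma>" by (simp add: add_pos_nonneg)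
  then have "0 < 1 / (2 * B * (1 + M powr \<gamma>))" using B by simp
  from eventually_small_powr[OF this \<gamma>_pos] show ?thesis
  proof eventually_elim
    case (elim \<epsilon>)
    have "exp (- 1) \<le> opnorm (Ttilde g F \<epsilon> n)" for n
    proof -
      have "B * \<epsilon> powr \<gamma> * (1 + normD F n powr \<gamma>) \<le> B * \<epsilon> powr \<gamma> * (1 + M powr \<gamma>)"
        using B assms normD_nonneg[OF F_lift F_C1] \<gamma>_pos
        by (intro mult_left_mono add_left_mono powr_mono2) auto
      also have "\<dots> < 1 / 2"
      proof -
        have "0 < 2 * B * (1 + M powr \<gamma>)" using B M1 by simp
        then have "\<epsilon> powr \<gamma> * (2 * B * (1 + M powr \<gamma>)) < 1"
          using elim by (simp only: pos_less_divide_eq)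
        then show ?thesis by (simp add: algebra_simps)
      qed
      finally show ?thesis using B(2)[of \<epsilon> n] elim exp_minus_1_le_half by linarith
    qed
    then have "\<not> (\<exists>n\<ge>1. opnorm (Ttilde g F \<epsilon> n) < exp (- 1))" by (simp add: not_less)
    then show ?case by (simp add: tau_tilde_def)
  qed
qed

end

subsection \<open>The Fourier transform of the noise away from the origin\<close>

lemma lborel_distr_uminus_euclidean: "distr lborel borel uminus = (lborel :: 'a::euclidean_space measure)"
  using lborel_affine[of "- 1" "0::'a"] by (simp add: density_1)

lemma lborel_distr_translation: "distr lborel borel (\<lambda>x. x + a) = (lborel :: 'a::euclidean_space measure)"
  using lborel_distr_plus[of a] by (simp add: add.commute[of _ a] cong: distr_cong)

lemma integrable_translation:
  fixes f :: "'a::euclidean_space \<Rightarrow> real"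
  assumes "integrable lborel f"
  shows "integrable lborel (\<lambda>x. f (x + a))"
proof -
  have "f \<in> borel_measurable borel" using borel_measurable_integrable[OF assms] by simp
  moreover have "integrable (distr lborel borel (\<lambda>x. x + a)) f"
    unfolding lborel_distr_translation by (rule assms)
  ultimately show ?thesis by (subst (asm) integrable_distr_eq) auto
qed

text \<open>Dominated convergence in the form of the limit case of \<open>integrable_induct\<close>,
  for the Riemann-Lebesgue lemma and for the density of trigonometric polynomials alike.\<close>

lemma integrable_L1_approx:
  fixes f :: "'a \<Rightarrow> real"
  assumes s: "\<And>i. integrable M (s i)" and lim: "\<And>x. x \<in> space M \<Longrightarrow> (\<lambda>i. s i x) \<longlonglongrightarrow> f x"
    and le: "\<And>i x. x \<in> space M \<Longrightarrow> norm (s i x) \<le> 2 * norm (f x)"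
    and f: "integrable M f" and "0 < \<eta>"
  shows "\<exists>i. (\<integral>x. \<bar>f x - s i x\<bar> \<partial>M) < \<eta>"
proof -
  have "(\<lambda>i. \<integral>x. \<bar>f x - s i x\<bar> \<partial>M) \<longlonglongrightarrow> (\<integral>x. 0 \<partial>M :: real)"
  proof (rule integral_dominated_convergence[where w="\<lambda>x. 3 * \<bar>f x\<bar>"])
    show "(\<lambda>x. \<bar>f x - s i x\<bar>) \<in> borel_measurable M" for i
      using borel_measurable_integrable[OF f] borel_measurable_integrable[OF s[of i]] by simp
    show "integrable M (\<lambda>x. 3 * \<bar>f x\<bar>)" using f by simp
    show "AE x in M. (\<lambda>i. \<bar>f x - s i x\<bar>) \<longlonglongrightarrow> 0"
    proof (rule AE_I2)
      fix x assume "x \<in> space M"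
      then have "(\<lambda>i. \<bar>f x - s i x\<bar>) \<longlonglongrightarrow> \<bar>f x - f x\<bar>"
        by (intro tendsto_intros lim)
      then show "(\<lambda>i. \<bar>f x - s i x\<bar>) \<longlonglongrightarrow> 0" by simp
    qed
    show "AE x in M. norm \<bar>f x - s i x\<bar> \<le> 3 * \<bar>f x\<bar>" for i
    proof (rule AE_I2)
      fix x assume "x \<in> space M"
      then show "norm \<bar>f x - s i x\<bar> \<le> 3 * \<bar>f x\<bar>" using le[of x i] by simp
    qed
  qed simp
  then have "(\<lambda>i. \<integral>x. \<bar>f x - s i x\<bar> \<partial>M) \<longlonglongrightarrow> 0" by simp
  then have "\<forall>\<^sub>F i in sequentially. (\<integral>x. \<bar>f x - s i x\<bar> \<partial>M) < \<eta>"
    using \<open>0 < \<eta>\<close> by (intro order_tendstoD) auto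
  then show ?thesis by (meson eventually_happens sequentially_bot)
qed

text \<open>Continuity of translation by outer regularity: an open \<open>T\<close> exceeds
  \<open>K\<close> by little and contains a uniform neighbourhood of it, so wherever the indicator
  of \<open>K\<close> and its small shift differ, one of the points \<open>x\<close> and
  \<open>x + a\<close> lies in \<open>T - K\<close>.\<close>

lemma compact_translation_L1:
  fixes K :: "'a::euclidean_space set"
  assumes K: "compact K" and "0 < \<eta>"
  obtains \<delta> where "0 < \<delta>"
    "\<And>a. norm a < \<delta> \<Longrightarrow> (\<integral>x. \<bar>indicator K x - indicator K (x + a)\<bar> \<partial>lborel) \<le> (\<eta> :: real)"
proof -
  have "K \<in> sets lebesgue" using K by (simp add: compact_imp_closed)
  then obtain T where T: "open T" "K \<subseteq> T" "T - K \<in> lmeasurable" "emeasure lebesgue (T - K) < ennreal (\<eta> / 2)"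
    using sets_lebesgue_outer_open[of K "\<eta> / 2"] assms(2) by auto
  from compact_subset_open_imp_ball_epsilon_subset[OF K T(1,2)]
  obtain \<delta> where \<delta>: "0 < \<delta>" "(\<Union>x\<in>K. ball x \<delta>) \<subseteq> T" by blast
  have [measurable]: "K \<in> sets borel" "T \<in> sets borel" using K T by (auto simp: compact_imp_closed)
  have e: "emeasure lborel (T - K) < ennreal (\<eta> / 2)" using T(4) by simp
  then have fin: "emeasure lborel (T - K) < \<infinity>" by (rule less_trans) simp
  have i: "integrable lborel (indicator (T - K) :: 'a \<Rightarrow> real)"
    using fin by simp
  have m: "measure lborel (T - K) \<le> \<eta> / 2"
  proof -
    have "ennreal (measure lborel (T - K)) < ennreal (\<eta> / 2)"
      using e fin by (subst emeasure_eq_ennreal_measure[symmetric]) auto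
    then show ?thesis by (simp add: ennreal_less_iff)
  qed
  have ia: "integrable lborel (\<lambda>x. indicator (T - K) (x + a) :: real)" for a
    by (rule integrable_translation[OF i])
  have ma: "(\<integral>x. indicator (T - K) (x + a) \<partial>lborel) = measure lborel (T - K)" for a
  proof -
    have "(\<integral>x. indicator (T - K) (x + a) \<partial>lborel) = integral\<^sup>L (distr lborel borel (\<lambda>x. x + a)) (indicator (T - K) :: 'a \<Rightarrow> real)"
      by (subst integral_distr) auto
    then show ?thesis unfolding lborel_distr_translation by simp
  qed
  show thesis
  proof (rule that[OF \<delta>(1)])
    fix a :: 'a assume a: "norm a < \<delta>"
    have pt: "\<bar>indicator K x - indicator K (x + a)\<bar> \<le> (indicator (T - K) x + indicator (T - K) (x + a) :: real)" for x
    proof -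
      have "x \<in> T" if "x + a \<in> K"
      proof -
        have "x \<in> ball (x + a) \<delta>" using a by (simp add: dist_norm)
        then show ?thesis using \<delta>(2) that by blast
      qed
      moreover have "x + a \<in> T" if "x \<in> K"
      proof -
        have "x + a \<in> ball x \<delta>" using a by (simp add: dist_norm)
        then show ?thesis using \<delta>(2) that by blast
      qed
      ultimately show ?thesis by (auto simp: indicator_def)
    qed
    have "(\<integral>x. \<bar>indicator K x - indicator K (x + a)\<bar> \<partial>lborel)
        \<le> (\<integral>x. indicator (T - K) x + indicator (T - K) (x + a) \<partial>lborel :: real)"
    proof (rule integral_mono)
      show I: "integrable lborel (\<lambda>x. indicator (T - K) x + indicator (T - K) (x + a) :: real)"
        using i ia by simp
      show "integrable lborel (\<lambda>x. \<bar>indicator K x - indicator K (x + a)\<bar> :: real)"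
        by (rule Bochner_Integration.integrable_bound[OF I]) (use pt in auto)
    qed (rule pt)
    also have "\<dots> = 2 * measure lborel (T - K)"
      using i ia by (simp add: ma)
    finally show "(\<integral>x. \<bar>indicator K x - indicator K (x + a)\<bar> \<partial>lborel) \<le> \<eta>" using m by simp
  qed
qed

text \<open>Closeness in L1 transfers to the cosine transform uniformly in the frequency.\<close>

lemma integral_mult_cos_diff_le:
  fixes f h :: "'a::euclidean_space \<Rightarrow> real"
  assumes f: "integrable lborel f" and h: "integrable lborel h"
  shows "\<bar>\<integral>x. f x * cos (2 * pi * (x \<bullet> \<xi>)) \<partial>lborel\<bar>
    \<le> \<bar>\<integral>x. h x * cos (2 * pi * (x \<bullet> \<xi>)) \<partial>lborel\<bar> + (\<integral>x. \<bar>f x - h x\<bar> \<partial>lborel)"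
proof -
  have d: "integrable lborel (\<lambda>x. f x - h x)" using f h by simp
  have "(\<integral>x. f x * cos (2 * pi * (x \<bullet> \<xi>)) \<partial>lborel) =
      (\<integral>x. h x * cos (2 * pi * (x \<bullet> \<xi>)) \<partial>lborel) + (\<integral>x. (f x - h x) * cos (2 * pi * (x \<bullet> \<xi>)) \<partial>lborel)"
    using integrable_mult_cos[OF f, of \<xi>] integrable_mult_cos[OF h, of \<xi>] by (simp add: left_diff_distrib)
  moreover have "\<bar>\<integral>x. (f x - h x) * cos (2 * pi * (x \<bullet> \<xi>)) \<partial>lborel\<bar> \<le> (\<integral>x. \<bar>f x - h x\<bar> \<partial>lborel)"
  proof -
    have "\<bar>\<integral>x. (f x - h x) * cos (2 * pi * (x \<bullet> \<xi>)) \<partial>lborel\<bar>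
        \<le> (\<integral>x. \<bar>(f x - h x) * cos (2 * pi * (x \<bullet> \<xi>))\<bar> \<partial>lborel)"
      by (rule integral_abs_bound)
    also have "\<dots> \<le> (\<integral>x. \<bar>f x - h x\<bar> \<partial>lborel)"
      by (rule integral_mono[OF integrable_abs[OF integrable_mult_cos[OF d]] integrable_abs[OF d]])
        (simp add: abs_mult mult_left_le)
    finally show ?thesis .
  qed
  ultimately show ?thesis by linarith
qed

text \<open>A shift by half a period along the frequency flips the cosine, so twice the integral is
  the transform of the difference between the indicator and its translate. The shift has length
  \<open>1 / (2 * norm \<xi>)\<close>, small for large frequencies.\<close>

lemma riemann_lebesgue_compact:
  fixes K :: "'a::euclidean_space set"
  assumes K: "compact K" and \<eta>: "0 < \<eta>"
  shows "\<exists>R>0. \<forall>\<xi>. R \<le> norm \<xi> \<longrightarrow> \<bar>\<integral>x. indicator K x * cos (2 * pi * (x \<bullet> \<xi>)) \<partial>lborel\<bar> \<le> \<eta>"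
proof -
  obtain \<delta> where \<delta>: "0 < \<delta>"
    "\<And>a. norm a < \<delta> \<Longrightarrow> (\<integral>x. \<bar>indicator K x - indicator K (x + a)\<bar> \<partial>lborel) \<le> (2 * \<eta> :: real)"
    using compact_translation_L1[OF K, of "2 * \<eta>"] \<eta> by auto
  have [measurable]: "K \<in> sets borel" using K by (simp add: compact_imp_closed)
  have iK: "integrable lborel (indicator K :: 'a \<Rightarrow> real)"
    using emeasure_bounded_finite[OF compact_imp_bounded[OF K]] by simp
  show ?thesis
  proof (intro exI[of _ "1 / \<delta>"] conjI allI impI)
    fix \<xi> :: 'a assume \<xi>: "1 / \<delta> \<le> norm \<xi>"
    have "0 < 1 / \<delta>" using \<delta>(1) by simp
    with \<xi> have pos: "0 < norm \<xi>" by linarith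
    define a where "a = (1 / (2 * (\<xi> \<bullet> \<xi>))) *\<^sub>R \<xi>"
    have "norm a = 1 / (2 * norm \<xi>)"
      using pos by (simp add: a_def dot_square_norm power2_eq_square)
    also have "\<dots> < \<delta>" using \<xi> pos \<delta>(1) by (simp add: field_simps)
    finally have na: "norm a < \<delta>" .
    have c: "cos (2 * pi * ((x + a) \<bullet> \<xi>)) = - cos (2 * pi * (x \<bullet> \<xi>))" for x
      using pos by (simp add: a_def inner_add_left distrib_left)
    let ?I = "\<integral>x. indicator K x * cos (2 * pi * (x \<bullet> \<xi>)) \<partial>lborel"
    have ia: "integrable lborel (\<lambda>x. indicator K (x + a) :: real)"
      by (rule integrable_translation[OF iK])
    have "?I = (\<integral>x. indicator K x * cos (2 * pi * (x \<bullet> \<xi>)) \<partial>distr lborel borel (\<lambda>x. x + a))"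
      unfolding lborel_distr_translation ..
    also have "\<dots> = (\<integral>x. indicator K (x + a) * cos (2 * pi * ((x + a) \<bullet> \<xi>)) \<partial>lborel)"
      by (subst integral_distr) auto
    also have "\<dots> = - (\<integral>x. indicator K (x + a) * cos (2 * pi * (x \<bullet> \<xi>)) \<partial>lborel)"
      by (simp add: c)
    finally have "2 * ?I = (\<integral>x. (indicator K x - indicator K (x + a)) * cos (2 * pi * (x \<bullet> \<xi>)) \<partial>lborel)"
      using integrable_mult_cos[OF iK] integrable_mult_cos[OF ia] by (simp add: left_diff_distrib)
    also have "\<bar>\<dots>\<bar> \<le> (\<integral>x. \<bar>indicator K x - indicator K (x + a)\<bar> \<partial>lborel)"
      using integral_mult_cos_diff_le[of "\<lambda>x. indicator K x - indicator K (x + a)" "\<lambda>x. 0" \<xi>] iK ia by simp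
    also have "\<dots> \<le> 2 * \<eta>" by (rule \<delta>(2)[OF na])
    finally show "\<bar>?I\<bar> \<le> \<eta>" by simp
  qed (use \<delta> in simp)
qed

lemma riemann_lebesgue:
  fixes f :: "'a::euclidean_space \<Rightarrow> real"
  assumes "integrable lborel f" and "0 < \<eta>"
  shows "\<exists>R>0. \<forall>\<xi>. R \<le> norm \<xi> \<longrightarrow> \<bar>\<integral>x. f x * cos (2 * pi * (x \<bullet> \<xi>)) \<partial>lborel\<bar> \<le> \<eta>"
  using assms
proof (induction arbitrary: \<eta> rule: integrable_induct)
  case (base A c)
  note [measurable] = base(1)
  \<comment> \<open>The summand 1 covers \<open>c = 0\<close>; the factor 2 leaves room for two
    errors, the transform of \<open>K\<close> and the replacement of \<open>A\<close> by
    \<open>K\<close>.\<close>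
  define e where "e = \<eta> / (2 * (\<bar>c\<bar> + 1))"
  have e: "0 < e" using base(3) by (simp add: e_def)
  \<comment> \<open>\<open>lborel\<close> cut down to \<open>A\<close> is a finite measure, as
    \<open>inner_regular\<close> demands.\<close>
  have "emeasure (density lborel (indicator A)) A = (SUP K\<in>{K. K \<subseteq> A \<and> compact K}. emeasure (density lborel (indicator A)) K)"
    using base(1,2) by (intro inner_regular) (auto simp: emeasure_density)
  also have "emeasure (density lborel (indicator A)) A = emeasure lborel A"
    using base(1) by (simp add: emeasure_density flip: indicator_inter_arith)
  finally have sup: "emeasure lborel A = (SUP K\<in>{K. K \<subseteq> A \<and> compact K}. emeasure (density lborel (indicator A)) K)" .
  have "\<exists>K\<in>{K. K \<subseteq> A \<and> compact K}. emeasure lborel A < emeasure (density lborel (indicator A)) K + ennreal e"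
    using e base(2) by (intro SUP_approx_ennreal[OF _ _ sup]) auto
  then obtain K where K: "K \<subseteq> A" "compact K" and le: "emeasure lborel A \<le> emeasure (density lborel (indicator A)) K + ennreal e"
    by (auto intro: less_imp_le)
  have [measurable]: "K \<in> sets borel" using K by (simp add: compact_imp_closed)
  have KA: "K \<inter> A = K" using K by blast
  have finK: "emeasure lborel K < \<infinity>" using emeasure_bounded_finite[OF compact_imp_bounded[OF K(2)]] .
  have "emeasure (density lborel (indicator A)) K = emeasure lborel K"
    using KA by (simp add: emeasure_density Int_commute flip: indicator_inter_arith)
  with le have "measure lborel A \<le> measure lborel K + e"
    using base(2) finK e
    by (simp add: emeasure_eq_ennreal_measure less_top flip: ennreal_plus)
  moreover have "measure lborel (A - K) = measure lborel A - measure lborel K"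
    using K base(1,2) finK by (intro measure_Diff) auto
  ultimately have mAK: "measure lborel (A - K) \<le> e" by simp
  have iA: "integrable lborel (indicator A :: 'a \<Rightarrow> real)" and iK: "integrable lborel (indicator K :: 'a \<Rightarrow> real)"
    using base(1,2) finK by auto
  have diff: "(\<integral>x. \<bar>indicator A x - indicator K x\<bar> \<partial>lborel) \<le> e"
  proof -
    have "\<bar>indicator A x - indicator K x\<bar> = (indicator (A - K) x :: real)" for x
      using K(1) by (auto simp: indicator_def)
    then show ?thesis using mAK by simp
  qed
  from riemann_lebesgue_compact[OF K(2) e]
  obtain R where R: "R > 0" "\<And>\<xi>. R \<le> norm \<xi> \<Longrightarrow> \<bar>\<integral>x. indicator K x * cos (2 * pi * (x \<bullet> \<xi>)) \<partial>lborel\<bar> \<le> e" by blast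
  show ?case
  proof (intro exI[of _ R] conjI allI impI R(1))
    fix \<xi> :: 'a assume "R \<le> norm \<xi>"
    then have "\<bar>\<integral>x. indicator A x * cos (2 * pi * (x \<bullet> \<xi>)) \<partial>lborel\<bar> \<le> e + e"
      using integral_mult_cos_diff_le[OF iA iK, of \<xi>] R(2) diff by fastforce
    then have "\<bar>c\<bar> * \<bar>\<integral>x. indicator A x * cos (2 * pi * (x \<bullet> \<xi>)) \<partial>lborel\<bar> \<le> \<bar>c\<bar> * (2 * e)"
      by (intro mult_left_mono) auto
    also have "\<dots> \<le> (\<bar>c\<bar> + 1) * (2 * e)" using e by (intro mult_right_mono) auto
    also have "\<dots> = \<eta>" by (simp add: e_def field_simps)
    finally show "\<bar>\<integral>x. indicator A x *\<^sub>R c * cos (2 * pi * (x \<bullet> \<xi>)) \<partial>lborel\<bar> \<le> \<eta>"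
      by (simp add: mult_ac abs_mult[symmetric] flip: integral_mult_right_zero)
  qed
next
  case (add f h)
  from add.IH(1)[of "\<eta> / 2"] add.prems obtain R1 where R1: "R1 > 0"
    "\<And>\<xi>. R1 \<le> norm \<xi> \<Longrightarrow> \<bar>\<integral>x. f x * cos (2 * pi * (x \<bullet> \<xi>)) \<partial>lborel\<bar> \<le> \<eta> / 2" by auto
  from add.IH(2)[of "\<eta> / 2"] add.prems obtain R2 where R2: "R2 > 0"
    "\<And>\<xi>. R2 \<le> norm \<xi> \<Longrightarrow> \<bar>\<integral>x. h x * cos (2 * pi * (x \<bullet> \<xi>)) \<partial>lborel\<bar> \<le> \<eta> / 2" by auto
  show ?case
  proof (intro exI[of _ "max R1 R2"] conjI allI impI)
    fix \<xi> :: 'a assume "max R1 R2 \<le> norm \<xi>"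
    with R1(2)[of \<xi>] R2(2)[of \<xi>]
    show "\<bar>\<integral>x. (f x + h x) * cos (2 * pi * (x \<bullet> \<xi>)) \<partial>lborel\<bar> \<le> \<eta>"
      using integrable_mult_cos[OF add.hyps(1), of \<xi>] integrable_mult_cos[OF add.hyps(2), of \<xi>]
      by (simp add: distrib_right)
  qed (use R1 in auto)
next
  case (lim f s)
  have "0 < \<eta> / 2" using lim.prems by simp
  from integrable_L1_approx[OF lim.hyps(1-4) this]
  obtain i where i: "(\<integral>x. \<bar>f x - s i x\<bar> \<partial>lborel) < \<eta> / 2" by blast
  from lim.IH[of "\<eta> / 2" i] lim.prems obtain R where R: "R > 0"
    "\<And>\<xi>. R \<le> norm \<xi> \<Longrightarrow> \<bar>\<integral>x. s i x * cos (2 * pi * (x \<bullet> \<xi>)) \<partial>lborel\<bar> \<le> \<eta> / 2" by auto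
  show ?case
  proof (intro exI[of _ R] conjI allI impI R(1))
    fix \<xi> :: 'a assume "R \<le> norm \<xi>"
    then show "\<bar>\<integral>x. f x * cos (2 * pi * (x \<bullet> \<xi>)) \<partial>lborel\<bar> \<le> \<eta>"
      using integral_mult_cos_diff_le[OF lim.hyps(4,1), of \<xi> i] R(2)[of \<xi>] i by linarith
  qed
qed

section \<open>Bounds on the characteristic function of the noise\<close>

lemma ghat_real:
  assumes g: "noise_density g"
  shows "ghat g \<xi> = complex_of_real (Re (ghat g \<xi>))"
proof -
  have [measurable]: "g \<in> borel_measurable borel" by (rule noise_density_measurable[OF g])
  have [measurable]: "cis \<in> borel_measurable borel"
    by (intro borel_measurable_continuous_onI continuous_intros)
  have "ghat g \<xi> = (\<integral>x. complex_of_real (g x) * cis (- 2 * pi * (x \<bullet> \<xi>)) \<partial>distr lborel borel uminus)"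
    by (simp add: ghat_def lborel_distr_uminus_euclidean)
  also have "\<dots> = (\<integral>x. complex_of_real (g (- x)) * cis (- 2 * pi * ((- x) \<bullet> \<xi>)) \<partial>lborel)"
    by (subst integral_distr) auto
  also have "\<dots> = (\<integral>x. cnj (complex_of_real (g x) * cis (- 2 * pi * (x \<bullet> \<xi>))) \<partial>lborel)"
    by (simp add: noise_density_even[OF g] cis_cnj)
  also have "\<dots> = cnj (ghat g \<xi>)" unfolding ghat_def by (rule Bochner_Integration.integral_cnj)
  finally show ?thesis by (metis Im_complex_of_real Reals_cnj_iff of_real_Re)
qed

lemma abs_sin_mult_le: "\<bar>sin (real n * y)\<bar> \<le> real n * \<bar>sin y\<bar>"
proof (induction n)
  case (Suc n)
  have "sin (real (Suc n) * y) = sin (real n * y) * cos y + cos (real n * y) * sin y"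
    by (simp add: distrib_right sin_add add.commute)
  also have "\<bar>\<dots>\<bar> \<le> \<bar>sin (real n * y)\<bar> * \<bar>cos y\<bar> + \<bar>cos (real n * y)\<bar> * \<bar>sin y\<bar>"
    by (metis abs_mult abs_triangle_ineq)
  also have "\<dots> \<le> \<bar>sin (real n * y)\<bar> * 1 + 1 * \<bar>sin y\<bar>"
    by (intro add_mono mult_left_mono mult_right_mono) auto
  finally show ?case using Suc by (simp add: distrib_right)
qed simp

text \<open>By the half-angle formula this is the square of \<open>abs_sin_mult_le\<close>.\<close>

lemma one_minus_cos_mult_le: "1 - cos (real n * y) \<le> (real n)\<^sup>2 * (1 - cos y)"
proof -
  have half: "1 - cos t = 2 * (sin (t / 2))\<^sup>2" for t :: real
    using cos_double_sin[of "t / 2"] by simp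
  have "\<bar>sin (real n * (y / 2))\<bar>\<^sup>2 \<le> (real n * \<bar>sin (y / 2)\<bar>)\<^sup>2"
    by (intro power_mono abs_sin_mult_le) auto
  then show ?thesis by (simp add: half power_mult_distrib)
qed

text \<open>Integrates a trigonometric inequality against the density. The sign \<open>b\<close>
  selects its use: -1 keeps \<open>ghat\<close> away from 1, and +1 keeps it away from -1.\<close>

lemma noise_integral_cos_mono:
  assumes g: "noise_density g" and a: "0 \<le> a"
    and le: "\<And>t. 1 - cos (real n * t) \<le> a * (1 + b * cos t)"
  shows "1 - Re (ghat g (real n *\<^sub>R \<xi>)) \<le> a * (1 + b * Re (ghat g \<xi>))"
proof -
  have "(\<integral>x. g x - g x * cos (2 * pi * (x \<bullet> (real n *\<^sub>R \<xi>))) \<partial>lborel)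
      \<le> (\<integral>x. a * (g x + b * (g x * cos (2 * pi * (x \<bullet> \<xi>)))) \<partial>lborel)"
  proof (rule integral_mono)
    fix x
    have "g x * (1 - cos (real n * (2 * pi * (x \<bullet> \<xi>)))) \<le> g x * (a * (1 + b * cos (2 * pi * (x \<bullet> \<xi>))))"
      by (intro mult_left_mono le noise_density_nonneg[OF g])
    then show "g x - g x * cos (2 * pi * (x \<bullet> (real n *\<^sub>R \<xi>))) \<le> a * (g x + b * (g x * cos (2 * pi * (x \<bullet> \<xi>))))"
      by (simp add: algebra_simps)
    show "integrable lborel (\<lambda>x. g x - g x * cos (2 * pi * (x \<bullet> (real n *\<^sub>R \<xi>))))"
      by (intro Bochner_Integration.integrable_diff integrable_noise_cos[OF g] noise_density_integrable[OF g])
    show "integrable lborel (\<lambda>x. a * (g x + b * (g x * cos (2 * pi * (x \<bullet> \<xi>)))))"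
      by (intro integrable_mult_right Bochner_Integration.integrable_add integrable_noise_cos[OF g] noise_density_integrable[OF g])
  qed
  also have "(\<integral>x. a * (g x + b * (g x * cos (2 * pi * (x \<bullet> \<xi>)))) \<partial>lborel) = a * (1 + b * Re (ghat g \<xi>))"
    using integrable_noise_cos[OF g, of \<xi>] noise_density_integrable[OF g]
    by (simp add: Re_ghat[OF g] noise_density_integral[OF g])
  finally show ?thesis
    using Bochner_Integration.integral_diff[OF noise_density_integrable[OF g] integrable_noise_cos[OF g, of "real n *\<^sub>R \<xi>"]]
    by (simp only: Re_ghat[OF g] noise_density_integral[OF g])
qed

text \<open>The inequality \<open>1 - cos (n t) \<le> n\<^sup>2 (1 - cos t)\<close> transports the decay at infinity given by
  Riemann-Lebesgue down to frequencies bounded away from \<open>0\<close>, which replaces a compactness argument.\<close>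

lemma ghat_bounded_away:
  fixes g :: "real^'d \<Rightarrow> real"
  assumes g: "noise_density g" and \<delta>: "0 < \<delta>"
  obtains c where "0 < c" "\<And>\<xi>. \<delta> \<le> norm \<xi> \<Longrightarrow> \<bar>Re (ghat g \<xi>)\<bar> \<le> 1 - c"
proof -
  obtain R where R: "R > 0" "\<And>\<xi>. R \<le> norm \<xi> \<Longrightarrow> \<bar>Re (ghat g \<xi>)\<bar> \<le> 1 / 2"
    using riemann_lebesgue[OF noise_density_integrable[OF g], of "1 / 2"] by (auto simp: Re_ghat[OF g])
  \<comment> \<open>Multiplication by \<open>n\<close> carries every frequency of norm at least
    \<open>\<delta>\<close> beyond \<open>R\<close>.\<close>
  define n where "n = nat \<lceil>R / \<delta>\<rceil>"
  have n: "R / \<delta> \<le> real n" "0 < n" using R(1) \<delta> by (auto simp: n_def) 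
  show thesis
  proof (rule that[of "1 / (8 * (real n)\<^sup>2)"])
    show "0 < 1 / (8 * (real n)\<^sup>2)" using n by simp
    fix \<xi> :: "real^'d" assume \<xi>: "\<delta> \<le> norm \<xi>"
    have "R \<le> real n * \<delta>" using n(1) \<delta> by (simp add: field_simps)
    also have "\<dots> \<le> real n * norm \<xi>" using \<xi> by (intro mult_left_mono) auto
    finally have nx: "R \<le> norm (real n *\<^sub>R \<xi>)" by simp
    then have n2x: "R \<le> norm (real (2 * n) *\<^sub>R \<xi>)" using R(1) by simp
    have "1 - Re (ghat g (real n *\<^sub>R \<xi>)) \<le> (real n)\<^sup>2 * (1 + (- 1) * Re (ghat g \<xi>))"
      by (rule noise_integral_cos_mono[OF g]) (use one_minus_cos_mult_le in auto)
    then have "1 / 2 \<le> (real n)\<^sup>2 * (1 - Re (ghat g \<xi>))" using R(2)[OF nx] by simp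
    then have A: "Re (ghat g \<xi>) \<le> 1 - 1 / (2 * (real n)\<^sup>2)" using n(2) by (simp add: field_simps)
    \<comment> \<open>For the bound near -1 the cosine inequality is used at \<open>t + pi\<close>:
      the even multiple \<open>2 * n\<close> ignores this shift, while \<open>cos t\<close> changes
      sign.\<close>
    have "1 - Re (ghat g (real (2 * n) *\<^sub>R \<xi>)) \<le> (real (2 * n))\<^sup>2 * (1 + 1 * Re (ghat g \<xi>))"
    proof (rule noise_integral_cos_mono[OF g])
      fix t
      have "cos (real (2 * n) * (t + pi)) = cos (real (2 * n) * t + 2 * pi * real n)"
        by (simp add: algebra_simps)
      also have "\<dots> = cos (real (2 * n) * t)"
        using cos_eq_periodic_intro[of "real (2 * n) * t + 2 * pi * real n" "real (2 * n) * t" "int n"] by simp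
      finally show "1 - cos (real (2 * n) * t) \<le> (real (2 * n))\<^sup>2 * (1 + 1 * cos t)"
        using one_minus_cos_mult_le[of "2 * n" "t + pi"] by simp
    qed simp
    then have "1 / 2 \<le> 4 * (real n)\<^sup>2 * (1 + Re (ghat g \<xi>))" using R(2)[OF n2x] by (simp add: power_mult_distrib)
    then have B: "- Re (ghat g \<xi>) \<le> 1 - 1 / (8 * (real n)\<^sup>2)" using n(2) by (simp add: field_simps)
    have "1 / (8 * (real n)\<^sup>2) \<le> 1 / (2 * (real n)\<^sup>2)" using n(2) by (simp add: field_simps)
    with A B show "\<bar>Re (ghat g \<xi>)\<bar> \<le> 1 - 1 / (8 * (real n)\<^sup>2)" by linarith
  qed
qed

lemma Re_ghat_le_1:
  assumes g: "noise_density g"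
  shows "Re (ghat g \<xi>) \<le> 1"
proof -
  have "Re (ghat g \<xi>) \<le> (\<integral>x. g x \<partial>lborel)"
    unfolding Re_ghat[OF g] using noise_density_nonneg[OF g]
    by (intro integral_mono integrable_noise_cos[OF g] noise_density_integrable[OF g] mult_left_le) auto
  then show ?thesis by (simp add: noise_density_integral[OF g])
qed

text \<open>Near 0 the asymptotic lower bound gives the gap, farther out
  \<open>ghat_bounded_away\<close> does. The frequencies it is meant for are
  \<open>\<epsilon> *\<^sub>R lat_vec m\<close>, of norm at least \<open>\<epsilon>\<close> for
  nonzero \<open>m\<close>.\<close>

lemma ghat_lattice_gap:
  fixes g :: "real^'d \<Rightarrow> real"
  assumes g: "noise_density g" and \<alpha>: "0 < \<alpha>" and asymp: "fourier_asymp g \<alpha>"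
  obtains c where "0 < c"
    "\<forall>\<^sub>F \<epsilon> in at_right 0. 0 < \<epsilon> \<and> \<epsilon> < 1 \<and> c * \<epsilon> powr \<alpha> < 1 \<and>
       (\<forall>\<xi>. \<epsilon> \<le> norm \<xi> \<longrightarrow> \<bar>Re (ghat g \<xi>)\<bar> \<le> 1 - c * \<epsilon> powr \<alpha>)"
proof -
  from asymp obtain C \<delta> where C: "C > 0" "\<delta> > 0"
    and up: "\<And>\<xi>. 0 < norm \<xi> \<Longrightarrow> norm \<xi> < \<delta> \<Longrightarrow> norm (1 - ghat g \<xi>) \<le> C * norm \<xi> powr \<alpha>"
    and lo: "\<And>\<xi>. 0 < norm \<xi> \<Longrightarrow> norm \<xi> < \<delta> \<Longrightarrow> norm \<xi> powr \<alpha> \<le> C * norm (1 - ghat g \<xi>)"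
    unfolding fourier_asymp_def by blast
  have nm: "norm (1 - ghat g \<xi>) = \<bar>1 - Re (ghat g \<xi>)\<bar>" for \<xi>
    by (subst ghat_real[OF g]) (metis norm_of_real of_real_1 of_real_diff)
  note le1 = Re_ghat_le_1[OF g]
  \<comment> \<open>Within \<open>\<rho>\<close> the asymptotic upper bound gives
    \<open>1 - ghat \<le> 1\<close>, so \<open>ghat\<close> is nonnegative and the absolute value
    harmless.\<close>
  define \<rho> where "\<rho> = min \<delta> ((1 / C) powr (1 / \<alpha>))"
  have \<rho>: "0 < \<rho>" "\<rho> \<le> \<delta>" using C by (auto simp: \<rho>_def)
  obtain c1 where c1: "0 < c1" "\<And>\<xi>. \<rho> \<le> norm \<xi> \<Longrightarrow> \<bar>Re (ghat g \<xi>)\<bar> \<le> 1 - c1"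
    using ghat_bounded_away[OF g \<rho>(1)] by blast
  have c: "0 < 1 / C" using C by simp
  show thesis
  proof (rule that[OF c])
    \<comment> \<open>Makes \<open>\<epsilon> powr \<alpha> / C\<close> smaller than 1 and than the
      gap \<open>c1\<close> of the large frequencies.\<close>
    have "0 < min C (c1 * C)" using C c1 by simp
    from eventually_small_powr[OF this \<alpha>]
    show "\<forall>\<^sub>F \<epsilon> in at_right 0. 0 < \<epsilon> \<and> \<epsilon> < 1 \<and> 1 / C * \<epsilon> powr \<alpha> < 1 \<and>
       (\<forall>\<xi>. \<epsilon> \<le> norm \<xi> \<longrightarrow> \<bar>Re (ghat g \<xi>)\<bar> \<le> 1 - 1 / C * \<epsilon> powr \<alpha>)"
    proof eventually_elim
      case (elim \<epsilon>)
      have lt: "1 / C * \<epsilon> powr \<alpha> < 1" "1 / C * \<epsilon> powr \<alpha> < c1"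
        using elim C by (auto simp: field_simps)
      have "\<bar>Re (ghat g \<xi>)\<bar> \<le> 1 - 1 / C * \<epsilon> powr \<alpha>" if \<xi>: "\<epsilon> \<le> norm \<xi>" for \<xi>
      proof (cases "norm \<xi> < \<rho>")
        case True
        have pos: "0 < norm \<xi>" "norm \<xi> < \<delta>" using elim \<xi> True \<rho> by linarith+
        have "\<epsilon> powr \<alpha> \<le> norm \<xi> powr \<alpha>" using elim \<xi> \<alpha> by (intro powr_mono2) auto
        also have "\<dots> \<le> C * (1 - Re (ghat g \<xi>))" using lo[OF pos] le1[of \<xi>] by (simp add: nm)
        finally have A: "Re (ghat g \<xi>) \<le> 1 - 1 / C * \<epsilon> powr \<alpha>" using C by (simp add: field_simps)
        have "1 - Re (ghat g \<xi>) \<le> C * norm \<xi> powr \<alpha>" using up[OF pos] le1[of \<xi>] by (simp add: nm)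
        also have "norm \<xi> powr \<alpha> \<le> ((1 / C) powr (1 / \<alpha>)) powr \<alpha>"
          using True \<alpha> by (intro powr_mono2) (auto simp: \<rho>_def)
        then have "C * norm \<xi> powr \<alpha> \<le> C * (1 / C)" using C \<alpha> by (intro mult_left_mono) (auto simp: powr_powr)
        finally have "0 \<le> Re (ghat g \<xi>)" using C by simp
        with A show ?thesis by simp
      next
        case False
        then show ?thesis using c1(2)[of \<xi>] lt by simp
      qed
      with elim lt show ?case by auto
    qed
  qed
qed

subsection \<open>Trigonometric polynomials on the torus\<close>

lemma borel_measurable_cnj [measurable]:
  "f \<in> borel_measurable M \<Longrightarrow> (\<lambda>x. cnj (f x)) \<in> borel_measurable M"
  by (rule measurable_compose[of f M borel cnj])
    (auto intro!: borel_measurable_continuous_onI continuous_intros)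

definition trig_poly :: "(real^'d \<Rightarrow> complex) \<Rightarrow> bool" where
  "trig_poly p \<longleftrightarrow> (\<exists>S c. finite S \<and> p = (\<lambda>x. \<Sum>m\<in>S. c m * character m x))"

lemma character_add: "character (m + n) x = character m x * character n x"
  by (simp add: character_def lat_vec_add inner_add_left distrib_left flip: cis_mult)

lemma character_0 [simp]: "character 0 x = 1"
  by (simp add: character_def)

lemma character_minus: "character (- m) x = cnj (character m x)"
  by (simp add: character_def lat_vec_minus cis_cnj)

lemma character_diff_arg: "character m (x - y) = character m x * cnj (character m y)"
  by (simp add: character_def inner_diff_right right_diff_distrib cis_cnj cis_mult)

lemma trig_poly_character: "trig_poly (\<lambda>x. c * character m x)"
  unfolding trig_poly_def by (intro exI[of _ "{m}"] exI[of _ "\<lambda>_. c"]) auto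

lemma trig_poly_const: "trig_poly (\<lambda>x. c)"
  using trig_poly_character[of c 0] by simp

lemma trig_poly_add:
  assumes "trig_poly p" "trig_poly q"
  shows "trig_poly (\<lambda>x. p x + q x)"
proof -
  from assms obtain S c T d where *: "finite S" "p = (\<lambda>x. \<Sum>m\<in>S. c m * character m x)"
    "finite T" "q = (\<lambda>x. \<Sum>m\<in>T. d m * character m x)"
    unfolding trig_poly_def by blast
  have "p x + q x = (\<Sum>m\<in>S \<union> T. ((if m \<in> S then c m else 0) + (if m \<in> T then d m else 0)) * character m x)" for x
  proof -
    have "p x = (\<Sum>m\<in>S \<union> T. (if m \<in> S then c m else 0) * character m x)"
      unfolding *(2) using *(1,3) by (intro sum.mono_neutral_cong_left) auto
    moreover have "q x = (\<Sum>m\<in>S \<union> T. (if m \<in> T then d m else 0) * character m x)"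
      unfolding *(4) using *(1,3) by (intro sum.mono_neutral_cong_left) auto
    ultimately show ?thesis by (simp add: sum.distrib distrib_right)
  qed
  with *(1,3) show ?thesis
    unfolding trig_poly_def
    by (intro exI[of _ "S \<union> T"] exI[of _ "\<lambda>m. (if m \<in> S then c m else 0) + (if m \<in> T then d m else 0)"]) auto
qed

lemma trig_poly_sum:
  "finite I \<Longrightarrow> (\<And>i. i \<in> I \<Longrightarrow> trig_poly (p i)) \<Longrightarrow> trig_poly (\<lambda>x. \<Sum>i\<in>I. p i x)"
  by (induction I rule: finite_induct) (auto intro: trig_poly_add trig_poly_const)

lemma trig_poly_mult:
  assumes "trig_poly p" "trig_poly q"
  shows "trig_poly (\<lambda>x. p x * q x)"
proof -
  from assms obtain S c T d where *: "finite S" "p = (\<lambda>x. \<Sum>m\<in>S. c m * character m x)"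
    "finite T" "q = (\<lambda>x. \<Sum>m\<in>T. d m * character m x)"
    unfolding trig_poly_def by blast
  have eq: "(\<lambda>x. p x * q x) = (\<lambda>x. \<Sum>m\<in>S. \<Sum>n\<in>T. (c m * d n) * character (m + n) x)"
    by (simp add: *(2,4) sum_product character_add mult_ac)
  show ?thesis
    unfolding eq using *(1,3) by (intro trig_poly_sum trig_poly_character)
qed

lemma trig_poly_continuous: "trig_poly p \<Longrightarrow> continuous_on A p"
  unfolding trig_poly_def by (auto intro!: continuous_intros character_continuous)

lemma trig_poly_measurable: "trig_poly p \<Longrightarrow> p \<in> borel_measurable borel"
  by (intro borel_measurable_continuous_onI trig_poly_continuous)

lemma trig_poly_bounded:
  assumes "trig_poly p" obtains B where "\<And>x. norm (p x) \<le> B"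
proof -
  from assms obtain S c where *: "finite S" "p = (\<lambda>x. \<Sum>m\<in>S. c m * character m x)"
    unfolding trig_poly_def by blast
  have "norm (p x) \<le> (\<Sum>m\<in>S. norm (c m))" for x
    unfolding *(2) by (rule order_trans[OF norm_sum]) (simp add: norm_mult)
  then show thesis by (rule that)
qed

lemma trig_poly_integrable: "trig_poly p \<Longrightarrow> integrable torus p"
  by (metis torus.integrable_const_bound AE_I2 trig_poly_bounded trig_poly_measurable measurable_torus)

text \<open>Realizes the torus as a compact set in complex d-space, where Stone-Weierstrass applies;
  real polynomials in the coordinates pull back to trigonometric polynomials.\<close>

definition torus_embedding :: "real^'d \<Rightarrow> complex^'d" where
  "torus_embedding x = (\<chi> i. cis (2 * pi * x $ i))"

lemma torus_embedding_continuous: "continuous_on A torus_embedding"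
  unfolding torus_embedding_def
  by (intro continuous_on_vec_lambda continuous_intros)

lemma torus_embedding_inj:
  assumes "torus_embedding x = torus_embedding y" "x \<in> cube" "y \<in> cube"
  shows "x = y"
  unfolding vec_eq_iff
proof
  fix i
  have "cis (2 * pi * x $ i) = cis (2 * pi * y $ i)"
    using assms(1) by (simp add: torus_embedding_def vec_eq_iff)
  then have "sin (2 * pi * x $ i) = sin (2 * pi * y $ i) \<and> cos (2 * pi * x $ i) = cos (2 * pi * y $ i)"
    by (metis cis.sel)
  then obtain n :: int where "2 * pi * x $ i = 2 * pi * y $ i + 2 * pi * n"
    unfolding sin_cos_eq_iff by blast
  then have "2 * pi * (x $ i) = 2 * pi * (y $ i + n)" by (simp add: distrib_left)
  then have *: "x $ i = y $ i + n" by simp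
  moreover have "0 \<le> x $ i" "x $ i < 1" "0 \<le> y $ i" "y $ i < 1" using assms(2,3) by (auto simp: cube_def)
  ultimately have "real_of_int n < 1" "- 1 < real_of_int n" by linarith+
  then have "n = 0" by linarith
  with * show "x $ i = y $ i" by simp
qed

lemma trig_poly_embedding_Basis:
  assumes "b \<in> Basis"
  shows "trig_poly (\<lambda>x. complex_of_real (torus_embedding x \<bullet> b))"
proof -
  from assms obtain i b' where b: "b = axis i b'" "b' = 1 \<or> b' = \<i>"
    by (auto simp: Basis_vec_def Basis_complex_def)
  have m: "lat_vec (axis i 1) \<bullet> x = x $ i" for x
  proof -
    have "lat_vec (axis i 1) = axis i 1" by (simp add: lat_vec_def vec_eq_iff axis_def)
    then show ?thesis by (simp add: inner_axis inner_commute)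
  qed
  have c: "character (axis i 1) x = cis (2 * pi * x $ i)" for x
    by (simp add: character_def m)
  have Re: "complex_of_real (Re z) = (1 / 2) * z + (1 / 2) * cnj z" for z
    by (simp add: complex_eq_iff)
  have Im: "complex_of_real (Im z) = (- \<i> / 2) * z + (\<i> / 2) * cnj z" for z
    by (simp add: complex_eq_iff)
  have in1: "torus_embedding x \<bullet> axis i 1 = Re (character (axis i 1) x)" for x
    by (simp add: inner_axis torus_embedding_def c)
  have in2: "torus_embedding x \<bullet> axis i \<i> = Im (character (axis i 1) x)" for x
    by (simp add: inner_axis torus_embedding_def c inner_complex_def)
  from b(2) show ?thesis
    unfolding b(1) by (auto simp only: in1 in2 Re Im character_minus[symmetric] intro!: trig_poly_add trig_poly_character)
qed

lemma trig_poly_polynomial_embedding: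
  fixes q :: "complex^'d \<Rightarrow> real"
  assumes "real_polynomial_function q"
  shows "trig_poly (\<lambda>x. complex_of_real (q (torus_embedding x)))"
  using assms
proof (induction q rule: real_polynomial_function.induct)
  case (linear f)
  have "f z = (\<Sum>b\<in>Basis. f b * (z \<bullet> b))" for z
  proof -
    have "f z = f (\<Sum>b\<in>Basis. (z \<bullet> b) *\<^sub>R b)" by (simp add: euclidean_representation)
    also have "\<dots> = (\<Sum>b\<in>Basis. f b * (z \<bullet> b))"
      using linear by (simp add: linear_sum bounded_linear.linear linear_cmul mult.commute)
    finally show ?thesis .
  qed
  then have eq: "(\<lambda>x. complex_of_real (f (torus_embedding x))) =
     (\<lambda>x. \<Sum>b\<in>Basis. complex_of_real (f b) * complex_of_real (torus_embedding x \<bullet> b))"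
    by (metis (mono_tags, lifting) of_real_sum of_real_mult sum.cong)
  show ?case
    unfolding eq by (intro trig_poly_sum trig_poly_mult trig_poly_const trig_poly_embedding_Basis finite_Basis)
next
  case (add f g) then show ?case using trig_poly_add by fastforce
next
  case (mult f g) then show ?case using trig_poly_mult by fastforce
qed (simp add: trig_poly_const)

lemma AE_torus_cube: "AE x in torus. x \<in> cube"
  unfolding torus_def by (subst AE_density) (auto split: split_indicator)

text \<open>Each third of \<open>\<eta>\<close> pays for one replacement: \<open>A\<close> by a
  compact \<open>K\<close>, \<open>K\<close> by a continuous cutoff on the embedded torus, the
  cutoff by a polynomial. Passing through the embedding makes the cutoff periodic.\<close>

lemma trig_poly_dense_indicator:
  fixes A :: "(real^'d) set"
  assumes A: "A \<in> sets borel" and \<eta>: "0 < \<eta>"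
  shows "\<exists>p. trig_poly p \<and> (\<integral>x. norm (complex_of_real (indicator A x) - p x) \<partial>torus) \<le> \<eta>"
proof -
  let ?M = "torus :: (real^'d) measure"
  define e where "e = \<eta> / 3"
  have e: "0 < e" using \<eta> by (simp add: e_def)
  have [measurable]: "A \<in> sets borel" by fact
  have sup: "emeasure ?M (A \<inter> cube) = (SUP K\<in>{K. K \<subseteq> A \<inter> cube \<and> compact K}. emeasure ?M K)"
    by (intro inner_regular) auto
  have "\<exists>K\<in>{K. K \<subseteq> A \<inter> cube \<and> compact K}. emeasure ?M (A \<inter> cube) < emeasure ?M K + ennreal e"
    using e by (intro SUP_approx_ennreal[OF _ _ sup]) auto
  then obtain K where K: "K \<subseteq> A \<inter> cube" "compact K" and le: "emeasure ?M (A \<inter> cube) < emeasure ?M K + ennreal e"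
    by blast
  have [measurable]: "K \<in> sets borel" using K by (simp add: compact_imp_closed)
  have mAK: "measure ?M (A \<inter> cube - K) \<le> e"
  proof -
    have "ennreal (measure ?M (A \<inter> cube)) < ennreal (measure ?M K) + ennreal e"
      using le by (simp add: torus.emeasure_eq_measure)
    also have "\<dots> = ennreal (measure ?M K + e)" using e by (subst ennreal_plus) auto
    finally have "measure ?M (A \<inter> cube) < measure ?M K + e" by (simp add: ennreal_less_iff)
    moreover have "measure ?M (A \<inter> cube - K) = measure ?M (A \<inter> cube) - measure ?M K"
      using K by (intro torus.finite_measure_Diff) auto
    ultimately show ?thesis by simp
  qed
  have AK: "(\<integral>x. \<bar>indicator A x - indicator K x\<bar> \<partial>?M) \<le> e"
  proof -
    have "(\<integral>x. \<bar>indicator A x - indicator K x\<bar> \<partial>?M) = (\<integral>x. indicator (A \<inter> cube - K) x \<partial>?M :: real)"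
    proof (rule integral_cong_AE)
      show "AE x in ?M. \<bar>indicator A x - indicator K x\<bar> = (indicator (A \<inter> cube - K) x :: real)"
        using AE_torus_cube by eventually_elim (use K in \<open>auto simp: indicator_def\<close>)
    qed auto
    then show ?thesis using mAK by simp
  qed
  let ?E = "torus_embedding :: real^'d \<Rightarrow> complex^'d"
  have [measurable]: "?E \<in> borel_measurable borel"
    by (intro borel_measurable_continuous_onI torus_embedding_continuous)
  show ?thesis
  \<comment> \<open>\<open>infdist\<close> to the empty set is 0, so the cutoff used below would be
    identically 1; here the zero polynomial is close enough.\<close>
  proof (cases "K = {}")
    case True
    then show ?thesis using AK e by (intro exI[of _ "\<lambda>_. 0"]) (simp add: trig_poly_const e_def)
  next
    case False
    have cl: "closed (?E ` K)" and ne: "?E ` K \<noteq> {}"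
      using compact_continuous_image[OF torus_embedding_continuous K(2)] False
      by (auto intro: compact_imp_closed)
    \<comment> \<open>Tends to the indicator of the closed image of \<open>K\<close>; since the
      embedding is injective on the half-open cube, this is the indicator of \<open>K\<close> at
      almost every point of the torus.\<close>
    define h :: "nat \<Rightarrow> complex^'d \<Rightarrow> real" where "h n z = max 0 (1 - real n * infdist z (?E ` K))" for n z
    have hc: "continuous_on B (h n)" for n B unfolding h_def by (intro continuous_intros)
    have [measurable]: "h n \<in> borel_measurable borel" for n
      by (intro borel_measurable_continuous_onI hc)
    have h01: "0 \<le> h n z" "h n z \<le> 1" for n z by (auto simp: h_def infdist_nonneg)
    have hb: "\<bar>h n (?E x) - indicator K x\<bar> \<le> 1" for n x
      using h01(1)[of n "?E x"] h01(2)[of n "?E x"] by (simp add: indicator_def)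
    have lim: "(\<lambda>n. h n (?E x)) \<longlonglongrightarrow> indicator K x" if x: "x \<in> cube" for x
    proof (cases "x \<in> K")
      case True
      then have "infdist (?E x) (?E ` K) = 0" by (intro infdist_zero) auto
      then show ?thesis using True by (simp add: h_def)
    next
      case notin: False
      have "?E x \<notin> ?E ` K" using notin torus_embedding_inj[OF _ x] K(1) by blast
      then have pos: "0 < infdist (?E x) (?E ` K)" (is "0 < ?d")
        using infdist_pos_not_in_closed[OF cl ne] by blast
      have "\<forall>\<^sub>F n in sequentially. h n (?E x) = 0"
        using eventually_ge_at_top[of "nat \<lceil>1 / ?d\<rceil>"]
      proof eventually_elim
        case (elim n)
        then have "1 / ?d \<le> real n" by linarith
        then have "1 \<le> real n * ?d" using pos by (simp add: field_simps)
        then show ?case by (simp add: h_def)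
      qed
      then show ?thesis using notin by (simp add: tendsto_eventually)
    qed
    have "(\<lambda>n. \<integral>x. \<bar>h n (?E x) - indicator K x\<bar> \<partial>?M) \<longlonglongrightarrow> (\<integral>x. 0 \<partial>?M :: real)"
    proof (rule integral_dominated_convergence[where w="\<lambda>_. 1"])
      show "AE x in ?M. (\<lambda>n. \<bar>h n (?E x) - indicator K x\<bar>) \<longlonglongrightarrow> 0"
        using AE_torus_cube
      proof eventually_elim
        case (elim x)
        have "(\<lambda>n. \<bar>h n (?E x) - indicator K x\<bar>) \<longlonglongrightarrow> \<bar>indicator K x - indicator K x\<bar>"
          by (intro tendsto_intros lim elim)
        then show ?case by simp
      qed
      show "AE x in ?M. norm \<bar>h n (?E x) - indicator K x\<bar> \<le> 1" for n
        using hb by simp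
    qed auto
    then have "(\<lambda>n. \<integral>x. \<bar>h n (?E x) - indicator K x\<bar> \<partial>?M) \<longlonglongrightarrow> 0" by simp
    then have "\<forall>\<^sub>F n in sequentially. (\<integral>x. \<bar>h n (?E x) - indicator K x\<bar> \<partial>?M) < e"
      using e by (intro order_tendstoD) auto
    then obtain n where n: "(\<integral>x. \<bar>h n (?E x) - indicator K x\<bar> \<partial>?M) < e"
      by (meson eventually_happens sequentially_bot)
    \<comment> \<open>The closed cube gives compactness, and its image contains the image of all of
      \<open>cube\<close>.\<close>
    have "compact (?E ` cbox 0 (\<chi> i. 1))"
      by (intro compact_continuous_image torus_embedding_continuous compact_cbox)
    then obtain q where q: "real_polynomial_function q" "\<And>z. z \<in> ?E ` cbox 0 (\<chi> i. 1) \<Longrightarrow> \<bar>h n z - q z\<bar> < e"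
      using Stone_Weierstrass_real_polynomial_function[OF _ hc e] by blast
    let ?p = "\<lambda>x. complex_of_real (q (?E x))"
    have p: "trig_poly ?p" by (rule trig_poly_polynomial_embedding[OF q(1)])
    have [measurable]: "(\<lambda>x. q (?E x)) \<in> borel_measurable borel"
    proof -
      have "(\<lambda>x. Re (?p x)) \<in> borel_measurable borel"
        using trig_poly_measurable[OF p] by measurable
      then show ?thesis by simp
    qed
    have "(\<integral>x. norm (complex_of_real (indicator A x) - ?p x) \<partial>?M)
        \<le> (\<integral>x. \<bar>indicator A x - indicator K x\<bar> + \<bar>h n (?E x) - indicator K x\<bar> + e \<partial>?M)"
    proof (rule integral_mono_AE)
      have "integrable ?M (\<lambda>x. complex_of_real (indicator A x))"
        by (rule torus.integrable_const_bound[of _ 1]) (auto simp: indicator_def)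
      then show "integrable ?M (\<lambda>x. norm (complex_of_real (indicator A x) - ?p x))"
        using trig_poly_integrable[OF p] by (intro integrable_norm Bochner_Integration.integrable_diff)
      have "integrable ?M (\<lambda>x. \<bar>indicator A x - indicator K x\<bar> :: real)"
        by (rule torus.integrable_const_bound[of _ 1]) (auto simp: indicator_def)
      moreover have "integrable ?M (\<lambda>x. \<bar>h n (?E x) - indicator K x\<bar>)"
        using hb by (intro torus.integrable_const_bound[of _ 1]) auto
      ultimately show "integrable ?M (\<lambda>x. \<bar>indicator A x - indicator K x\<bar> + \<bar>h n (?E x) - indicator K x\<bar> + e)"
        by simp
      show "AE x in ?M. norm (complex_of_real (indicator A x) - ?p x)
          \<le> \<bar>indicator A x - indicator K x\<bar> + \<bar>h n (?E x) - indicator K x\<bar> + e"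
        using AE_torus_cube
      proof eventually_elim
        case (elim x)
        then have "x \<in> cbox 0 (\<chi> i. 1)" by (simp add: cube_def mem_box_cart less_imp_le)
        then have "\<bar>h n (?E x) - q (?E x)\<bar> < e" by (intro q(2)) auto
        moreover have "norm (complex_of_real (indicator A x) - ?p x) = \<bar>indicator A x - q (?E x)\<bar>"
          by (metis norm_of_real of_real_diff)
        ultimately show ?case by linarith
      qed
    qed
    also have "\<dots> = (\<integral>x. \<bar>indicator A x - indicator K x\<bar> \<partial>?M) + (\<integral>x. \<bar>h n (?E x) - indicator K x\<bar> \<partial>?M) + e"
    proof -
      have "integrable ?M (\<lambda>x. \<bar>indicator A x - indicator K x\<bar> :: real)"
        by (rule torus.integrable_const_bound[of _ 1]) (auto simp: indicator_def)
      moreover have "integrable ?M (\<lambda>x. \<bar>h n (?E x) - indicator K x\<bar>)"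
        using hb by (intro torus.integrable_const_bound[of _ 1]) auto
      ultimately show ?thesis by simp
    qed
    also have "\<dots> \<le> \<eta>" using AK n by (simp add: e_def)
    finally show ?thesis using p by blast
  qed
qed

lemma L1_dist_trig_poly_triangle:
  assumes f: "integrable torus f" and h: "integrable torus h" and p: "trig_poly p"
  shows "(\<integral>x. norm (complex_of_real (f x) - p x) \<partial>torus)
     \<le> (\<integral>x. \<bar>f x - h x\<bar> \<partial>torus) + (\<integral>x. norm (complex_of_real (h x) - p x) \<partial>torus)"
proof -
  have i: "integrable torus (\<lambda>x. norm (complex_of_real (u x) - p x))" if "integrable torus u" for u
    using that trig_poly_integrable[OF p] by (intro integrable_norm Bochner_Integration.integrable_diff) auto
  have d: "integrable torus (\<lambda>x. \<bar>f x - h x\<bar>)" using f h by simp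
  have "(\<integral>x. norm (complex_of_real (f x) - p x) \<partial>torus)
      \<le> (\<integral>x. \<bar>f x - h x\<bar> + norm (complex_of_real (h x) - p x) \<partial>torus)"
  proof (rule integral_mono)
    fix x
    have "norm (complex_of_real (f x) - p x) \<le> norm (complex_of_real (f x) - complex_of_real (h x)) + norm (complex_of_real (h x) - p x)"
      by norm
    also have "norm (complex_of_real (f x) - complex_of_real (h x)) = \<bar>f x - h x\<bar>"
      by (metis norm_of_real of_real_diff)
    finally show "norm (complex_of_real (f x) - p x) \<le> \<bar>f x - h x\<bar> + norm (complex_of_real (h x) - p x)" .
  qed (use i[OF f] i[OF h] d in auto)
  also have "\<dots> = (\<integral>x. \<bar>f x - h x\<bar> \<partial>torus) + (\<integral>x. norm (complex_of_real (h x) - p x) \<partial>torus)"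
    using d i[OF h] by (rule Bochner_Integration.integral_add)
  finally show ?thesis .
qed

lemma trig_poly_dense:
  fixes f :: "real^'d \<Rightarrow> real"
  assumes "integrable torus f" and "0 < \<eta>"
  shows "\<exists>p. trig_poly p \<and> (\<integral>x. norm (complex_of_real (f x) - p x) \<partial>torus) \<le> \<eta>"
  using assms
proof (induction arbitrary: \<eta> rule: integrable_induct)
  case (base A c)
  have "0 < \<eta> / (\<bar>c\<bar> + 1)" using base by simp
  then obtain p where p: "trig_poly p"
    "(\<integral>x. norm (complex_of_real (indicator A x) - p x) \<partial>torus) \<le> \<eta> / (\<bar>c\<bar> + 1)"
    using trig_poly_dense_indicator[of A] base(1) by auto
  have "(\<integral>x. norm (complex_of_real (indicator A x *\<^sub>R c) - complex_of_real c * p x) \<partial>torus)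
     = (\<integral>x. \<bar>c\<bar> * norm (complex_of_real (indicator A x) - p x) \<partial>torus)"
  proof (rule Bochner_Integration.integral_cong[OF refl])
    fix x
    have "complex_of_real (indicator A x *\<^sub>R c) - complex_of_real c * p x
        = complex_of_real c * (complex_of_real (indicator A x) - p x)"
      by (simp add: right_diff_distrib mult.commute)
    then show "norm (complex_of_real (indicator A x *\<^sub>R c) - complex_of_real c * p x)
      = \<bar>c\<bar> * norm (complex_of_real (indicator A x) - p x)" by (simp add: norm_mult)
  qed
  also have "\<dots> = \<bar>c\<bar> * (\<integral>x. norm (complex_of_real (indicator A x) - p x) \<partial>torus)" by simp
  also have "\<dots> \<le> (\<bar>c\<bar> + 1) * (\<eta> / (\<bar>c\<bar> + 1))"
    using p(2) by (intro mult_mono) auto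
  also have "\<dots> = \<eta>" by simp
  finally show ?case using p(1) by (intro exI[of _ "\<lambda>x. complex_of_real c * p x"])
      (auto intro: trig_poly_mult trig_poly_const)
next
  case (add f h)
  from add.IH(1)[of "\<eta> / 2"] add.prems obtain p where p: "trig_poly p"
    "(\<integral>x. norm (complex_of_real (f x) - p x) \<partial>torus) \<le> \<eta> / 2" by auto
  from add.IH(2)[of "\<eta> / 2"] add.prems obtain q where q: "trig_poly q"
    "(\<integral>x. norm (complex_of_real (h x) - q x) \<partial>torus) \<le> \<eta> / 2" by auto
  have i: "integrable torus (\<lambda>x. norm (complex_of_real (u x) - r x))"
    if "integrable torus u" "trig_poly r" for u :: "real^'d \<Rightarrow> real" and r
    using that trig_poly_integrable[OF that(2)] by (intro integrable_norm Bochner_Integration.integrable_diff) auto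
  have "(\<integral>x. norm (complex_of_real (f x + h x) - (p x + q x)) \<partial>torus)
     \<le> (\<integral>x. norm (complex_of_real (f x) - p x) + norm (complex_of_real (h x) - q x) \<partial>torus)"
  proof (rule integral_mono)
    fix x
    have "complex_of_real (f x + h x) - (p x + q x) = (complex_of_real (f x) - p x) + (complex_of_real (h x) - q x)"
      by simp
    then show "norm (complex_of_real (f x + h x) - (p x + q x)) \<le> norm (complex_of_real (f x) - p x) + norm (complex_of_real (h x) - q x)"
      by (metis norm_triangle_ineq)
  next
    show "integrable torus (\<lambda>x. norm (complex_of_real (f x + h x) - (p x + q x)))"
      using add.hyps p(1) q(1) by (intro i trig_poly_add Bochner_Integration.integrable_add)
    show "integrable torus (\<lambda>x. norm (complex_of_real (f x) - p x) + norm (complex_of_real (h x) - q x))"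
      using add.hyps p(1) q(1) by (intro i Bochner_Integration.integrable_add)
  qed
  also have "\<dots> = (\<integral>x. norm (complex_of_real (f x) - p x) \<partial>torus) + (\<integral>x. norm (complex_of_real (h x) - q x) \<partial>torus)"
    by (rule Bochner_Integration.integral_add[OF i[OF add.hyps(1) p(1)] i[OF add.hyps(2) q(1)]])
  also have "\<dots> \<le> \<eta>" using p(2) q(2) by simp
  finally show ?case using trig_poly_add[OF p(1) q(1)] by blast
next
  case (lim f s)
  have "0 < \<eta> / 2" using lim.prems by simp
  from integrable_L1_approx[OF lim.hyps(1-4) this]
  obtain i where i: "(\<integral>x. \<bar>f x - s i x\<bar> \<partial>torus) < \<eta> / 2" by blast
  from lim.IH[of "\<eta> / 2" i] lim.prems obtain p where p: "trig_poly p"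
    "(\<integral>x. norm (complex_of_real (s i x) - p x) \<partial>torus) \<le> \<eta> / 2" by auto
  then show ?case
    using L1_dist_trig_poly_triangle[OF lim.hyps(4,1) p(1), of i] i by (intro exI[of _ p]) auto
qed

section \<open>Fourier coefficients and Bessel's inequality\<close>

definition fourier_coeff :: "(real^'d \<Rightarrow> real) \<Rightarrow> int^'d \<Rightarrow> complex" where
  "fourier_coeff f m = (\<integral>x. complex_of_real (f x) * cnj (character m x) \<partial>torus)"

lemma integrable_mult_character:
  assumes "integrable torus f"
  shows "integrable torus (\<lambda>x. complex_of_real (f x) * character m x)"
proof (rule Bochner_Integration.integrable_bound[OF assms])
  have [measurable]: "f \<in> borel_measurable borel" using borel_measurable_integrable[OF assms] by simp
  show "(\<lambda>x. complex_of_real (f x) * character m x) \<in> borel_measurable torus" by simp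
qed (simp add: norm_mult)

lemma integrable_mult_cnj_character:
  assumes "integrable torus f"
  shows "integrable torus (\<lambda>x. complex_of_real (f x) * cnj (character m x))"
  using integrable_mult_character[OF assms, of "- m"] by (simp add: character_minus)

lemma integral_mult_character:
  "(\<integral>x. complex_of_real (f x) * character m x \<partial>torus) = cnj (fourier_coeff f m)"
  unfolding fourier_coeff_def by (subst Bochner_Integration.integral_cnj[symmetric]) simp

lemma integral_character_mult_cnj:
  "(\<integral>x. character m x * cnj (character n x) \<partial>torus) = (if m = n then 1 else 0)"
proof -
  have "character m x * cnj (character n x) = character (m - n) x" for x
    by (simp add: character_add[of m "- n", simplified] character_minus)
  then show ?thesis using integral_character[of "m - n"] by simp
qed

lemma integral_trig_poly_mult_cnj_character:
  assumes S: "finite S"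
  shows "(\<integral>x. (\<Sum>m\<in>S. c m * character m x) * cnj (character n x) \<partial>torus) = (if n \<in> S then c n else 0)"
proof -
  have i: "integrable torus (\<lambda>x. c m * (character m x * cnj (character n x)))" for m
    by (rule torus.integrable_const_bound[of _ "norm (c m)"]) (auto simp: norm_mult)
  have "(\<integral>x. (\<Sum>m\<in>S. c m * character m x) * cnj (character n x) \<partial>torus)
      = (\<integral>x. (\<Sum>m\<in>S. c m * (character m x * cnj (character n x))) \<partial>torus)"
    by (simp add: sum_distrib_right mult.assoc)
  also have "\<dots> = (\<Sum>m\<in>S. c m * (if m = n then 1 else 0))"
    using i by (simp add: integral_character_mult_cnj)
  also have "\<dots> = (if n \<in> S then c n else 0)" using S by (simp add: if_distrib cong: if_cong)
  finally show ?thesis .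
qed

text \<open>The squared distance of \<open>f\<close> to its partial Fourier sum is nonnegative; the
  mixed term and the square of the sum both reduce to the sum of squared coefficients.\<close>

lemma bessel:
  assumes f: "f \<in> L2_torus" and S: "finite S"
  shows "(\<Sum>m\<in>S. (norm (fourier_coeff f m))\<^sup>2) \<le> nsq f"
proof -
  let ?c = "fourier_coeff f"
  define P where "P = (\<lambda>x. \<Sum>m\<in>S. ?c m * character m x)"
  have P: "trig_poly P" unfolding trig_poly_def P_def using S by blast
  have [measurable]: "f \<in> borel_measurable borel" "P \<in> borel_measurable borel"
    using f trig_poly_measurable[OF P] by auto
  have fi: "integrable torus f" by (rule L2_torus_integrable[OF f])
  have cnjP: "cnj (P x) = (\<Sum>m\<in>S. cnj (?c m) * cnj (character m x))" for x by (simp add: P_def)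
  have fP: "complex_of_real (f x) * cnj (P x) = (\<Sum>m\<in>S. cnj (?c m) * (complex_of_real (f x) * cnj (character m x)))" for x
    by (simp add: cnjP sum_distrib_left mult_ac)
  have PP: "P x * cnj (P x) = (\<Sum>m\<in>S. cnj (?c m) * (P x * cnj (character m x)))" for x
    by (simp add: cnjP sum_distrib_left mult_ac)
  obtain B where B: "\<And>x. norm (P x) \<le> B" by (rule trig_poly_bounded[OF P]) blast
  have iPc: "integrable torus (\<lambda>x. P x * cnj (character m x))" for m
    using B by (intro torus.integrable_const_bound[of _ B]) (auto simp: norm_mult)
  have I1: "integrable torus (\<lambda>x. complex_of_real (f x) * cnj (P x))"
    unfolding fP using integrable_mult_cnj_character[OF fi] by auto
  have I2: "integrable torus (\<lambda>x. P x * cnj (P x))"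
    unfolding PP using iPc by auto
  have E1: "(\<integral>x. complex_of_real (f x) * cnj (P x) \<partial>torus) = (\<Sum>m\<in>S. cnj (?c m) * ?c m)"
    unfolding fP using integrable_mult_cnj_character[OF fi] by (simp add: fourier_coeff_def)
  have E2: "(\<integral>x. P x * cnj (P x) \<partial>torus) = (\<Sum>m\<in>S. cnj (?c m) * ?c m)"
  proof -
    have "(\<integral>x. P x * cnj (P x) \<partial>torus) = (\<Sum>m\<in>S. cnj (?c m) * (\<integral>x. P x * cnj (character m x) \<partial>torus))"
      unfolding PP using iPc by simp
    also have "\<dots> = (\<Sum>m\<in>S. cnj (?c m) * ?c m)"
      unfolding P_def using S by (intro sum.cong refl) (simp add: integral_trig_poly_mult_cnj_character)
    finally show ?thesis .
  qed
  have sq: "(\<Sum>m\<in>S. cnj (?c m) * ?c m) = complex_of_real (\<Sum>m\<in>S. (norm (?c m))\<^sup>2)"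
    by (simp add: complex_norm_square mult.commute del: of_real_power)
  have "(norm (complex_of_real (f x) - P x))\<^sup>2 = (f x)\<^sup>2 - 2 * Re (complex_of_real (f x) * cnj (P x)) + Re (P x * cnj (P x))" for x
    unfolding cmod_power2 by (simp add: power2_eq_square algebra_simps)
  then have "0 \<le> (\<integral>x. (f x)\<^sup>2 - 2 * Re (complex_of_real (f x) * cnj (P x)) + Re (P x * cnj (P x)) \<partial>torus)"
    by (intro Bochner_Integration.integral_nonneg) (metis zero_le_power2)
  also have "\<dots> = nsq f - 2 * Re (\<integral>x. complex_of_real (f x) * cnj (P x) \<partial>torus) + Re (\<integral>x. P x * cnj (P x) \<partial>torus)"
    using L2_torusD(3)[OF f] integrable_Re[OF I1] integrable_Re[OF I2] integral_Re[OF I1] integral_Re[OF I2]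
    by (simp only: Bochner_Integration.integral_add Bochner_Integration.integral_diff integral_mult_right_zero
        Bochner_Integration.integrable_diff integrable_mult_right nsq_def)
  also have "\<dots> = nsq f - (\<Sum>m\<in>S. (norm (?c m))\<^sup>2)"
    unfolding E1 E2 sq by simp
  finally show ?thesis by simp
qed

subsection \<open>The spectral bound\<close>

context torus_kernel
begin

text \<open>Bessel's inequality suffices here: the kernel, not the function it acts on, is approximated by
  trigonometric polynomials, so completeness of the characters in \<open>L\<^sup>2\<close> is never needed. The
  approximation error enters through Young's inequality in bilinear form.\<close>

lemma integral_trig_poly_convolution:
  assumes S: "finite S" and f: "integrable torus f"
  shows "(\<integral>y. (\<Sum>m\<in>S. c m * character m (x - y)) * complex_of_real (f y) \<partial>torus)
     = (\<Sum>m\<in>S. c m * fourier_coeff f m * character m x)"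
proof -
  have "(\<integral>y. (\<Sum>m\<in>S. c m * character m (x - y)) * complex_of_real (f y) \<partial>torus)
     = (\<integral>y. (\<Sum>m\<in>S. (c m * character m x) * (complex_of_real (f y) * cnj (character m y))) \<partial>torus)"
    by (simp add: character_diff_arg sum_distrib_left sum_distrib_right mult_ac)
  also have "\<dots> = (\<Sum>m\<in>S. (c m * character m x) * fourier_coeff f m)"
    using integrable_mult_cnj_character[OF f] by (simp add: fourier_coeff_def)
  finally show ?thesis by (simp add: mult_ac)
qed

text \<open>A Fourier coefficient is bounded by the L1 norm, so an approximating polynomial inherits
  the spectral gap of the kernel up to \<open>\<eta>\<close>.\<close>

lemma trig_poly_coeff_near:
  assumes S: "finite S" and n: "n \<in> S"
    and \<eta>: "(\<integral>x. norm (complex_of_real (k x) - (\<Sum>m\<in>S. c m * character m x)) \<partial>torus) \<le> \<eta>"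
  shows "norm (c n - fourier_coeff k n) \<le> \<eta>"
proof -
  define P where "P = (\<lambda>x. \<Sum>m\<in>S. c m * character m x)"
  have P: "trig_poly P" unfolding trig_poly_def P_def using S by blast
  obtain B where B: "\<And>x. norm (P x) \<le> B" using trig_poly_bounded[OF P] by blast
  have [measurable]: "P \<in> borel_measurable borel" by (rule trig_poly_measurable[OF P])
  have iP: "integrable torus (\<lambda>x. P x * cnj (character n x))"
    using B by (intro torus.integrable_const_bound[of _ B]) (auto simp: norm_mult)
  have "fourier_coeff k n - c n = (\<integral>x. complex_of_real (k x) * cnj (character n x) \<partial>torus) - (\<integral>x. P x * cnj (character n x) \<partial>torus)"
    using integral_trig_poly_mult_cnj_character[OF S, of c n] n by (simp add: fourier_coeff_def P_def)
  also have "\<dots> = (\<integral>x. (complex_of_real (k x) - P x) * cnj (character n x) \<partial>torus)"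
    using integrable_mult_cnj_character[OF integrable_k] iP by (simp add: left_diff_distrib)
  also have "norm \<dots> \<le> (\<integral>x. norm ((complex_of_real (k x) - P x) * cnj (character n x)) \<partial>torus)"
    by (rule integral_norm_bound)
  also have "\<dots> \<le> \<eta>" using \<eta> by (simp add: norm_mult P_def)
  finally show ?thesis by (simp add: norm_minus_commute)
qed

text \<open>\<open>nsq (conv f)\<close> is the pairing of \<open>v = conv f\<close> with itself; in
  one factor the kernel is split into a polynomial and a remainder. Both parts are bounded by
  \<open>a * b \<le> (q * a\<^sup>2 + b\<^sup>2 / q) / 2\<close>, whose two terms balance exactly
  when the target estimate \<open>nsq v = q\<^sup>2 * nsq f\<close> is sharp. The polynomial
  contributes \<open>q + \<eta>\<close>, the remainder \<open>\<eta>\<close>.\<close>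

lemma nsq_conv_le_spectral_approx:
  assumes f: "f \<in> L2_0" and q: "0 < q" and \<eta>: "0 < \<eta>"
    and gap: "\<And>m. m \<noteq> 0 \<Longrightarrow> norm (fourier_coeff k m) \<le> q"
  shows "nsq (conv f) \<le> (q + 2 * \<eta>) * ((q * nsq f + nsq (conv f) / q) / 2)"
proof -
  let ?M = "torus :: (real^'d) measure"
  define v where "v = conv f"
  define Y where "Y = (q * nsq f + nsq v / q) / 2"
  have Y0: "0 \<le> Y" using q by (simp add: Y_def)
  have v0: "v \<in> L2_0" unfolding v_def by (rule conv_L2_0[OF f])
  have fL: "f \<in> L2_torus" and vL: "v \<in> L2_torus" using f v0 by (auto simp: L2_0_iff)
  have fi: "integrable ?M f" and vi: "integrable ?M v" using fL vL by (auto intro: L2_torus_integrable)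
  have [measurable]: "f \<in> borel_measurable borel" "v \<in> borel_measurable borel" using fL vL by auto
  obtain p where p: "trig_poly p" and pk: "(\<integral>x. norm (complex_of_real (k x) - p x) \<partial>?M) \<le> \<eta>"
    using trig_poly_dense[OF integrable_k \<eta>] by blast
  obtain S c where S: "finite S" and pS: "p = (\<lambda>x. \<Sum>m\<in>S. c m * character m x)"
    using p unfolding trig_poly_def by blast
  have [measurable]: "p \<in> borel_measurable borel" by (rule trig_poly_measurable[OF p])
  obtain B where B: "\<And>x. norm (p x) \<le> B" using trig_poly_bounded[OF p] by blast
  define h where "h x = norm (complex_of_real (k x) - p x)" for x
  have [measurable]: "h \<in> borel_measurable borel" unfolding h_def by measurable
  have h0: "0 \<le> h x" for x by (simp add: h_def)
  have hi: "integrable ?M h"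
    unfolding h_def using integrable_k trig_poly_integrable[OF p]
    by (intro integrable_norm Bochner_Integration.integrable_diff) auto
  have hn: "(\<integral>\<^sup>+x. ennreal (h x) \<partial>?M) \<le> ennreal \<eta>"
  proof -
    have "(\<integral>x. h x \<partial>?M) \<le> \<eta>" using pk by (simp only: h_def)
    then show ?thesis using hi h0 by (subst nn_integral_eq_integral) (auto intro!: ennreal_leI)
  qed
  have hper: "periodic_fun h"
    unfolding periodic_fun_def
  proof safe
    fix x l :: "real^'d" assume l: "l \<in> lattice"
    have "character m (x + l) = character m x" for m :: "int^'d"
      using l character_periodic[of m] by (simp only: periodic_fun_def)
    then have "p (x + l) = p x" unfolding pS by simp
    moreover have "k (x + l) = k x" using l k_periodic by (simp only: periodic_fun_def)
    ultimately show "h (x + l) = h x" by (simp only: h_def)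
  qed
  have hper': "periodic_fun (\<lambda>x. ennreal (h x))" using hper by (simp add: periodic_fun_def)
  have h_y: "(\<integral>\<^sup>+y. ennreal (h (x - y)) \<partial>?M) \<le> ennreal \<eta>" for x
  proof -
    have "(\<integral>\<^sup>+y. ennreal (h (x - y)) \<partial>?M) = (\<integral>\<^sup>+x. ennreal (h x) \<partial>?M)"
      by (rule mpres_nn_integral[OF mpres_reflection, of "\<lambda>z. ennreal (h z)"]) (measurable, rule hper')
    then show ?thesis using hn by (simp only:)
  qed
  have h_x: "(\<integral>\<^sup>+x. ennreal (h (x - y)) \<partial>?M) \<le> ennreal \<eta>" for y
  proof -
    have "(\<integral>\<^sup>+x. ennreal (h (x + - y)) \<partial>?M) = (\<integral>\<^sup>+x. ennreal (h x) \<partial>?M)"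
      by (rule mpres_nn_integral[OF mpres_translation, of "\<lambda>z. ennreal (h z)"]) (measurable, rule hper')
    then show ?thesis using hn by (simp only: add_uminus_conv_diff)
  qed
  define w where "w = (\<lambda>x. \<Sum>m\<in>S. c m * fourier_coeff f m * character m x)"
  have wp: "trig_poly w"
    unfolding w_def using S by (intro trig_poly_sum trig_poly_character)
  have [measurable]: "w \<in> borel_measurable borel" by (rule trig_poly_measurable[OF wp])
  obtain B' where B': "\<And>x. norm (w x) \<le> B'" using trig_poly_bounded[OF wp] by blast

  have coeff: "(\<integral>x. complex_of_real (v x) * w x \<partial>?M) = (\<Sum>m\<in>S. c m * fourier_coeff f m * cnj (fourier_coeff v m))"
  proof -
    have "(\<integral>x. complex_of_real (v x) * w x \<partial>?M) = (\<integral>x. (\<Sum>m\<in>S. (c m * fourier_coeff f m) * (complex_of_real (v x) * character m x)) \<partial>?M)"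
      by (simp add: w_def sum_distrib_left mult_ac)
    also have "\<dots> = (\<Sum>m\<in>S. (c m * fourier_coeff f m) * cnj (fourier_coeff v m))"
      using integrable_mult_character[OF vi] by (simp add: integral_mult_character)
    finally show ?thesis .
  qed
  \<comment> \<open>Zero mean removes the index 0, where the kernel has coefficient 1 and no gap is
    assumed.\<close>
  have f0: "fourier_coeff f 0 = 0"
    using L2_0D(4)[OF f] by (simp add: fourier_coeff_def)
  have main: "norm (\<integral>x. complex_of_real (v x) * w x \<partial>?M) \<le> (q + \<eta>) * Y"
  proof -
    have "norm (\<integral>x. complex_of_real (v x) * w x \<partial>?M) \<le> (\<Sum>m\<in>S. norm (c m * fourier_coeff f m * cnj (fourier_coeff v m)))"
      unfolding coeff by (rule norm_sum)
    also have "\<dots> \<le> (\<Sum>m\<in>S. (q + \<eta>) * ((q * (norm (fourier_coeff f m))\<^sup>2 + (norm (fourier_coeff v m))\<^sup>2 / q) / 2))"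
    proof (rule sum_mono)
      fix m assume m: "m \<in> S"
      show "norm (c m * fourier_coeff f m * cnj (fourier_coeff v m))
        \<le> (q + \<eta>) * ((q * (norm (fourier_coeff f m))\<^sup>2 + (norm (fourier_coeff v m))\<^sup>2 / q) / 2)"
      proof (cases "m = 0")
        case True
        then show ?thesis using q \<eta> by (simp add: f0)
      next
        case False
        have "norm (c m) \<le> norm (fourier_coeff k m) + norm (c m - fourier_coeff k m)"
          using norm_triangle_sub[of "c m" "fourier_coeff k m"] .
        also have "\<dots> \<le> q + \<eta>"
          using gap[OF False] trig_poly_coeff_near[OF S m pk[unfolded pS]] by (rule add_mono)
        finally have cm: "norm (c m) \<le> q + \<eta>" .
        have ag: "a * b \<le> (q * a\<^sup>2 + b\<^sup>2 / q) / 2" for a b :: real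
        proof -
          have "0 \<le> (q * a - b)\<^sup>2 / q" using q by simp
          also have "\<dots> = q * a\<^sup>2 + b\<^sup>2 / q - 2 * (a * b)"
            using q by (simp add: power2_eq_square field_simps)
          finally show ?thesis by simp
        qed
        have "norm (c m * fourier_coeff f m * cnj (fourier_coeff v m))
           = norm (c m) * (norm (fourier_coeff f m) * norm (fourier_coeff v m))"
          by (simp add: norm_mult)
        also have "\<dots> \<le> (q + \<eta>) * ((q * (norm (fourier_coeff f m))\<^sup>2 + (norm (fourier_coeff v m))\<^sup>2 / q) / 2)"
          using q \<eta> by (intro mult_mono cm ag) auto
        finally show ?thesis .
      qed
    qed
    also have "\<dots> = (q + \<eta>) * ((q * (\<Sum>m\<in>S. (norm (fourier_coeff f m))\<^sup>2) + (\<Sum>m\<in>S. (norm (fourier_coeff v m))\<^sup>2) / q) / 2)"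
      by (simp only: sum_distrib_left sum_divide_distrib sum.distrib[symmetric])
    also have "\<dots> \<le> (q + \<eta>) * Y"
      unfolding Y_def using q \<eta> bessel[OF fL S] bessel[OF vL S]
      by (intro mult_left_mono divide_right_mono add_mono) auto
    finally show ?thesis .
  qed

  \<comment> \<open>Only for almost every \<open>x\<close>: elsewhere the convolution integrand may
    fail to be integrable and \<open>conv f x\<close> is a default value.\<close>
  have err_pt: "AE x in ?M. ennreal (norm (complex_of_real (v x) * (complex_of_real (conv f x) - w x)))
      \<le> (\<integral>\<^sup>+y. ennreal (h (x - y)) * ennreal ((q * (f y)\<^sup>2 + (v x)\<^sup>2 / q) / 2) \<partial>?M)"
  proof -
    have "AE x in ?M. integrable ?M (\<lambda>y. case (x, y) of (x, y) \<Rightarrow> k (x - y) * f y)"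
      by (rule torus_pair.AE_integrable_fst'[OF integrable_pair_snd[OF fi]])
    then show ?thesis
    proof eventually_elim
      case (elim x)
      then have ik: "integrable ?M (\<lambda>y. complex_of_real (k (x - y) * f y))"
        by (simp only: complex_of_real_integrable_eq prod.case)
      have ip: "integrable ?M (\<lambda>y. p (x - y) * complex_of_real (f y))"
      proof (rule Bochner_Integration.integrable_bound)
        show "integrable ?M (\<lambda>y. B * f y)" using fi by simp
        have "norm (p (x - y)) * \<bar>f y\<bar> \<le> \<bar>B\<bar> * \<bar>f y\<bar>" for y
          using B[of "x - y"] by (intro mult_right_mono) auto
        then show "AE y in ?M. norm (p (x - y) * complex_of_real (f y)) \<le> norm (B * f y)"
          by (simp add: norm_mult abs_mult)
      qed measurable
      have "complex_of_real (conv f x) = (\<integral>y. complex_of_real (k (x - y) * f y) \<partial>?M)"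
        unfolding conv_def by (rule integral_complex_of_real[symmetric])
      moreover have "w x = (\<integral>y. p (x - y) * complex_of_real (f y) \<partial>?M)"
        by (simp only: w_def pS integral_trig_poly_convolution[OF S fi])
      ultimately have "complex_of_real (conv f x) - w x
         = (\<integral>y. complex_of_real (k (x - y) * f y) - p (x - y) * complex_of_real (f y) \<partial>?M)"
        using Bochner_Integration.integral_diff[OF ik ip] by simp
      then have eq: "complex_of_real (v x) * (complex_of_real (conv f x) - w x)
         = (\<integral>y. complex_of_real (v x) * ((complex_of_real (k (x - y)) - p (x - y)) * complex_of_real (f y)) \<partial>?M)"
        by (simp only: integral_mult_right_zero left_diff_distrib of_real_mult)
      have i: "integrable ?M (\<lambda>y. complex_of_real (v x) * ((complex_of_real (k (x - y)) - p (x - y)) * complex_of_real (f y)))"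
        using integrable_mult_right[OF Bochner_Integration.integrable_diff[OF ik ip], of "complex_of_real (v x)"]
        by (simp only: left_diff_distrib of_real_mult)
      have "ennreal (norm (complex_of_real (v x) * (complex_of_real (conv f x) - w x)))
         \<le> (\<integral>\<^sup>+y. ennreal (norm (complex_of_real (v x) * ((complex_of_real (k (x - y)) - p (x - y)) * complex_of_real (f y)))) \<partial>?M)"
        unfolding eq by (rule integral_norm_bound_ennreal[OF i])
      also have "\<dots> \<le> (\<integral>\<^sup>+y. ennreal (h (x - y)) * ennreal ((q * (f y)\<^sup>2 + (v x)\<^sup>2 / q) / 2) \<partial>?M)"
      proof (rule nn_integral_mono)
        fix y
        have "0 \<le> (q * \<bar>f y\<bar> - \<bar>v x\<bar>)\<^sup>2 / q" using q by simp
        also have "\<dots> = q * (f y)\<^sup>2 + (v x)\<^sup>2 / q - 2 * (\<bar>f y\<bar> * \<bar>v x\<bar>)"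
          using q by (simp add: power2_diff power_mult_distrib add_divide_distrib diff_divide_distrib)
             (simp add: power2_eq_square)
        finally have ag: "\<bar>v x\<bar> * \<bar>f y\<bar> \<le> (q * (f y)\<^sup>2 + (v x)\<^sup>2 / q) / 2" by (simp add: mult.commute)
        have "norm (complex_of_real (v x) * ((complex_of_real (k (x - y)) - p (x - y)) * complex_of_real (f y)))
            = h (x - y) * (\<bar>v x\<bar> * \<bar>f y\<bar>)"
          by (simp add: norm_mult h_def)
        also have "\<dots> \<le> h (x - y) * ((q * (f y)\<^sup>2 + (v x)\<^sup>2 / q) / 2)"
          by (rule mult_left_mono[OF ag h0])
        finally show "ennreal (norm (complex_of_real (v x) * ((complex_of_real (k (x - y)) - p (x - y)) * complex_of_real (f y))))
            \<le> ennreal (h (x - y)) * ennreal ((q * (f y)\<^sup>2 + (v x)\<^sup>2 / q) / 2)"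
          using h0 q by (subst ennreal_mult[symmetric]) (auto intro!: ennreal_leI)
      qed
      finally show ?case .
    qed
  qed
  \<comment> \<open>The remainder \<open>h\<close> has integral at most \<open>\<eta>\<close> in
    either variable, so each of the two squares is integrated after the other variable.\<close>
  have err: "(\<integral>\<^sup>+x. ennreal (norm (complex_of_real (v x) * (complex_of_real (conv f x) - w x))) \<partial>?M) \<le> ennreal (\<eta> * Y)"
  proof -
    have fn: "(\<integral>\<^sup>+y. ennreal (q * (f y)\<^sup>2 / 2) \<partial>?M) = ennreal (q * nsq f / 2)"
      using L2_torusD(3)[OF fL] q by (subst nn_integral_eq_integral) (auto simp: nsq_def)
    have vn: "(\<integral>\<^sup>+x. ennreal ((v x)\<^sup>2 / q / 2) \<partial>?M) = ennreal (nsq v / q / 2)"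
      using L2_torusD(3)[OF vL] q by (subst nn_integral_eq_integral) (auto simp: nsq_def)
    have split: "ennreal ((q * (f y)\<^sup>2 + (v x)\<^sup>2 / q) / 2) = ennreal (q * (f y)\<^sup>2 / 2) + ennreal ((v x)\<^sup>2 / q / 2)" for x y
      using q by (subst ennreal_plus[symmetric]) (auto simp: add_divide_distrib)
    have "(\<integral>\<^sup>+x. ennreal (norm (complex_of_real (v x) * (complex_of_real (conv f x) - w x))) \<partial>?M)
      \<le> (\<integral>\<^sup>+x. (\<integral>\<^sup>+y. ennreal (h (x - y)) * ennreal ((q * (f y)\<^sup>2 + (v x)\<^sup>2 / q) / 2) \<partial>?M) \<partial>?M)"
      by (rule nn_integral_mono_AE[OF err_pt])
    also have "\<dots> = (\<integral>\<^sup>+x. (\<integral>\<^sup>+y. ennreal (h (x - y)) * ennreal (q * (f y)\<^sup>2 / 2) \<partial>?M)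
          + (\<integral>\<^sup>+y. ennreal (h (x - y)) \<partial>?M) * ennreal ((v x)\<^sup>2 / q / 2) \<partial>?M)"
      by (simp only: split distrib_left) (simp add: nn_integral_add nn_integral_multc)
    also have "\<dots> = (\<integral>\<^sup>+x. (\<integral>\<^sup>+y. ennreal (h (x - y)) * ennreal (q * (f y)\<^sup>2 / 2) \<partial>?M) \<partial>?M)
          + (\<integral>\<^sup>+x. (\<integral>\<^sup>+y. ennreal (h (x - y)) \<partial>?M) * ennreal ((v x)\<^sup>2 / q / 2) \<partial>?M)"
      by (rule nn_integral_add) measurable
    also have "\<dots> \<le> ennreal \<eta> * ennreal (q * nsq f / 2) + ennreal \<eta> * ennreal (nsq v / q / 2)"
    proof (rule add_mono)
      have "(\<integral>\<^sup>+x. (\<integral>\<^sup>+y. ennreal (h (x - y)) * ennreal (q * (f y)\<^sup>2 / 2) \<partial>?M) \<partial>?M)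
          = (\<integral>\<^sup>+y. (\<integral>\<^sup>+x. ennreal (h (x - y)) * ennreal (q * (f y)\<^sup>2 / 2) \<partial>?M) \<partial>?M)"
        by (rule torus_pair.Fubini') measurable
      also have "\<dots> = (\<integral>\<^sup>+y. (\<integral>\<^sup>+x. ennreal (h (x - y)) \<partial>?M) * ennreal (q * (f y)\<^sup>2 / 2) \<partial>?M)"
        by (simp add: nn_integral_multc)
      also have "\<dots> \<le> (\<integral>\<^sup>+y. ennreal \<eta> * ennreal (q * (f y)\<^sup>2 / 2) \<partial>?M)"
        by (intro nn_integral_mono mult_right_mono h_x) simp
      also have "\<dots> = ennreal \<eta> * (\<integral>\<^sup>+y. ennreal (q * (f y)\<^sup>2 / 2) \<partial>?M)"
        by (rule nn_integral_cmult) measurable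
      finally show "(\<integral>\<^sup>+x. (\<integral>\<^sup>+y. ennreal (h (x - y)) * ennreal (q * (f y)\<^sup>2 / 2) \<partial>?M) \<partial>?M)
          \<le> ennreal \<eta> * ennreal (q * nsq f / 2)"
        by (simp only: fn)
      have "(\<integral>\<^sup>+x. (\<integral>\<^sup>+y. ennreal (h (x - y)) \<partial>?M) * ennreal ((v x)\<^sup>2 / q / 2) \<partial>?M)
          \<le> (\<integral>\<^sup>+x. ennreal \<eta> * ennreal ((v x)\<^sup>2 / q / 2) \<partial>?M)"
        by (intro nn_integral_mono mult_right_mono h_y) simp
      also have "\<dots> = ennreal \<eta> * (\<integral>\<^sup>+x. ennreal ((v x)\<^sup>2 / q / 2) \<partial>?M)"
        by (rule nn_integral_cmult) measurable
      finally show "(\<integral>\<^sup>+x. (\<integral>\<^sup>+y. ennreal (h (x - y)) \<partial>?M) * ennreal ((v x)\<^sup>2 / q / 2) \<partial>?M)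
          \<le> ennreal \<eta> * ennreal (nsq v / q / 2)"
        by (simp only: vn)
    qed
    also have "\<dots> = ennreal (\<eta> * Y)"
    proof -
      have "ennreal \<eta> * ennreal (q * nsq f / 2) + ennreal \<eta> * ennreal (nsq v / q / 2) = ennreal (\<eta> * (q * nsq f / 2) + \<eta> * (nsq v / q / 2))"
        using q \<eta> by (simp add: ennreal_mult[symmetric] ennreal_plus[symmetric] del: ennreal_plus)
      also have "\<eta> * (q * nsq f / 2) + \<eta> * (nsq v / q / 2) = \<eta> * Y"
        unfolding Y_def by (simp add: distrib_left add_divide_distrib)
      finally show ?thesis .
    qed
    finally show ?thesis .
  qed
  have iv: "integrable ?M (\<lambda>x. complex_of_real (v x) * w x)"
  proof (rule Bochner_Integration.integrable_bound)
    show "integrable ?M (\<lambda>x. B' * v x)" using vi by simp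
    have "\<bar>v x\<bar> * norm (w x) \<le> \<bar>B'\<bar> * \<bar>v x\<bar>" for x
    proof -
      have "norm (w x) \<le> \<bar>B'\<bar>" using B'[of x] by linarith
      then have "norm (w x) * \<bar>v x\<bar> \<le> \<bar>B'\<bar> * \<bar>v x\<bar>" by (rule mult_right_mono) simp
      then show ?thesis by (simp only: mult.commute[of "\<bar>v x\<bar>"])
    qed
    then show "AE x in ?M. norm (complex_of_real (v x) * w x) \<le> norm (B' * v x)"
      by (simp add: norm_mult abs_mult)
  qed simp
  have ivv: "integrable ?M (\<lambda>x. complex_of_real (v x) * complex_of_real (conv f x))"
  proof -
    have "integrable ?M (\<lambda>x. complex_of_real (v x * v x))"
      using L2_torusD(3)[OF vL] by (simp only: complex_of_real_integrable_eq power2_eq_square)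
    then show ?thesis by (simp only: of_real_mult v_def[symmetric])
  qed
  have id: "integrable ?M (\<lambda>x. complex_of_real (v x) * (complex_of_real (conv f x) - w x))"
    using iv ivv by (simp add: right_diff_distrib)
  have "complex_of_real (nsq v) = (\<integral>x. complex_of_real (v x) * complex_of_real (conv f x) \<partial>?M)"
    by (simp only: nsq_def power2_eq_square integral_complex_of_real[symmetric] of_real_mult v_def[symmetric])
  also have "\<dots> = (\<integral>x. complex_of_real (v x) * w x \<partial>?M) + (\<integral>x. complex_of_real (v x) * (complex_of_real (conv f x) - w x) \<partial>?M)"
    using iv ivv by (simp add: right_diff_distrib)
  finally have "norm (complex_of_real (nsq v)) \<le> norm (\<integral>x. complex_of_real (v x) * w x \<partial>?M)
     + norm (\<integral>x. complex_of_real (v x) * (complex_of_real (conv f x) - w x) \<partial>?M)"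
    by (metis norm_triangle_ineq)
  moreover have "norm (\<integral>x. complex_of_real (v x) * (complex_of_real (conv f x) - w x) \<partial>?M) \<le> \<eta> * Y"
  proof -
    have "ennreal (norm (\<integral>x. complex_of_real (v x) * (complex_of_real (conv f x) - w x) \<partial>?M)) \<le> ennreal (\<eta> * Y)"
      by (rule order_trans[OF integral_norm_bound_ennreal[OF id] err])
    then show ?thesis using \<eta> Y0 by (simp add: ennreal_le_iff)
  qed
  ultimately have "nsq v \<le> (q + \<eta>) * Y + \<eta> * Y" using main by simp
  also have "\<dots> = (q + 2 * \<eta>) * Y" by (simp add: algebra_simps)
  finally show ?thesis by (simp add: v_def Y_def)
qed

text \<open>As the approximation error tends to 0 there remains
  \<open>nsq (conv f) \<le> (q\<^sup>2 * nsq f + nsq (conv f)) / 2\<close>, and the last term is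
  absorbed on the left.\<close>

lemma nsq_conv_le_spectral:
  assumes f: "f \<in> L2_0" and q: "0 < q"
    and gap: "\<And>m. m \<noteq> 0 \<Longrightarrow> norm (fourier_coeff k m) \<le> q"
  shows "nsq (conv f) \<le> q\<^sup>2 * nsq f"
proof -
  define Y where "Y = (q * nsq f + nsq (conv f) / q) / 2"
  have Y0: "0 \<le> Y" using q by (simp add: Y_def)
  have "nsq (conv f) \<le> q * Y + e" if e: "0 < e" for e
  proof -
    \<comment> \<open>As \<open>\<eta>\<close> this makes \<open>2 * \<eta> * Y \<le> e\<close>; the
      summand 1 guards against \<open>Y = 0\<close>.\<close>
    have pos: "0 < e / (2 * (Y + 1))" using e Y0 by simp
    have "nsq (conv f) \<le> (q + 2 * (e / (2 * (Y + 1)))) * Y"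
      using nsq_conv_le_spectral_approx[OF f q pos gap] by (simp add: Y_def)
    also have "2 * (e / (2 * (Y + 1))) = e / (Y + 1)" using Y0 by (simp add: field_simps)
    also have "(q + e / (Y + 1)) * Y = q * Y + e * (Y / (Y + 1))" by (simp add: distrib_right)
    also have "\<dots> \<le> q * Y + e * 1" using e Y0 by (intro add_left_mono mult_left_mono) auto
    finally show ?thesis by simp
  qed
  then have "nsq (conv f) \<le> q * Y" by (rule field_le_epsilon)
  also have "q * Y = (q\<^sup>2 * nsq f + nsq (conv f)) / 2"
    using q by (simp add: Y_def power2_eq_square field_simps)
  finally show ?thesis by simp
qed

end

section \<open>Fourier coefficients of the periodized noise and the upper bound for
  \<open>tau\<close>\<close>

lemma fourier_coeff_gtilde:
  fixes g :: "real^'d \<Rightarrow> real"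
  assumes g: "noise_density g" and \<epsilon>: "0 < \<epsilon>"
  shows "fourier_coeff (gtilde g \<epsilon>) m = complex_of_real (Re (ghat g (\<epsilon> *\<^sub>R lat_vec m)))"
proof -
  interpret torus_kernel "gtilde g \<epsilon>" by (rule torus_kernel_gtilde[OF g \<epsilon>])
  note i = integrable_mult_cnj_character[OF integrable_k, of m]
  define c where "c x = cos (2 * pi * (lat_vec m \<bullet> x))" for x
  have [measurable]: "c \<in> borel_measurable borel" unfolding c_def by measurable
  have cper: "periodic_fun c"
    using character_periodic[of m] by (auto simp: periodic_fun_def c_def character_def cis.ctr)
  have ic: "integrable torus (\<lambda>x. gtilde g \<epsilon> x * c x)"
    by (rule integrable_k_bounded[where B=1]) (auto simp: c_def)
  \<comment> \<open>The transfer formula is for nonnegative integrands, hence its use for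
    \<open>1 - c\<close> rather than for the cosine itself.\<close>
  have "(\<integral>\<^sup>+x. ennreal (gtilde g \<epsilon> x) * ennreal (1 - c x) \<partial>torus)
      = (\<integral>\<^sup>+x. ennreal (g x) * ennreal (1 - c (\<epsilon> *\<^sub>R x)) \<partial>lborel)"
    using cper by (intro nn_integral_gtilde[OF g \<epsilon>]) (auto simp: periodic_fun_def)
  also have "\<dots> = (\<integral>\<^sup>+x. ennreal (g x * (1 - cos (2 * pi * (x \<bullet> (\<epsilon> *\<^sub>R lat_vec m))))) \<partial>lborel)"
    using noise_density_nonneg[OF g]
    by (intro nn_integral_cong) (simp add: c_def ennreal_mult inner_commute mult_ac)
  also have "\<dots> = ennreal (1 - Re (ghat g (\<epsilon> *\<^sub>R lat_vec m)))" by (rule nn_integral_one_minus_cos[OF g])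
  finally have A: "(\<integral>\<^sup>+x. ennreal (gtilde g \<epsilon> x) * ennreal (1 - c x) \<partial>torus)
     = ennreal (1 - Re (ghat g (\<epsilon> *\<^sub>R lat_vec m)))" .
  have "(\<integral>\<^sup>+x. ennreal (gtilde g \<epsilon> x) * ennreal (1 - c x) \<partial>torus)
     = (\<integral>\<^sup>+x. ennreal (gtilde g \<epsilon> x - gtilde g \<epsilon> x * c x) \<partial>torus)"
  proof (rule nn_integral_cong)
    fix x
    have "0 \<le> 1 - c x" by (simp add: c_def)
    then show "ennreal (gtilde g \<epsilon> x) * ennreal (1 - c x) = ennreal (gtilde g \<epsilon> x - gtilde g \<epsilon> x * c x)"
      by (subst ennreal_mult[symmetric]) (auto simp: k_nonneg algebra_simps)
  qed
  also have "\<dots> = ennreal (\<integral>x. gtilde g \<epsilon> x - gtilde g \<epsilon> x * c x \<partial>torus)"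
    using ic integrable_k k_nonneg
    by (intro nn_integral_eq_integral) (auto simp: c_def intro!: AE_I2 mult_left_le)
  also have "(\<integral>x. gtilde g \<epsilon> x - gtilde g \<epsilon> x * c x \<partial>torus) = 1 - (\<integral>x. gtilde g \<epsilon> x * c x \<partial>torus)"
    using ic integrable_k by (simp add: integral_k)
  finally have "ennreal (1 - (\<integral>x. gtilde g \<epsilon> x * c x \<partial>torus)) = ennreal (1 - Re (ghat g (\<epsilon> *\<^sub>R lat_vec m)))"
    using A by simp
  moreover have "(\<integral>x. gtilde g \<epsilon> x * c x \<partial>torus) \<le> 1"
    using integral_k_mult_le[of c 1] by (simp add: c_def)
  moreover note Re_ghat_le_1[OF g]
  ultimately have I: "(\<integral>x. gtilde g \<epsilon> x * c x \<partial>torus) = Re (ghat g (\<epsilon> *\<^sub>R lat_vec m))"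
    by (simp add: ennreal_inj)
  \<comment> \<open>Evenness of the kernel makes the coefficient its own conjugate.\<close>
  have "fourier_coeff (gtilde g \<epsilon>) m = (\<integral>x. complex_of_real (gtilde g \<epsilon> (- x)) * cnj (character m (- x)) \<partial>torus)"
    unfolding fourier_coeff_def
    using k_periodic character_periodic[of m]
    by (intro mpres_integral[OF mpres_uminus, symmetric]) (auto simp: periodic_fun_def)
  also have "\<dots> = (\<integral>x. cnj (complex_of_real (gtilde g \<epsilon> x) * cnj (character m x)) \<partial>torus)"
    by (simp add: k_even character_def cis_cnj)
  also have "\<dots> = cnj (fourier_coeff (gtilde g \<epsilon>) m)"
    unfolding fourier_coeff_def by (rule Bochner_Integration.integral_cnj)
  finally have real: "fourier_coeff (gtilde g \<epsilon>) m = complex_of_real (Re (fourier_coeff (gtilde g \<epsilon>) m))"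
    by (metis Reals_cnj_iff of_real_Re)
  have "Re (fourier_coeff (gtilde g \<epsilon>) m) = (\<integral>x. Re (complex_of_real (gtilde g \<epsilon> x) * cnj (character m x)) \<partial>torus)"
    unfolding fourier_coeff_def by (rule integral_Re[OF i, symmetric])
  also have "\<dots> = (\<integral>x. gtilde g \<epsilon> x * c x \<partial>torus)"
    by (simp add: c_def character_def)
  finally show ?thesis using real I by simp
qed

lemma lat_vec_norm_ge_1:
  assumes "m \<noteq> 0" shows "1 \<le> norm (lat_vec m)"
proof -
  obtain i where "m $ i \<noteq> 0" using assms by (auto simp: vec_eq_iff)
  then have "1 \<le> \<bar>lat_vec m $ i\<bar>" by (simp add: lat_vec_def)
  also have "\<dots> \<le> norm (lat_vec m)" by (rule component_le_norm_cart)
  finally show ?thesis .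
qed

text \<open>Nonzero lattice frequencies scaled by \<open>\<epsilon>\<close> have norm at least
  \<open>\<epsilon>\<close>, so each noise step contracts mean-zero functions by \<open>q\<close>,
  while composition with \<open>F\<close> preserves norm and mean.\<close>

lemma opnorm_Top_le:
  assumes g: "noise_density g" and \<epsilon>: "0 < \<epsilon>" and F: "mpres F" and q: "0 < q"
    and gap: "\<And>\<xi>. \<epsilon> \<le> norm \<xi> \<Longrightarrow> \<bar>Re (ghat g \<xi>)\<bar> \<le> q"
  shows "opnorm (Top g F \<epsilon> ^^ n) \<le> q ^ n"
proof (rule opnorm_le)
  interpret torus_kernel "gtilde g \<epsilon>" by (rule torus_kernel_gtilde[OF g \<epsilon>])
  show "0 \<le> q ^ n" using q by simp
  have gap': "norm (fourier_coeff (gtilde g \<epsilon>) m) \<le> q" if "m \<noteq> 0" for m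
    using gap[of "\<epsilon> *\<^sub>R lat_vec m"] lat_vec_norm_ge_1[OF that] \<epsilon>
    by (simp add: fourier_coeff_gtilde[OF g \<epsilon>])
  fix f :: "real^'a \<Rightarrow> real" assume f: "f \<in> L2_0"
  show "(Top g F \<epsilon> ^^ n) f \<in> L2_0 \<and> nsq ((Top g F \<epsilon> ^^ n) f) \<le> (q ^ n)\<^sup>2 * nsq f"
  proof (induction n)
    case (Suc n)
    let ?w = "(Top g F \<epsilon> ^^ n) f"
    have w: "?w \<in> L2_0" using Suc by blast
    have Uw: "Uop F ?w \<in> L2_0" by (rule Uop_L2_0[OF F w])
    have st: "(Top g F \<epsilon> ^^ Suc n) f = conv (Uop F ?w)"
      using Gop_eq_conv[OF g \<epsilon> L2_0D(1)[OF Uw]] by (simp add: Top_def)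
    have "nsq (conv (Uop F ?w)) \<le> q\<^sup>2 * nsq (Uop F ?w)"
      by (rule nsq_conv_le_spectral[OF Uw q gap'])
    also have "nsq (Uop F ?w) = nsq ?w" by (rule nsq_Uop[OF F L2_0D(1,2)[OF w]])
    also have "q\<^sup>2 * nsq ?w \<le> q\<^sup>2 * ((q ^ n)\<^sup>2 * nsq f)" using Suc by (intro mult_left_mono) auto
    also have "\<dots> = (q ^ Suc n)\<^sup>2 * nsq f" by (simp add: power_mult_distrib mult_ac)
    finally show ?case unfolding st using conv_L2_0[OF Uw] by blast
  qed (use f in simp)
qed

lemma tau_upper:
  fixes g :: "real^'d \<Rightarrow> real"
  assumes g: "noise_density g" and F: "mpres F" and \<alpha>: "0 < \<alpha>" and asymp: "fourier_asymp g \<alpha>"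
  shows "\<exists>K>0. \<forall>\<^sub>F \<epsilon> in at_right 0. tau g F \<epsilon> \<le> ereal (K * \<epsilon> powr (- \<alpha>))"
proof -
  obtain c where c: "0 < c" "\<forall>\<^sub>F \<epsilon> in at_right 0. 0 < \<epsilon> \<and> \<epsilon> < 1 \<and> c * \<epsilon> powr \<alpha> < 1 \<and>
       (\<forall>\<xi>. \<epsilon> \<le> norm \<xi> \<longrightarrow> \<bar>Re (ghat g \<xi>)\<bar> \<le> 1 - c * \<epsilon> powr \<alpha>)"
    using ghat_lattice_gap[OF g \<alpha> asymp] by blast
  from c(2) have "\<forall>\<^sub>F \<epsilon> in at_right 0. tau g F \<epsilon> \<le> ereal ((1 / c + 1) * \<epsilon> powr (- \<alpha>))"
  proof eventually_elim
    case (elim \<epsilon>)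
    define s where "s = c * \<epsilon> powr \<alpha>"
    have s: "0 < s" "s < 1" using elim c by (auto simp: s_def)
    \<comment> \<open>One above the floor, so that \<open>1 < real n * s\<close> and the norm falls
      strictly below \<open>exp (- 1)\<close>.\<close>
    define n where "n = nat \<lfloor>1 / s\<rfloor> + 1"
    have fl: "0 \<le> \<lfloor>1 / s\<rfloor>" using s by simp
    have n: "1 / s < real n" "real n \<le> 1 / s + 1" "1 \<le> n"
      using fl by (auto simp: n_def) linarith+
    have "opnorm (Top g F \<epsilon> ^^ n) \<le> (1 - s) ^ n"
      using elim s by (intro opnorm_Top_le[OF g _ F]) (auto simp: s_def)
    also have "\<dots> \<le> (exp (- s)) ^ n"
      using s exp_ge_add_one_self[of "- s"] by (intro power_mono) auto
    also have "\<dots> = exp (- (real n * s))" by (simp add: exp_of_nat_mult[symmetric])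
    also have "\<dots> < exp (- 1)" using n(1) s by (simp add: field_simps)
    finally have lt: "opnorm (Top g F \<epsilon> ^^ n) < exp (- 1)" .
    then have ex: "\<exists>n\<ge>1. opnorm (Top g F \<epsilon> ^^ n) < exp (- 1)" using n(3) by blast
    have "(LEAST n. n \<ge> 1 \<and> opnorm (Top g F \<epsilon> ^^ n) < exp (- 1)) \<le> n"
      using lt n(3) by (intro Least_le) simp
    then have "tau g F \<epsilon> \<le> ereal (real n)" unfolding tau_def if_P[OF ex] by simp
    \<comment> \<open>The extra 1 in the constant absorbs the rounding, as
      \<open>1 \<le> \<epsilon> powr (- \<alpha>)\<close>.\<close>
    also have "real n \<le> (1 / c + 1) * \<epsilon> powr (- \<alpha>)"
    proof -
      have "\<epsilon> powr \<alpha> \<le> 1" using elim \<alpha> by (intro powr_le1) auto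
      then have "1 \<le> \<epsilon> powr (- \<alpha>)" using elim by (simp add: powr_minus one_le_inverse)
      moreover have "1 / s = 1 / c * \<epsilon> powr (- \<alpha>)"
        by (simp add: s_def powr_minus divide_inverse)
      ultimately show ?thesis using n(2) by (simp only: distrib_right)
    qed
    finally show ?case by simp
  qed
  then show ?thesis using c(1) by (intro exI[of _ "1 / c + 1"]) (auto intro: add_pos_pos)
qed

theorem theorem2:
  fixes F :: "real^'d \<Rightarrow> real^'d" and g :: "real^'d \<Rightarrow> real" and \<alpha> :: real
  assumes F_lift: "torus_lift F" and F_C1: "C1_map F"
      and F_mp: "torus_measure_preserving F"
      and g_noise: "noise_density g"
      and \<alpha>_range: "0 < \<alpha>" "\<alpha> \<le> 2"
      and g_cond: "moment_finite g \<alpha> \<or> fourier_asymp g \<alpha>"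
  shows
   \<comment> \<open>(i)\<close>
   "(normD F 1 > 1 \<longrightarrow> (\<exists>c. \<forall>\<^sub>F \<epsilon> in at_right 0.
        tau g F \<epsilon> \<ge> ereal (min \<alpha> 1 / ln (normD F 1) * ln (1 / \<epsilon>) + c)))
  \<and> (muF F > 1 \<longrightarrow> (\<exists>\<mu> c. ereal \<mu> \<ge> muF F \<and> (\<forall>\<^sub>F \<epsilon> in at_right 0.
        tau_tilde g F \<epsilon> \<ge> ereal (min \<alpha> 1 / ln \<mu> * ln (1 / \<epsilon>) + c))))
  \<and> (torus_C1_diffeo F \<longrightarrow>
       (min (normD F 1) (normD (inv F) 1) > 1 \<longrightarrow> (\<exists>c. \<forall>\<^sub>F \<epsilon> in at_right 0.
          tau g F \<epsilon> \<ge> ereal (min \<alpha> 1 / ln (min (normD F 1) (normD (inv F) 1)) * ln (1 / \<epsilon>) + c)))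
     \<and> (min (muF F) (muF (inv F)) > 1 \<longrightarrow> (\<exists>\<mu> c. ereal \<mu> \<ge> min (muF F) (muF (inv F))
          \<and> (\<forall>\<^sub>F \<epsilon> in at_right 0.
          tau_tilde g F \<epsilon> \<ge> ereal (min \<alpha> 1 / ln \<mu> * ln (1 / \<epsilon>) + c)))))
   \<comment> \<open>(ii)\<close>
  \<and> (normD F 1 = 1 \<longrightarrow> (\<exists>C>0. \<forall>\<^sub>F \<epsilon> in at_right 0.
        ereal (\<epsilon> powr (- min \<alpha> 1)) \<le> ereal C * tau g F \<epsilon>))
  \<and> (normD F 1 = 1 \<and> fourier_asymp g \<alpha> \<and> \<alpha> \<le> 1 \<longrightarrow> (\<exists>C>0. \<forall>\<^sub>F \<epsilon> in at_right 0.
        ereal (\<epsilon> powr (- \<alpha>)) \<le> ereal C * tau g F \<epsilon>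
        \<and> tau g F \<epsilon> \<le> ereal (C * \<epsilon> powr (- \<alpha>))))
   \<comment> \<open>(iii)\<close>
  \<and> (\<forall>A \<beta>. muF F = 1 \<and> A > 0 \<and> \<beta> > 0 \<and> (\<forall>n\<ge>1. normD F n \<le> A * real n powr \<beta>) \<longrightarrow>
        (\<exists>C>0. \<forall>\<^sub>F \<epsilon> in at_right 0.
           ereal (\<epsilon> powr (- min \<alpha> 1 / \<beta>)) \<le> ereal C * tau_tilde g F \<epsilon>))
  \<and> ((\<exists>B. \<forall>n. normD F n \<le> B) \<longrightarrow> (\<forall>\<^sub>F \<epsilon> in at_right 0. tau_tilde g F \<epsilon> = \<infinity>))"
proof -
  have mp: "mpres F" by (rule mpres_C1_map[OF F_lift F_C1 F_mp])
  obtain C where C: "0 < C" "\<And>t. 0 \<le> t \<Longrightarrow> truncated_moment g t \<le> ennreal (C * t powr min \<alpha> 1)"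
    using truncated_moment_bound[OF g_noise \<alpha>_range(1) g_cond] by blast
  interpret noisy_map F g C "min \<alpha> 1"
    by standard (use F_lift F_C1 mp g_noise C \<alpha>_range in auto)
  \<comment> \<open>The witness is \<open>normD F 1\<close>, which exceeds 1 because
    \<open>muF F\<close> does.\<close>
  have tilde: "\<exists>\<mu> c. ereal \<mu> \<ge> muF F \<and> (\<forall>\<^sub>F \<epsilon> in at_right 0.
        tau_tilde g F \<epsilon> \<ge> ereal (min \<alpha> 1 / ln \<mu> * ln (1 / \<epsilon>) + c))" if "muF F > 1"
  proof -
    have "1 < ereal (normD F 1)" using that muF_le_normD[OF F_lift F_C1] by (rule less_le_trans)
    then show ?thesis using tau_tilde_lower muF_le_normD[OF F_lift F_C1] by auto
  qed
  \<comment> \<open>The smaller of the two norms decides between the direct and the adjoint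
    estimate.\<close>
  have diffeo: "\<exists>c. \<forall>\<^sub>F \<epsilon> in at_right 0.
      tau g F \<epsilon> \<ge> ereal (min \<alpha> 1 / ln (min (normD F 1) (normD (inv F) 1)) * ln (1 / \<epsilon>) + c)"
    if "torus_C1_diffeo F" "min (normD F 1) (normD (inv F) 1) > 1"
    using that tau_lower tau_lower_inverse by (cases "normD F 1 \<le> normD (inv F) 1") (auto simp: min_def)
  \<comment> \<open>The constant found for \<open>F\<close> alone already dominates the
    minimum.\<close>
  have diffeo_tilde: "\<exists>\<mu> c. ereal \<mu> \<ge> min (muF F) (muF (inv F)) \<and> (\<forall>\<^sub>F \<epsilon> in at_right 0.
      tau_tilde g F \<epsilon> \<ge> ereal (min \<alpha> 1 / ln \<mu> * ln (1 / \<epsilon>) + c))" if "min (muF F) (muF (inv F)) > 1"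
  proof -
    from that have "muF F > 1" by simp
    from tilde[OF this] obtain \<mu> c where "ereal \<mu> \<ge> muF F" "\<forall>\<^sub>F \<epsilon> in at_right 0.
        tau_tilde g F \<epsilon> \<ge> ereal (min \<alpha> 1 / ln \<mu> * ln (1 / \<epsilon>) + c)" by blast
    then show ?thesis by (intro exI[of _ \<mu>] exI[of _ c]) (auto simp: min_le_iff_disj)
  qed
  have sim: "\<exists>C>0. \<forall>\<^sub>F \<epsilon> in at_right 0. ereal (\<epsilon> powr (- \<alpha>)) \<le> ereal C * tau g F \<epsilon>
        \<and> tau g F \<epsilon> \<le> ereal (C * \<epsilon> powr (- \<alpha>))" if h: "normD F 1 = 1" "fourier_asymp g \<alpha>" "\<alpha> \<le> 1"
  proof -
    obtain K1 where K1: "K1 > 0" "\<forall>\<^sub>F \<epsilon> in at_right 0. ereal (\<epsilon> powr (- \<alpha>)) \<le> ereal K1 * tau g F \<epsilon>"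
      using tau_lower_neutral[OF h(1)] h(3) by (auto simp: min_def)
    obtain K2 where K2: "K2 > 0" "\<forall>\<^sub>F \<epsilon> in at_right 0. tau g F \<epsilon> \<le> ereal (K2 * \<epsilon> powr (- \<alpha>))"
      using tau_upper[OF g_noise mp \<alpha>_range(1) h(2)] by blast
    from K1(2) K2(2) have "\<forall>\<^sub>F \<epsilon> in at_right 0. ereal (\<epsilon> powr (- \<alpha>)) \<le> ereal (max K1 K2) * tau g F \<epsilon>
        \<and> tau g F \<epsilon> \<le> ereal (max K1 K2 * \<epsilon> powr (- \<alpha>))"
    proof eventually_elim
      case (elim \<epsilon>)
      have "0 \<le> tau g F \<epsilon>" by (simp add: tau_def)
      then have "ereal K1 * tau g F \<epsilon> \<le> ereal (max K1 K2) * tau g F \<epsilon>"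
        by (intro ereal_mult_right_mono) auto
      moreover have "K2 * \<epsilon> powr (- \<alpha>) \<le> max K1 K2 * \<epsilon> powr (- \<alpha>)" by (intro mult_right_mono) auto
      ultimately show ?case using elim by (meson ereal_less_eq(3) order_trans)
    qed
    then show ?thesis using K1(1) by (intro exI[of _ "max K1 K2"]) auto
  qed
  have poly: "\<exists>C>0. \<forall>\<^sub>F \<epsilon> in at_right 0. ereal (\<epsilon> powr (- min \<alpha> 1 / \<beta>)) \<le> ereal C * tau_tilde g F \<epsilon>"
    if "A > 0" "\<beta> > 0" "\<forall>n\<ge>1. normD F n \<le> A * real n powr \<beta>" for A \<beta>
    using tau_tilde_lower_polynomial that by blast
  have bounded: "\<forall>\<^sub>F \<epsilon> in at_right 0. tau_tilde g F \<epsilon> = \<infinity>" if "\<exists>B. \<forall>n. normD F n \<le> B"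
    using that tau_tilde_infinite by blast
  show ?thesis
    apply (intro conjI impI allI)
    subgoal by (rule tau_lower)
    subgoal by (rule tilde)
    subgoal by (rule diffeo)
    subgoal by (rule diffeo_tilde)
    subgoal by (rule tau_lower_neutral)
    subgoal using sim by blast
    subgoal using poly by blast
    subgoal by (rule bounded)
    done
qed

end
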